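(* Let $\mathbf{D},\mathbf{C}\in\mathbb{R}^{d\times d}$ satisfy Conditions (A)-(C) and the normalization that $\mathbf{D}$ is diagonal, $\mathbf{D}=\operatorname{diag}\{d_1,\dots,d_r,0,\dots,0\}$ with $d_j>0$, and $\frac{\mathbf{C}+\mathbf{C}^T}{2}=\mathbf{D}$, so that $f_\infty(x)=(2\pi)^{-d/2}e^{-|x|^2/2}$. Consider the Fokker-Planck equation $\partial_t f=\operatorname{div}(\mathbf{D}\nabla f+\mathbf{C}xf)$. Let $f_0\in L^1_+(\mathbb{R}^d)$ have unit mass and assume there exists $\epsilon>0$ such that $$\int_{\mathbb{R}^d}e^{\epsilon|x|^2}f_0(x)\,dx<\infty .$$ Let $f(t,x)$ be the solution with initial datum $f_0$. (i) For every $q>1$ there exists an explicit $t_0>0$, depending only on geometric constants of the problem (i.e. on $d,\mathbf{D},\mathbf{C}$, $q$ and $\epsilon$, but not otherwise on $f_0$), such that for all $t\ge t_0$ $$\int_{\mathbb{R}^d}f(t,x)^q f_\infty^{-1}(x)\,dx\le\Big(\frac{q}{\pi(q+1)}\Big)^{\frac{qd}{2}}\Big(\frac{8\pi^2}{q-1}\Big)^{\frac d2}\Big(\int_{\mathbb{R}^d}e^{\epsilon|x|^2}f_0(x)\,dx\Big)^q .$$ (ii) In particular, if $e_p(f_0|f_\infty)<\infty$ for some $1<p<2$, then $$e_2(f(t)|f_\infty)\le\frac12\Big(\Big(\frac{8\sqrt2}{3\cdot2^{\frac1p}}\Big)^d\big(p(p-1)e_p(f_0|f_\infty)+1\big)^{\frac2p}-1\Big)$$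 for all $t\ge\tilde t_0(p)$, where $\tilde t_0(p)>0$ can be given explicitly (it depends only on $d,\mathbf{D},\mathbf{C}$ and $p$).
   Context: Conditions: (A) $\mathbf{D}$ is (symmetric) positive semidefinite with $1\le r:=\operatorname{rank}\mathbf{D}\le d$. (B) All eigenvalues of $\mathbf{C}$ have positive real part. (C) There is no non-trivial $\mathbf{C}^T$-invariant subspace of $\operatorname{Ker}\mathbf{D}$. $L^1_+(\mathbb{R}^d)$ is the set of non-negative functions in $L^1(\mathbb{R}^d)$. Under (A)-(C), for $f_0\in L^1_+(\mathbb{R}^d)$ there is a unique classical solution $f\in C^\infty((0,\infty)\times\mathbb{R}^d)$ with initial datum $f_0$. $f_\infty$ denotes the unique unit mass stationary state, which under the normalization is the standard Gaussian. For $1<p\le2$, $\psi_p(y):=\frac{y^p-p(y-1)-1}{p(p-1)}$ and $e_p(f|f_\infty):=\int_{\mathbb{R}^d}\psi_p\big(\tfrac{f(x)}{f_\infty(x)}\big)f_\infty(x)\,dx$. *)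

theory Defs
  imports "HOL-Analysis.Analysis"
begin

text \<open>The dimension \<open>d\<close> is \<open>CARD('d)\<close>; vectors have type \<open>real^'d\<close>.\<close>

section \<open>Conditions on the coefficient matrices\<close>

definition cond_A :: "real^'d^'d \<Rightarrow> bool" where
  "cond_A D \<longleftrightarrow> transpose D = D \<and> (\<forall>x. 0 \<le> x \<bullet> (D *v x)) \<and>
     1 \<le> rank D \<and> rank D \<le> CARD('d)"

text \<open>The eigenvalues of a real matrix are its complex ones.\<close>

definition complex_mat :: "real^'d^'d \<Rightarrow> complex^'d^'d" where
  "complex_mat C = (\<chi> i j. complex_of_real (C $ i $ j))"

definition is_eigenvalue :: "complex^'d^'d \<Rightarrow> complex \<Rightarrow> bool" where
  "is_eigenvalue M l \<longleftrightarrow> (\<exists>v. v \<noteq> 0 \<and> M *v v = l *s v)"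

definition cond_B :: "real^'d^'d \<Rightarrow> bool" where
  "cond_B C \<longleftrightarrow> (\<forall>l. is_eigenvalue (complex_mat C) l \<longrightarrow> 0 < Re l)"

definition cond_C :: "real^'d^'d \<Rightarrow> real^'d^'d \<Rightarrow> bool" where
  "cond_C D C \<longleftrightarrow>
     \<not> (\<exists>V. subspace V \<and> V \<noteq> {0} \<and> V \<subseteq> {x. D *v x = 0} \<and>
          (\<forall>x\<in>V. transpose C *v x \<in> V))"

text \<open>\<open>D = diag {d\<^sub>1, \<dots>, d\<^sub>r, 0, \<dots>, 0}\<close> with \<open>r = rank D\<close> and \<open>d\<^sub>j > 0\<close>. The index type
  \<open>'d\<close> carries no order, so the set \<open>S\<close> of \<open>r\<close> indices plays the role of \<open>{1, \<dots>, r}\<close>.\<close>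

definition normalized :: "real^'d^'d \<Rightarrow> real^'d^'d \<Rightarrow> bool" where
  "normalized D C \<longleftrightarrow>
     (\<exists>S \<delta>. card S = rank D \<and> (\<forall>j\<in>S. 0 < \<delta> j) \<and>
        D = (\<chi> i j. if i = j \<and> i \<in> S then \<delta> i else 0)) \<and>
     (1/2) *\<^sub>R (C + transpose C) = D"

section \<open>The Fokker--Planck equation and its solutions\<close>

definition partial_deriv :: "'d \<Rightarrow> (real^'d \<Rightarrow> real) \<Rightarrow> real^'d \<Rightarrow> real" where
  "partial_deriv i g x = frechet_derivative g (at x) (axis i 1)"

definition gradient :: "(real^'d \<Rightarrow> real) \<Rightarrow> real^'d \<Rightarrow> real^'d" where
  "gradient g x = (\<chi> i. partial_deriv i g x)"

definition divergence :: "(real^'d \<Rightarrow> real^'d) \<Rightarrow> real^'d \<Rightarrow> real" where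
  "divergence F x = (\<Sum>i\<in>UNIV. partial_deriv i (\<lambda>y. F y $ i) x)"

text \<open>\<open>k\<close> times continuously differentiable on an open set.\<close>

primrec Ck_on :: "nat \<Rightarrow> 'a::euclidean_space set \<Rightarrow> ('a \<Rightarrow> real) \<Rightarrow> bool" where
  "Ck_on 0 S g \<longleftrightarrow> continuous_on S g"
| "Ck_on (Suc k) S g \<longleftrightarrow>
     (\<forall>x\<in>S. g differentiable (at x)) \<and>
     (\<forall>b\<in>Basis. Ck_on k S (\<lambda>x. frechet_derivative g (at x) b))"

definition Cinf_on :: "'a::euclidean_space set \<Rightarrow> ('a \<Rightarrow> real) \<Rightarrow> bool" where
  "Cinf_on S g \<longleftrightarrow> (\<forall>k. Ck_on k S g)"

definition L1_plus :: "(real^'d \<Rightarrow> real) \<Rightarrow> bool" where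
  "L1_plus g \<longleftrightarrow> integrable lborel g \<and> (AE x in lborel. 0 \<le> g x)"

text \<open>\<open>f\<close> is a classical solution on \<open>(0,\<infinity>)\<close> with initial datum \<open>f0\<close>, where the datum is
  attained in the sense that \<open>t \<mapsto> f(t)\<close>, extended by \<open>f0\<close> at \<open>t = 0\<close>, is a continuous curve
  \<open>[0,\<infinity>) \<rightarrow> L\<^sup>1\<close>. It is within this class that solutions are unique; the values of \<open>f\<close>
  at times \<open>t \<le> 0\<close> are irrelevant.\<close>

definition fp_solution ::
  "real^'d^'d \<Rightarrow> real^'d^'d \<Rightarrow> (real^'d \<Rightarrow> real) \<Rightarrow> (real \<Rightarrow> real^'d \<Rightarrow> real) \<Rightarrow> bool" where
  "fp_solution D C f0 f \<longleftrightarrow>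
     Cinf_on ({0<..} \<times> UNIV) (\<lambda>(t, x). f t x) \<and>
     (\<forall>t>0. \<forall>x. deriv (\<lambda>s. f s x) t =
        divergence (\<lambda>y. D *v gradient (f t) y + f t y *\<^sub>R (C *v y)) x) \<and>
     (\<forall>t>0. integrable lborel (f t)) \<and>
     (\<forall>t>0. ((\<lambda>s. LINT x|lborel. \<bar>f s x - f t x\<bar>) \<longlongrightarrow> 0) (at t)) \<and>
     ((\<lambda>s. LINT x|lborel. \<bar>f s x - f0 x\<bar>) \<longlongrightarrow> 0) (at_right 0)"

definition f_inf :: "real^'d \<Rightarrow> real" where
  "f_inf x = (2 * pi) powr (- real CARD('d) / 2) * exp (- (norm x)\<^sup>2 / 2)"

section \<open>Relative entropies\<close>

definition psi :: "real \<Rightarrow> real \<Rightarrow> real" where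
  "psi p y = (y powr p - p * (y - 1) - 1) / (p * (p - 1))"

text \<open>For \<open>1 < p\<close> one has \<open>psi p \<ge> 0\<close> on \<open>[0,\<infinity>)\<close>, so for non-negative \<open>f\<close> and positive
  \<open>g\<close> the conversion to \<open>ennreal\<close> truncates nothing and the entropy is well defined, possibly \<open>\<infinity>\<close>.\<close>

definition rel_entropy ::
  "real \<Rightarrow> (real^'d \<Rightarrow> real) \<Rightarrow> (real^'d \<Rightarrow> real) \<Rightarrow> ennreal" where
  "rel_entropy p f g = (\<integral>\<^sup>+x. ennreal (psi p (f x / g x) * g x) \<partial>lborel)"

end

theory Submission
  imports Defs "HOL-Probability.Probability"
begin

text \<open>For \<open>\<xi>\<^sub>t = exp (-t C\<^sup>T) \<xi>\<close> the functions
  \<open>exp (- (\<bar>\<xi>\<bar>\<^sup>2 - \<bar>\<xi>\<^sub>T\<^sub>-\<^sub>t\<bar>\<^sup>2) / 2) cos (\<xi>\<^sub>T\<^sub>-\<^sub>t \<bullet> x - c)\<close> solve the backward equation. Testing with them yields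
  the Fourier transform of any solution: with \<open>B = exp (-T C\<^sup>T)\<close>, the transform of \<open>f(T)\<close> at \<open>\<xi>\<close> is
  \<open>exp (- (\<bar>\<xi>\<bar>\<^sup>2 - \<bar>B \<xi>\<bar>\<^sup>2) / 2)\<close> times the transform of \<open>f\<^sub>0\<close> at \<open>B \<xi>\<close>. Condition (C) makes \<open>B\<close> a strict
  contraction and hence \<open>\<bar>B \<xi>\<bar>\<^sup>2 \<le> \<eta> \<bar>\<xi>\<bar>\<^sup>2\<close> for all large \<open>T\<close>, with \<open>\<eta>\<close> as small as desired. Inverting the transform,
  \<open>\<bar>f(T,a)\<bar> \<le> (1-\<eta>)\<^sup>-\<^sup>d\<^sup>/\<^sup>2 \<integral> f\<^sub>0(y) f\<^sub>\<infinity>(a - B\<^sup>T y) dy\<close>; splitting the square in the exponent bounds this by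
  a constant times \<open>exp (- (1-\<kappa>) \<bar>a\<bar>\<^sup>2 / 2) \<integral> exp (\<epsilon> \<bar>y\<bar>\<^sup>2) f\<^sub>0(y) dy\<close> as soon as \<open>\<eta> \<le> 2 \<kappa> \<epsilon>\<close>. The choice
  \<open>\<kappa> = (q-1)/(2q)\<close>, \<open>\<eta> \<le> (q-1)/(2q)\<close> gives exactly the constant in (i), and (ii) follows from the case
  \<open>q = 2\<close>, \<open>\<epsilon> = (p-1)/(4p)\<close> by Hoelder's inequality.\<close>

section \<open>Gaussian integrals and Fourier inversion\<close>

text \<open>Since C + C^T = 2D, the covariance of the transition law is I - exp(-TC) exp(-TC^T);
  this is why only |\<xi>|^2 - |B \<xi>|^2 enters and why the bounds need no information on C beyond
  the contraction constant \<eta>. The obstacle is the solution class. At each positive time f is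
  integrable, but nothing is assumed about its derivatives at infinity, and the drift Cx is
  unbounded, so a plane wave cannot be inserted into the equation directly: it has to be cut off,
  with an error that is small uniformly in x. At time 0 the datum is attained only in L^1, so the
  test functions must stay bounded. The inequality defining \<eta> involves C and T alone; fixing it
  before the datum makes the time threshold uniform in f0. Giving up a fraction \<kappa> of the
  Gaussian decay is affordable: after the q-th power and division by \<open>f_inf\<close>, the rate
  (q-1)/4 is still left, and this remaining Gaussian produces the second factor of the
  constant.\<close>

lemma lborel_integrable_product:
  fixes f :: "'a::euclidean_space \<Rightarrow> real \<Rightarrow> 'b::{real_normed_field,banach,second_countable_topology}"
  assumes "\<And>b. b \<in> Basis \<Longrightarrow> integrable lborel (f b)"
  shows "integrable lborel (\<lambda>x::'a. \<Prod>b\<in>Basis. f b (x \<bullet> b))"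
    and "(LINT x|lborel. (\<Prod>b\<in>Basis. f b ((x::'a) \<bullet> b))) = (\<Prod>b\<in>Basis. LINT x|lborel. f b x)"
proof -
  interpret product_sigma_finite "\<lambda>_::'a. lborel :: real measure" ..
  have [measurable]: "f b \<in> borel_measurable borel" if "b \<in> Basis" for b
    using borel_measurable_integrable[OF assms[OF that]] by simp
  have m: "(\<lambda>x::'a. \<Prod>b\<in>Basis. f b (x \<bullet> b)) \<in> borel_measurable borel" by measurable
  have eq: "(\<Prod>b\<in>Basis. f b ((\<Sum>c\<in>Basis. x c *\<^sub>R c) \<bullet> b)) = (\<Prod>b\<in>Basis. f b (x b))" for x :: "'a \<Rightarrow> real"
    by (intro prod.cong refl) simp
  show "integrable lborel (\<lambda>x::'a. \<Prod>b\<in>Basis. f b (x \<bullet> b))"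
    by (subst lborel_eq, subst integrable_distr_eq)
      (use m product_integrable_prod[of "Basis :: 'a set" f] assms in \<open>auto simp: eq\<close>)
  show "(LINT x|lborel. (\<Prod>b\<in>Basis. f b ((x::'a) \<bullet> b))) = (\<Prod>b\<in>Basis. LINT x|lborel. f b x)"
    by (subst lborel_eq, subst integral_distr)
      (use m product_integral_prod[of "Basis :: 'a set" f] assms in \<open>auto simp: eq\<close>)
qed

lemma norm_sq_eq_sum_Basis: "(norm (x::'a::euclidean_space))\<^sup>2 = (\<Sum>b\<in>Basis. (x \<bullet> b)\<^sup>2)"
  by (subst power2_norm_eq_inner, subst euclidean_inner) (simp add: power2_eq_square)

lemma exp_minus_norm_sq_eq_prod:
  "exp (- c * (norm (x::'a::euclidean_space))\<^sup>2) = (\<Prod>b\<in>Basis. exp (- c * (x \<bullet> b)\<^sup>2))"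
  by (simp add: norm_sq_eq_sum_Basis sum_distrib_left exp_sum sum_negf[symmetric])

lemma gaussian_1d:
  fixes c :: real
  assumes "0 < c"
  shows "integrable lborel (\<lambda>x::real. exp (- c * x\<^sup>2))"
    and "(LINT x|lborel. exp (- c * (x::real)\<^sup>2)) = sqrt (pi / c)"
proof -
  \<comment> \<open>The standard deviation with x^2 / (2 s^2) = c x^2, so that the integrand is a
    multiple of a normal density.\<close>
  define s where "s = sqrt (1 / (2 * c))"
  have s: "0 < s" "2 * s\<^sup>2 = 1 / c" using assms by (auto simp: s_def)
  have eq: "exp (- c * x\<^sup>2) = sqrt (pi / c) * normal_density 0 s x" for x
  proof -
    have "2 * pi * s\<^sup>2 = pi / c" using s(2) by (metis mult.assoc mult.left_commute times_divide_eq_right mult.right_neutral)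
    moreover have "- (x - 0)\<^sup>2 / (2 * s\<^sup>2) = - c * x\<^sup>2" using s(2) by simp
    ultimately show ?thesis using assms unfolding normal_density_def by simp
  qed
  show "integrable lborel (\<lambda>x::real. exp (- c * x\<^sup>2))"
    unfolding eq using s by simp
  show "(LINT x|lborel. exp (- c * (x::real)\<^sup>2)) = sqrt (pi / c)"
    unfolding eq using s by simp
qed

lemma gaussian_integral:
  assumes "0 < c"
  shows "integrable lborel (\<lambda>x::'a::euclidean_space. exp (- c * (norm x)\<^sup>2))"
    and "(LINT x|lborel. exp (- c * (norm (x::'a::euclidean_space))\<^sup>2)) = (pi / c) powr (real DIM('a) / 2)"
proof -
  show "integrable lborel (\<lambda>x::'a. exp (- c * (norm x)\<^sup>2))"
    unfolding exp_minus_norm_sq_eq_prod by (intro lborel_integrable_product gaussian_1d assms)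
  have "(LINT x|lborel. exp (- c * (norm (x::'a))\<^sup>2)) = (\<Prod>b\<in>(Basis::'a set). sqrt (pi / c))"
    unfolding exp_minus_norm_sq_eq_prod
    by (subst lborel_integrable_product(2)) (auto intro: gaussian_1d assms simp only: gaussian_1d(2)[OF assms])
  also have "\<dots> = (pi / c) powr (real DIM('a) / 2)"
    using assms by (simp add: powr_half_sqrt[symmetric] powr_powr powr_realpow[symmetric])
  finally show "(LINT x|lborel. exp (- c * (norm (x::'a))\<^sup>2)) = (pi / c) powr (real DIM('a) / 2)" .
qed

text \<open>The characteristic function of the standard normal law, with the normalizing factor
  removed.\<close>

lemma gaussian_iexp_1d:
  "integrable lborel (\<lambda>x::real. iexp (t * x) * complex_of_real (exp (- x\<^sup>2 / 2)))"
  "(LINT x|lborel. iexp (t * x) * complex_of_real (exp (- x\<^sup>2 / 2))) = complex_of_real (sqrt (2 * pi) * exp (- t\<^sup>2 / 2))"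
proof -
  have "integrable lborel (\<lambda>x::real. complex_of_real (exp (- (1/2) * x\<^sup>2)))"
    by (intro integrable_of_real gaussian_1d) simp
  then show i: "integrable lborel (\<lambda>x::real. iexp (t * x) * complex_of_real (exp (- x\<^sup>2 / 2)))"
    by (rule Bochner_Integration.integrable_bound) (auto simp: norm_mult)
  have "char std_normal_distribution t = (LINT x|lborel. complex_of_real (std_normal_density x) * iexp (t * x))"
    unfolding char_def
    by (subst integral_density) (auto simp: scaleR_conv_of_real)
  also have "\<dots> = (LINT x|lborel. complex_of_real (1 / sqrt (2 * pi)) * (iexp (t * x) * complex_of_real (exp (- x\<^sup>2 / 2))))"
    by (intro Bochner_Integration.integral_cong) (auto simp: std_normal_density_def)
  also have "\<dots> = complex_of_real (1 / sqrt (2 * pi)) * (LINT x|lborel. iexp (t * x) * complex_of_real (exp (- x\<^sup>2 / 2)))"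
    by (rule integral_mult_right_zero)
  finally have "complex_of_real (1 / sqrt (2 * pi)) * (LINT x|lborel. iexp (t * x) * complex_of_real (exp (- x\<^sup>2 / 2)))
     = complex_of_real (exp (- (t^2) / 2))"
    by (simp add: char_std_normal_distribution)
  then show "(LINT x|lborel. iexp (t * x) * complex_of_real (exp (- x\<^sup>2 / 2))) = complex_of_real (sqrt (2 * pi) * exp (- t\<^sup>2 / 2))"
    by (simp add: field_simps)
qed

lemma gaussian_iexp:
  fixes z :: "'a::euclidean_space"
  shows "integrable lborel (\<lambda>x::'a. iexp (x \<bullet> z) * complex_of_real (exp (- (norm x)\<^sup>2 / 2)))"
  "(LINT x|lborel. iexp (x \<bullet> z) * complex_of_real (exp (- (norm (x::'a))\<^sup>2 / 2)))
    = complex_of_real ((2 * pi) powr (real DIM('a) / 2) * exp (- (norm z)\<^sup>2 / 2))"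
proof -
  have eq: "iexp (x \<bullet> z) * complex_of_real (exp (- (norm x)\<^sup>2 / 2))
     = (\<Prod>b\<in>Basis. iexp ((z \<bullet> b) * (x \<bullet> b)) * complex_of_real (exp (- (x \<bullet> b)\<^sup>2 / 2)))" for x :: 'a
  proof -
    have "iexp (x \<bullet> z) = (\<Prod>b\<in>Basis. iexp ((z \<bullet> b) * (x \<bullet> b)))"
      by (subst exp_sum[symmetric], simp)
         (simp add: euclidean_inner[of x z] sum_distrib_left mult.commute)
    moreover have "exp (- (norm x)\<^sup>2 / 2) = (\<Prod>b\<in>Basis. exp (- (x \<bullet> b)\<^sup>2 / 2))"
      using exp_minus_norm_sq_eq_prod[of "1/2" x] by simp
    ultimately show ?thesis by (simp add: prod.distrib)
  qed
  show "integrable lborel (\<lambda>x::'a. iexp (x \<bullet> z) * complex_of_real (exp (- (norm x)\<^sup>2 / 2)))"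
    unfolding eq by (intro lborel_integrable_product gaussian_iexp_1d)
  have "(LINT x|lborel. iexp (x \<bullet> z) * complex_of_real (exp (- (norm (x::'a))\<^sup>2 / 2)))
     = (\<Prod>b\<in>(Basis::'a set). complex_of_real (sqrt (2 * pi) * exp (- (z \<bullet> b)\<^sup>2 / 2)))"
    unfolding eq by (subst lborel_integrable_product(2)) (auto intro: gaussian_iexp_1d simp only: gaussian_iexp_1d(2))
  also have "\<dots> = complex_of_real (sqrt (2 * pi) ^ DIM('a) * (\<Prod>b\<in>(Basis::'a set). exp (- (1/2) * (z \<bullet> b)\<^sup>2)))"
    by (simp add: prod.distrib)
  also have "\<dots> = complex_of_real ((2 * pi) powr (real DIM('a) / 2) * exp (- (norm z)\<^sup>2 / 2))"
    unfolding exp_minus_norm_sq_eq_prod[symmetric]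
    by (simp add: powr_half_sqrt[symmetric] powr_powr powr_realpow[symmetric])
  finally show "(LINT x|lborel. iexp (x \<bullet> z) * complex_of_real (exp (- (norm (x::'a))\<^sup>2 / 2)))
    = complex_of_real ((2 * pi) powr (real DIM('a) / 2) * exp (- (norm z)\<^sup>2 / 2))" .
qed

text \<open>Passing to real and imaginary parts keeps all later arguments real; a free phase inside
  a cosine then replaces the complex exponential.\<close>

lemma gaussian_cos_sin:
  fixes z :: "'a::euclidean_space"
  shows "integrable lborel (\<lambda>x. exp (- (norm x)\<^sup>2 / 2) * cos (x \<bullet> z))"
    "(LINT x|lborel. exp (- (norm x)\<^sup>2 / 2) * cos (x \<bullet> z)) = (2 * pi) powr (real DIM('a) / 2) * exp (- (norm z)\<^sup>2 / 2)"
    "integrable lborel (\<lambda>x. exp (- (norm x)\<^sup>2 / 2) * sin (x \<bullet> z))"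
    "(LINT x|lborel. exp (- (norm x)\<^sup>2 / 2) * sin (x \<bullet> z)) = 0"
proof -
  have re: "exp (- (norm x)\<^sup>2 / 2) * cos (x \<bullet> z) = Re (iexp (x \<bullet> z) * complex_of_real (exp (- (norm x)\<^sup>2 / 2)))" 
   and im: "exp (- (norm x)\<^sup>2 / 2) * sin (x \<bullet> z) = Im (iexp (x \<bullet> z) * complex_of_real (exp (- (norm x)\<^sup>2 / 2)))" for x
    by (auto simp: Re_exp Im_exp)
  note g = gaussian_iexp[of z]
  show "integrable lborel (\<lambda>x. exp (- (norm x)\<^sup>2 / 2) * cos (x \<bullet> z))" unfolding re by (rule integrable_Re[OF g(1)])
  show "integrable lborel (\<lambda>x. exp (- (norm x)\<^sup>2 / 2) * sin (x \<bullet> z))" unfolding im by (rule integrable_Im[OF g(1)])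
  show "(LINT x|lborel. exp (- (norm x)\<^sup>2 / 2) * cos (x \<bullet> z)) = (2 * pi) powr (real DIM('a) / 2) * exp (- (norm z)\<^sup>2 / 2)"
    unfolding re by (subst integral_Re[OF g(1)]) (simp only: g(2) Re_complex_of_real)
  show "(LINT x|lborel. exp (- (norm x)\<^sup>2 / 2) * sin (x \<bullet> z)) = 0"
    unfolding im by (subst integral_Im[OF g(1)]) (simp only: g(2) Im_complex_of_real)
qed

lemma lborel_translate:
  fixes g :: "'a::euclidean_space \<Rightarrow> real"
  assumes "integrable lborel g"
  shows "integrable lborel (\<lambda>x. g (u + x))" "(LINT x|lborel. g (u + x)) = (LINT x|lborel. g x)"
proof -
  have m: "g \<in> borel_measurable borel" using borel_measurable_integrable[OF assms] by simp
  have "integrable (distr lborel borel ((+) u)) g" by (subst lborel_distr_plus) (rule assms)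
  then show "integrable lborel (\<lambda>x. g (u + x))" by (subst (asm) integrable_distr_eq) (use m in auto)
  have "(LINT x|lborel. g x) = (LINT x|distr lborel borel ((+) u). g x)" by (subst lborel_distr_plus) simp
  then show "(LINT x|lborel. g (u + x)) = (LINT x|lborel. g x)" by (subst (asm) integral_distr) (use m in auto)
qed

text \<open>Completing the square moves the real shift \<open>u\<close> into the integration variable.\<close>

lemma gaussian_exp_cos:
  fixes u z :: "'a::euclidean_space"
  shows "integrable lborel (\<lambda>x. exp (- (norm x)\<^sup>2 / 2 + x \<bullet> u) * cos (x \<bullet> z))"
    "(LINT x|lborel. exp (- (norm x)\<^sup>2 / 2 + x \<bullet> u) * cos (x \<bullet> z))
      = (2 * pi) powr (real DIM('a) / 2) * exp (((norm u)\<^sup>2 - (norm z)\<^sup>2) / 2) * cos (u \<bullet> z)"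
proof -
  define h where "h x = exp ((norm u)\<^sup>2 / 2) * cos (u \<bullet> z) * (exp (- (norm x)\<^sup>2 / 2) * cos (x \<bullet> z))
      - exp ((norm u)\<^sup>2 / 2) * sin (u \<bullet> z) * (exp (- (norm x)\<^sup>2 / 2) * sin (x \<bullet> z))" for x
  have h: "integrable lborel h" unfolding h_def
    by (intro Bochner_Integration.integrable_diff integrable_mult_right gaussian_cos_sin)
  have ih: "integral\<^sup>L lborel h = (2 * pi) powr (real DIM('a) / 2) * exp (((norm u)\<^sup>2 - (norm z)\<^sup>2) / 2) * cos (u \<bullet> z)"
    unfolding h_def
    by (subst Bochner_Integration.integral_diff, (intro integrable_mult_right gaussian_cos_sin)+)
      (simp only: integral_mult_right_zero gaussian_cos_sin(2,4),
        simp add: diff_divide_distrib exp_diff exp_minus inverse_eq_divide)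
  have eq: "h (- u + x) = exp (- (norm x)\<^sup>2 / 2 + x \<bullet> u) * cos (x \<bullet> z)" for x
  proof -
    have "(norm (x - u))\<^sup>2 = (norm x)\<^sup>2 - 2 * (x \<bullet> u) + (norm u)\<^sup>2"
      by (simp add: power2_norm_eq_inner inner_diff_left inner_diff_right inner_commute)
    then have e: "exp ((norm u)\<^sup>2 / 2) * exp (- (norm (x - u))\<^sup>2 / 2) = exp (- (norm x)\<^sup>2 / 2 + x \<bullet> u)"
      by (subst exp_add[symmetric]) (simp add: field_simps)
    have "cos (x \<bullet> z) = cos (u \<bullet> z + (x - u) \<bullet> z)" by (simp add: inner_diff_left)
    then have "cos (x \<bullet> z) = cos (u \<bullet> z) * cos ((x - u) \<bullet> z) - sin (u \<bullet> z) * sin ((x - u) \<bullet> z)"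
      by (simp only: cos_add)
    moreover have "h (- u + x) = (exp ((norm u)\<^sup>2 / 2) * exp (- (norm (x - u))\<^sup>2 / 2)) *
        (cos (u \<bullet> z) * cos ((x - u) \<bullet> z) - sin (u \<bullet> z) * sin ((x - u) \<bullet> z))"
      unfolding h_def uminus_add_conv_diff by (simp only: right_diff_distrib mult_ac)
    ultimately show ?thesis using e by simp
  qed
  show "integrable lborel (\<lambda>x. exp (- (norm x)\<^sup>2 / 2 + x \<bullet> u) * cos (x \<bullet> z))"
    using lborel_translate(1)[OF h, of "-u"] by (simp only: eq)
  show "(LINT x|lborel. exp (- (norm x)\<^sup>2 / 2 + x \<bullet> u) * cos (x \<bullet> z))
      = (2 * pi) powr (real DIM('a) / 2) * exp (((norm u)\<^sup>2 - (norm z)\<^sup>2) / 2) * cos (u \<bullet> z)"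
    using lborel_translate(2)[OF h, of "-u"] by (simp only: eq ih)
qed

section \<open>Pointwise bound on the transition kernel\<close>

lemma integrable_pair_mult:
  fixes f g :: "'a::euclidean_space \<Rightarrow> real"
  assumes "integrable lborel f" "integrable lborel g"
  shows "integrable (lborel \<Otimes>\<^sub>M lborel) (\<lambda>(x, y). f x * g y)"
proof (rule lborel_pair.Fubini_integrable)
  have [measurable]: "f \<in> borel_measurable borel" "g \<in> borel_measurable borel"
    using assms[THEN borel_measurable_integrable] by simp_all
  show "(\<lambda>(x, y). f x * g y) \<in> borel_measurable (lborel \<Otimes>\<^sub>M lborel)" by measurable
  show "integrable lborel (\<lambda>x. LINT y|lborel. norm (case (x, y) of (x, y) \<Rightarrow> f x * g y))"
    using assms by (simp add: abs_mult)
  show "AE x in lborel. integrable lborel (\<lambda>y. case (x, y) of (x, y) \<Rightarrow> f x * g y)"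
    using assms by simp
qed

lemma linear_borel_measurable:
  fixes B :: "'a::euclidean_space \<Rightarrow> 'b::euclidean_space"
  assumes "linear B" shows "B \<in> borel_measurable borel"
  using assms by (intro borel_measurable_continuous_onI linear_continuous_on linear_conv_bounded_linear[THEN iffD1])

text \<open>From |B^T w|^2 = w . B B^T w \<le> |w| |B B^T w|, squaring and cancelling |B^T w|^2. The
  decay estimate concerns B acting on frequencies, whereas points are moved by the adjoint.\<close>

lemma norm_adjoint_sq_le:
  fixes B :: "'a::euclidean_space \<Rightarrow> 'a"
  assumes "linear B" "0 \<le> \<eta>" "\<And>\<xi>. (norm (B \<xi>))\<^sup>2 \<le> \<eta> * (norm \<xi>)\<^sup>2"
  shows "(norm (adjoint B w))\<^sup>2 \<le> \<eta> * (norm w)\<^sup>2"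
proof -
  let ?v = "adjoint B w"
  have "(norm ?v)\<^sup>2 = w \<bullet> B ?v"
    by (simp add: power2_norm_eq_inner adjoint_works[OF assms(1)] inner_commute)
  also have "\<dots> \<le> norm w * norm (B ?v)" by (rule norm_cauchy_schwarz)
  finally have "((norm ?v)\<^sup>2)\<^sup>2 \<le> (norm w)\<^sup>2 * (norm (B ?v))\<^sup>2"
    by (metis power_mono power_mult_distrib zero_le_power2)
  also have "\<dots> \<le> (norm w)\<^sup>2 * (\<eta> * (norm ?v)\<^sup>2)" by (intro mult_left_mono assms) auto
  finally have "(norm ?v)\<^sup>2 * (norm ?v)\<^sup>2 \<le> (\<eta> * (norm w)\<^sup>2) * (norm ?v)\<^sup>2"
    by (simp add: power2_eq_square mult_ac)
  then show ?thesis using assms(2) mult_right_le_imp_le[of "(norm ?v)\<^sup>2" "(norm ?v)\<^sup>2"]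
    by (cases "?v = 0") auto
qed

lemma gaussian_exp:
  fixes u :: "'a::euclidean_space"
  shows "integrable lborel (\<lambda>x. exp (- (norm x)\<^sup>2 / 2 + x \<bullet> u))"
    "(LINT x|lborel. exp (- (norm x)\<^sup>2 / 2 + x \<bullet> u)) = (2 * pi) powr (real DIM('a) / 2) * exp ((norm u)\<^sup>2 / 2)"
  using gaussian_exp_cos[of u 0] by simp_all

text \<open>Writing \<open>exp (\<bar>B \<xi>\<bar>\<^sup>2 / 2)\<close> as a Gaussian average of exponentials \<open>exp (w \<bullet> B \<xi>)\<close> turns the
  transform into an average of Gaussian transforms with a complex shift, whose modulus is explicit.
  This avoids inverting and taking the determinant of the covariance matrix.\<close>

lemma gaussian_kernel_bound:
  fixes B :: "'a::euclidean_space \<Rightarrow> 'a"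
  assumes lin: "linear B" and \<eta>: "0 \<le> \<eta>" "\<eta> < 1" and B: "\<And>\<xi>. (norm (B \<xi>))\<^sup>2 \<le> \<eta> * (norm \<xi>)\<^sup>2"
  shows "\<bar>LINT \<xi>|lborel. exp (- ((norm \<xi>)\<^sup>2 - (norm (B \<xi>))\<^sup>2) / 2) * cos (\<xi> \<bullet> z)\<bar>
    \<le> (2 * pi / (1 - \<eta>)) powr (real DIM('a) / 2) * exp (- (norm z)\<^sup>2 / 2)"
proof -
  define N where "N = (2 * pi) powr (real DIM('a) / 2)"
  have N: "0 < N" by (simp add: N_def)
  \<comment> \<open>The cross term \<open>w \<bullet> B \<xi>\<close> costs at most sqrt \<eta> / 2
    of each square; \<open>c\<close> is what remains of 1/2. It is positive because \<eta> < 1,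
    which makes the double integrand absolutely integrable.\<close>
  define c where "c = (1 - sqrt \<eta>) / 2"
  have c: "0 < c" using \<eta> by (simp add: c_def)
  define F where "F \<xi> w = exp (- (norm \<xi>)\<^sup>2 / 2 - (norm w)\<^sup>2 / 2 + w \<bullet> B \<xi>) * cos (\<xi> \<bullet> z)" for \<xi> w
  have [measurable]: "B \<in> borel_measurable borel" using lin by (rule linear_borel_measurable)
  have bound: "\<bar>F \<xi> w\<bar> \<le> exp (- c * (norm \<xi>)\<^sup>2) * exp (- c * (norm w)\<^sup>2)" for \<xi> w
  proof -
    have "norm (B \<xi>) \<le> sqrt \<eta> * norm \<xi>"
      using real_sqrt_le_mono[OF B[of \<xi>]] by (simp add: real_sqrt_mult)
    then have "w \<bullet> B \<xi> \<le> norm w * (sqrt \<eta> * norm \<xi>)"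
      by (meson norm_cauchy_schwarz mult_left_mono norm_ge_zero order_trans)
    also have "\<dots> = sqrt \<eta> * (norm w * norm \<xi>)" by simp
    also have "\<dots> \<le> sqrt \<eta> * (((norm w)\<^sup>2 + (norm \<xi>)\<^sup>2) / 2)"
      using sum_squares_bound[of "norm w" "norm \<xi>"] \<eta> by (intro mult_left_mono) auto
    finally have "- (norm \<xi>)\<^sup>2 / 2 - (norm w)\<^sup>2 / 2 + w \<bullet> B \<xi> \<le> - c * (norm \<xi>)\<^sup>2 + - c * (norm w)\<^sup>2"
      by (simp add: c_def field_simps)
    then have "exp (- (norm \<xi>)\<^sup>2 / 2 - (norm w)\<^sup>2 / 2 + w \<bullet> B \<xi>) \<le> exp (- c * (norm \<xi>)\<^sup>2) * exp (- c * (norm w)\<^sup>2)"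
      unfolding exp_add[symmetric] by simp
    moreover have "\<bar>F \<xi> w\<bar> \<le> exp (- (norm \<xi>)\<^sup>2 / 2 - (norm w)\<^sup>2 / 2 + w \<bullet> B \<xi>)"
      by (simp add: F_def abs_mult)
    ultimately show ?thesis by linarith
  qed
  have F: "integrable (lborel \<Otimes>\<^sub>M lborel) (\<lambda>(\<xi>, w). F \<xi> w)"
    by (rule Bochner_Integration.integrable_bound[OF integrable_pair_mult[OF gaussian_integral(1)[OF c] gaussian_integral(1)[OF c]]])
      (use bound in \<open>auto simp: F_def\<close>)
  have inner1: "(LINT w|lborel. F \<xi> w) = N * (exp (- ((norm \<xi>)\<^sup>2 - (norm (B \<xi>))\<^sup>2) / 2) * cos (\<xi> \<bullet> z))" for \<xi>
  proof -
    have "F \<xi> w = (exp (- (norm \<xi>)\<^sup>2 / 2) * cos (\<xi> \<bullet> z)) * exp (- (norm w)\<^sup>2 / 2 + w \<bullet> B \<xi>)" for w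
    proof -
      have "- (norm \<xi>)\<^sup>2 / 2 - (norm w)\<^sup>2 / 2 + w \<bullet> B \<xi> = - (norm \<xi>)\<^sup>2 / 2 + (- (norm w)\<^sup>2 / 2 + w \<bullet> B \<xi>)"
        by simp
      then show ?thesis unfolding F_def by (simp only: exp_add mult_ac)
    qed
    moreover have "exp (- ((norm \<xi>)\<^sup>2 - (norm (B \<xi>))\<^sup>2) / 2) = exp (- (norm \<xi>)\<^sup>2 / 2) * exp ((norm (B \<xi>))\<^sup>2 / 2)"
      by (simp add: exp_add[symmetric] field_simps)
    ultimately show ?thesis
      by (simp only: integral_mult_right_zero gaussian_exp N_def mult_ac)
  qed
  have inner2: "(LINT \<xi>|lborel. F \<xi> w) = exp (- (norm w)\<^sup>2 / 2) * (N * exp (((norm (adjoint B w))\<^sup>2 - (norm z)\<^sup>2) / 2) * cos (adjoint B w \<bullet> z))" for w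
  proof -
    have "F \<xi> w = exp (- (norm w)\<^sup>2 / 2) * (exp (- (norm \<xi>)\<^sup>2 / 2 + \<xi> \<bullet> adjoint B w) * cos (\<xi> \<bullet> z))" for \<xi>
    proof -
      have "w \<bullet> B \<xi> = \<xi> \<bullet> adjoint B w" by (simp add: adjoint_works[OF lin] inner_commute)
      then have "- (norm \<xi>)\<^sup>2 / 2 - (norm w)\<^sup>2 / 2 + w \<bullet> B \<xi> = - (norm w)\<^sup>2 / 2 + (- (norm \<xi>)\<^sup>2 / 2 + \<xi> \<bullet> adjoint B w)"
        by simp
      then show ?thesis unfolding F_def by (simp only: exp_add mult_ac)
    qed
    then show ?thesis by (simp only: integral_mult_right_zero gaussian_exp_cos N_def)
  qed
  \<comment> \<open>Absolute values are taken only after integrating over \<xi>, so the oscillation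
    has already produced exp (-|z|^2 / 2). The shift adds at most exp (\<eta> |w|^2 / 2), which exp
    (-|w|^2 / 2) absorbs.\<close>
  have ub: "norm (LINT \<xi>|lborel. F \<xi> w) \<le> N * exp (- (norm z)\<^sup>2 / 2) * exp (- ((1 - \<eta>) / 2) * (norm w)\<^sup>2)" for w
  proof -
    have "exp (- (norm w)\<^sup>2 / 2) * exp (((norm (adjoint B w))\<^sup>2 - (norm z)\<^sup>2) / 2)
       \<le> exp (- (norm z)\<^sup>2 / 2) * exp (- ((1 - \<eta>) / 2) * (norm w)\<^sup>2)"
      unfolding exp_add[symmetric] using norm_adjoint_sq_le[OF lin \<eta>(1) B, of w]
      by (simp add: field_simps)
    then have "N * (exp (- (norm w)\<^sup>2 / 2) * exp (((norm (adjoint B w))\<^sup>2 - (norm z)\<^sup>2) / 2)) * \<bar>cos (adjoint B w \<bullet> z)\<bar>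
       \<le> N * (exp (- (norm z)\<^sup>2 / 2) * exp (- ((1 - \<eta>) / 2) * (norm w)\<^sup>2)) * 1"
      by (rule mult_mono[OF mult_left_mono]) (use N in auto)
    moreover have "norm (LINT \<xi>|lborel. F \<xi> w)
       = N * (exp (- (norm w)\<^sup>2 / 2) * exp (((norm (adjoint B w))\<^sup>2 - (norm z)\<^sup>2) / 2)) * \<bar>cos (adjoint B w \<bullet> z)\<bar>"
      unfolding inner2 using N by (simp add: abs_mult)
    ultimately show ?thesis by (simp only: mult_1_right mult.assoc)
  qed
  have "N * (LINT \<xi>|lborel. exp (- ((norm \<xi>)\<^sup>2 - (norm (B \<xi>))\<^sup>2) / 2) * cos (\<xi> \<bullet> z)) = (LINT \<xi>|lborel. LINT w|lborel. F \<xi> w)"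
    unfolding inner1 by simp
  also have "\<dots> = (LINT w|lborel. LINT \<xi>|lborel. F \<xi> w)"
    using lborel_pair.Fubini_integral[OF F] by simp
  finally have eq: "N * (LINT \<xi>|lborel. exp (- ((norm \<xi>)\<^sup>2 - (norm (B \<xi>))\<^sup>2) / 2) * cos (\<xi> \<bullet> z)) = (LINT w|lborel. LINT \<xi>|lborel. F \<xi> w)" .
  have "N * \<bar>LINT \<xi>|lborel. exp (- ((norm \<xi>)\<^sup>2 - (norm (B \<xi>))\<^sup>2) / 2) * cos (\<xi> \<bullet> z)\<bar> = \<bar>LINT w|lborel. LINT \<xi>|lborel. F \<xi> w\<bar>"
    unfolding eq[symmetric] using N by (simp add: abs_mult)
  also have "\<dots> \<le> (LINT w|lborel. N * exp (- (norm z)\<^sup>2 / 2) * exp (- ((1 - \<eta>) / 2) * (norm (w::'a))\<^sup>2))"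
    unfolding real_norm_def[symmetric]
  proof (rule Bochner_Integration.integral_norm_bound_integral)
    show "integrable lborel (\<lambda>w. LINT \<xi>|lborel. F \<xi> w)"
      using lborel_pair.integrable_snd[OF F] by simp
    show "integrable lborel (\<lambda>w::'a. N * exp (- (norm z)\<^sup>2 / 2) * exp (- ((1 - \<eta>) / 2) * (norm w)\<^sup>2))"
      using \<eta> by (intro integrable_mult_right gaussian_integral(1)) simp
  qed (use ub in simp)
  also have "\<dots> = N * (exp (- (norm z)\<^sup>2 / 2) * (2 * pi / (1 - \<eta>)) powr (real DIM('a) / 2))"
    using \<eta> by (subst integral_mult_right_zero, subst gaussian_integral(2)) (simp_all add: mult_ac)
  finally show ?thesis using N by (simp add: mult_ac)
qed

section \<open>Pointwise Fourier inversion by Gaussian summation\<close>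

lemma lborel_scale:
  fixes g :: "'a::euclidean_space \<Rightarrow> real"
  assumes "0 < c" and [measurable]: "g \<in> borel_measurable borel"
  shows "(LINT x|lborel. g (t + c *\<^sub>R x)) = (LINT x|lborel. g x) / c ^ DIM('a)"
proof -
  have "(LINT x|lborel. g x) = (LINT x|density (distr lborel borel (\<lambda>x. t + c *\<^sub>R x)) (\<lambda>_. ennreal (\<bar>c\<bar> ^ DIM('a))). g x)"
    using assms by (subst lborel_affine[of c t]) auto
  also have "\<dots> = c ^ DIM('a) * (LINT x|lborel. g (t + c *\<^sub>R x))"
    using assms(1) by (subst integral_density) (auto simp: integral_distr)
  finally show ?thesis using assms(1) by simp
qed

lemma gaussian_cos_scaled:
  fixes w :: "'a::euclidean_space"
  assumes s: "0 < s"
  shows "(LINT \<xi>|lborel. exp (- (norm (s *\<^sub>R \<xi>))\<^sup>2 / 2) * cos (\<xi> \<bullet> w))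
     = (2 * pi) powr (real DIM('a) / 2) * exp (- (norm (w /\<^sub>R s))\<^sup>2 / 2) / s ^ DIM('a)"
proof -
  have "(LINT \<xi>|lborel. exp (- (norm (s *\<^sub>R \<xi>))\<^sup>2 / 2) * cos (\<xi> \<bullet> w))
    = (LINT \<xi>|lborel. exp (- (norm (0 + s *\<^sub>R \<xi>))\<^sup>2 / 2) * cos ((0 + s *\<^sub>R \<xi>) \<bullet> (w /\<^sub>R s)))"
    using s by (simp add: mult.assoc[symmetric])
  also have "\<dots> = (LINT \<xi>|lborel. exp (- (norm \<xi>)\<^sup>2 / 2) * cos (\<xi> \<bullet> (w /\<^sub>R s))) / s ^ DIM('a)"
    by (rule lborel_scale[OF s]) simp
  finally show ?thesis unfolding gaussian_cos_sin(2) .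
qed

text \<open>Damping the frequency integral by exp (-|s \<xi>|^2 / 2) makes Fubini applicable and
  turns it into a Gaussian average of \<open>u\<close> around \<open>a\<close> at scale s; both
  sides are then compared as s tends to 0. Including \<open>a\<close> in the phase selects the real
  part of the inversion formula.\<close>

lemma fourier_inversion_cos:
  fixes u :: "'a::euclidean_space \<Rightarrow> real"
  assumes u: "integrable lborel u" and cont: "isCont u a"
    and \<Phi>: "integrable lborel (\<lambda>\<xi>. LINT x|lborel. u x * cos (\<xi> \<bullet> (x - a)))"
  shows "(LINT \<xi>|lborel. LINT x|lborel. u x * cos (\<xi> \<bullet> (x - a))) = (2 * pi) ^ DIM('a) * u a"
proof (rule LIMSEQ_unique)
  define N where "N = (2 * pi) powr (real DIM('a) / 2)"
  have N: "0 < N" "N * N = (2 * pi) ^ DIM('a)"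
    by (simp_all add: N_def powr_add[symmetric] powr_realpow)
  have [measurable]: "u \<in> borel_measurable borel" using borel_measurable_integrable[OF u] by simp
  define \<Phi>' where "\<Phi>' \<xi> = (LINT x|lborel. u x * cos (\<xi> \<bullet> (x - a)))" for \<xi>
  have \<Phi>': "integrable lborel \<Phi>'" using \<Phi> by (simp add: \<Phi>'_def[abs_def])
  then have [measurable]: "\<Phi>' \<in> borel_measurable borel" using borel_measurable_integrable by force
  define s :: "nat \<Rightarrow> real" where "s n = 1 / real (Suc n)" for n
  have s: "0 < s n" for n by (simp add: s_def)
  have s0: "s \<longlonglongrightarrow> 0" unfolding s_def by (rule LIMSEQ_Suc[OF lim_1_over_n])
  define I where "I n = (LINT \<xi>|lborel. exp (- (norm (s n *\<^sub>R \<xi>))\<^sup>2 / 2) * \<Phi>' \<xi>)" for n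
  show "I \<longlonglongrightarrow> (LINT \<xi>|lborel. LINT x|lborel. u x * cos (\<xi> \<bullet> (x - a)))"
    unfolding \<Phi>'_def[symmetric] I_def
  proof (rule integral_dominated_convergence[where w = "\<lambda>\<xi>. \<bar>\<Phi>' \<xi>\<bar>"])
    show "AE \<xi> in lborel. (\<lambda>n. exp (- (norm (s n *\<^sub>R \<xi>))\<^sup>2 / 2) * \<Phi>' \<xi>) \<longlonglongrightarrow> \<Phi>' \<xi>"
      by (intro AE_I2) (auto intro!: tendsto_eq_intros s0)
  qed (use \<Phi>' in \<open>auto simp: abs_mult intro!: mult_left_le_one_le\<close>)
  define A where "A n v = (LINT x|lborel. v x * (exp (- (norm ((x - a) /\<^sub>R s n))\<^sup>2 / 2) / s n ^ DIM('a)))" for n v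
  have I: "I n = N * A n u" for n
  proof -
    let ?F = "\<lambda>(\<xi>, x). (exp (- (norm (s n *\<^sub>R \<xi>))\<^sup>2 / 2) * u x) * cos (\<xi> \<bullet> (x - a))"
    have g: "integrable lborel (\<lambda>\<xi>::'a. exp (- (norm (s n *\<^sub>R \<xi>))\<^sup>2 / 2))"
      using gaussian_integral(1)[of "(s n)\<^sup>2 / 2", where 'a='a] s[of n] by (simp add: power_mult_distrib)
    have F: "integrable (lborel \<Otimes>\<^sub>M lborel) ?F"
      by (rule Bochner_Integration.integrable_bound[OF integrable_pair_mult[OF g u]])
        (auto simp: abs_mult split_beta simp del: norm_scaleR intro!: mult_right_le_one_le)
    have "I n = (LINT \<xi>|lborel. LINT x|lborel. (exp (- (norm (s n *\<^sub>R \<xi>))\<^sup>2 / 2) * u x) * cos (\<xi> \<bullet> (x - a)))"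
      unfolding I_def \<Phi>'_def by (simp add: mult.assoc)
    also have "\<dots> = (LINT x|lborel. LINT \<xi>|lborel. (exp (- (norm (s n *\<^sub>R \<xi>))\<^sup>2 / 2) * u x) * cos (\<xi> \<bullet> (x - a)))"
      using lborel_pair.Fubini_integral[OF F] by simp
    also have "\<dots> = (LINT x|lborel. u x * (LINT \<xi>|lborel. exp (- (norm (s n *\<^sub>R \<xi>))\<^sup>2 / 2) * cos (\<xi> \<bullet> (x - a))))"
      by (subst integral_mult_right_zero[symmetric]) (simp add: mult_ac)
    also have "\<dots> = N * A n u"
      unfolding gaussian_cos_scaled[OF s] A_def integral_mult_right_zero[symmetric] N_def by (simp add: mult_ac)
    finally show ?thesis .
  qed
  obtain \<delta> where \<delta>: "0 < \<delta>" "\<And>x. dist x a < \<delta> \<Longrightarrow> \<bar>u x - u a\<bar> < 1"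
    using cont unfolding continuous_at_eps_delta dist_real_def by (meson zero_less_one)
  \<comment> \<open>Boundedness of \<open>u\<close> is known only near \<open>a\<close>: the near
    part is treated by dominated convergence, the far part by smallness of the kernel away from
    \<open>a\<close>.\<close>
  define v where "v x = (if dist x a < \<delta> then u x else 0)" for x
  define w where "w x = (if dist x a < \<delta> then 0 else u x)" for x
  have [measurable]: "v \<in> borel_measurable borel" "w \<in> borel_measurable borel"
    unfolding v_def w_def by measurable
  have uvw: "u x = v x + w x" for x by (simp add: v_def w_def)
  have gb: "exp (- (norm ((x - a) /\<^sub>R s n))\<^sup>2 / 2) / s n ^ DIM('a) \<le> 1 / s n ^ DIM('a)" for x n
    using s by (intro divide_right_mono) (auto simp: less_imp_le)
  have "integrable lborel (\<lambda>x. r x * (exp (- (norm ((x - a) /\<^sub>R s n))\<^sup>2 / 2) / s n ^ DIM('a)))"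
    if [measurable]: "r \<in> borel_measurable borel" and r: "\<And>x. \<bar>r x\<bar> \<le> \<bar>u x\<bar>" for r n
  proof (rule Bochner_Integration.integrable_bound[where f = "\<lambda>x. u x * (1 / s n ^ DIM('a))"])
    show "integrable lborel (\<lambda>x. u x * (1 / s n ^ DIM('a)))" by (intro integrable_mult_left u)
    show "AE x in lborel. norm (r x * (exp (- (norm ((x - a) /\<^sub>R s n))\<^sup>2 / 2) / s n ^ DIM('a)))
        \<le> norm (u x * (1 / s n ^ DIM('a)))"
    proof (rule AE_I2)
      fix x
      have "0 \<le> exp (- (norm ((x - a) /\<^sub>R s n))\<^sup>2 / 2) / s n ^ DIM('a)" using s[of n] by simp
      then have "norm (exp (- (norm ((x - a) /\<^sub>R s n))\<^sup>2 / 2) / s n ^ DIM('a)) \<le> norm (1 / s n ^ DIM('a))"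
        using gb[of n x] unfolding real_norm_def by linarith
      then show "norm (r x * (exp (- (norm ((x - a) /\<^sub>R s n))\<^sup>2 / 2) / s n ^ DIM('a))) \<le> norm (u x * (1 / s n ^ DIM('a)))"
        unfolding norm_mult by (intro mult_mono) (use r in auto)
    qed
  qed measurable
  then have iv: "integrable lborel (\<lambda>x. v x * (exp (- (norm ((x - a) /\<^sub>R s n))\<^sup>2 / 2) / s n ^ DIM('a)))"
   and iw: "integrable lborel (\<lambda>x. w x * (exp (- (norm ((x - a) /\<^sub>R s n))\<^sup>2 / 2) / s n ^ DIM('a)))" for n
    by (simp_all add: v_def w_def)
  have A: "A n u = A n v + A n w" for n
    unfolding A_def uvw distrib_right by (rule Bochner_Integration.integral_add[OF iv iw])
  have "(\<lambda>n. A n v) \<longlonglongrightarrow> (LINT y|lborel. u a * exp (- (1/2) * (norm (y::'a))\<^sup>2))"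
  proof -
    have "A n v = (LINT y|lborel. v (a + s n *\<^sub>R y) * exp (- (1/2) * (norm y)\<^sup>2))" for n
    proof -
      have "A n v = (LINT x|lborel. v x * exp (- (norm ((x - a) /\<^sub>R s n))\<^sup>2 / 2)) / s n ^ DIM('a)"
        unfolding A_def by simp
      also have "\<dots> = (LINT y|lborel. v (a + s n *\<^sub>R y) * exp (- (norm ((a + s n *\<^sub>R y - a) /\<^sub>R s n))\<^sup>2 / 2))"
        by (rule lborel_scale[OF s, symmetric]) measurable
      finally show ?thesis using s[of n] by (simp del: of_nat_Suc)
    qed
    moreover have "(\<lambda>n. LINT y|lborel. v (a + s n *\<^sub>R y) * exp (- (1/2) * (norm y)\<^sup>2)) \<longlonglongrightarrow> (LINT y|lborel. u a * exp (- (1/2) * (norm (y::'a))\<^sup>2))"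
    proof (rule integral_dominated_convergence[where w = "\<lambda>y::'a. (\<bar>u a\<bar> + 1) * exp (- (1/2) * (norm y)\<^sup>2)"])
      show "integrable lborel (\<lambda>y::'a. (\<bar>u a\<bar> + 1) * exp (- (1/2) * (norm y)\<^sup>2))"
        by (intro integrable_mult_right gaussian_integral(1)) simp
      have "\<bar>v x\<bar> \<le> \<bar>u a\<bar> + 1" for x using \<delta>(2)[of x] by (auto simp: v_def)
      then show "AE y in lborel. norm (v (a + s n *\<^sub>R y) * exp (- (1/2) * (norm y)\<^sup>2)) \<le> (\<bar>u a\<bar> + 1) * exp (- (1/2) * (norm y)\<^sup>2)" for n
        by (intro AE_I2) (auto simp: abs_mult intro!: mult_right_mono)
      have "(\<lambda>n. v (a + s n *\<^sub>R y)) \<longlonglongrightarrow> u a" for y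
      proof -
        have l: "(\<lambda>n. a + s n *\<^sub>R y) \<longlonglongrightarrow> a" by (auto intro!: tendsto_eq_intros s0)
        have "(\<lambda>n. u (a + s n *\<^sub>R y)) \<longlonglongrightarrow> u a" using isCont_tendsto_compose[OF cont l] .
        moreover have "\<forall>\<^sub>F n in sequentially. u (a + s n *\<^sub>R y) = v (a + s n *\<^sub>R y)"
          using tendstoD[OF l \<delta>(1)] by eventually_elim (simp add: v_def)
        ultimately show ?thesis by (rule Lim_transform_eventually)
      qed
      then show "AE y in lborel. (\<lambda>n. v (a + s n *\<^sub>R y) * exp (- (1/2) * (norm y)\<^sup>2)) \<longlonglongrightarrow> u a * exp (- (1/2) * (norm y)\<^sup>2)"
        by (intro AE_I2 tendsto_mult) auto
    qed simp_all
    ultimately show ?thesis by simp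
  qed
  then have Av: "(\<lambda>n. A n v) \<longlonglongrightarrow> u a * N"
    by (simp add: gaussian_integral(2)[of "1/2", simplified] N_def mult.commute)
  \<comment> \<open>Bounds the averaging kernel at distance at least \<delta> from \<open>a\<close>;
    the Gaussian factor beats the growth of the normalization 1 / s^d.\<close>
  define k where "k n = exp (- (\<delta> * real (Suc n))\<^sup>2 / 2) * real (Suc n) ^ DIM('a)" for n
  have Aw: "(\<lambda>n. A n w) \<longlonglongrightarrow> 0"
  proof (rule Lim_null_comparison)
    show "\<forall>\<^sub>F n in sequentially. norm (A n w) \<le> (LINT x|lborel. \<bar>u x\<bar>) * k n"
    proof (intro always_eventually allI)
      fix n
      have "norm (A n w) \<le> (LINT x|lborel. \<bar>u x\<bar> * k n)"
        unfolding A_def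
      proof (rule Bochner_Integration.integral_norm_bound_integral[OF iw])
        show "integrable lborel (\<lambda>x. \<bar>u x\<bar> * k n)" using u by simp
        fix x
        show "norm (w x * (exp (- (norm ((x - a) /\<^sub>R s n))\<^sup>2 / 2) / s n ^ DIM('a))) \<le> \<bar>u x\<bar> * k n"
        proof (cases "dist x a < \<delta>")
          case False
          then have "\<delta> * real (Suc n) \<le> norm ((x - a) /\<^sub>R s n)"
            by (simp add: s_def dist_norm mult.commute mult_left_mono)
          then have "(\<delta> * real (Suc n))\<^sup>2 \<le> (norm ((x - a) /\<^sub>R s n))\<^sup>2" using \<delta>(1) by (intro power_mono) auto
          then have "exp (- (norm ((x - a) /\<^sub>R s n))\<^sup>2 / 2) / s n ^ DIM('a) \<le> k n"
            unfolding k_def s_def power_one_over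
            by (simp del: of_nat_Suc norm_scaleR add: mult_right_mono)
          then have "\<bar>w x\<bar> * (exp (- (norm ((x - a) /\<^sub>R s n))\<^sup>2 / 2) / s n ^ DIM('a)) \<le> \<bar>u x\<bar> * k n"
            using s[of n] by (intro mult_mono) (auto simp: w_def)
          then show ?thesis using s[of n] by (simp add: abs_mult)
        qed (simp add: w_def k_def)
      qed
      then show "norm (A n w) \<le> (LINT x|lborel. \<bar>u x\<bar>) * k n" by simp
    qed
    have "(\<lambda>n. k n) \<longlonglongrightarrow> 0"
    proof -
      \<comment> \<open>Replacing (n+1)^2 by n+1 in the exponent reduces the claim to the standard
        limit x^d / exp x \<rightarrow> 0 with x = c (n+1).\<close>
      define c where "c = \<delta>\<^sup>2 / 2"
      have c: "0 < c" using \<delta>(1) by (simp add: c_def)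
      have "filterlim (\<lambda>n. c * real (Suc n)) at_top sequentially"
        by (intro filterlim_tendsto_pos_mult_at_top[OF tendsto_const c] filterlim_compose[OF filterlim_real_sequentially filterlim_Suc])
      from filterlim_compose[OF tendsto_power_div_exp_0[of "DIM('a)"] this]
      have l: "(\<lambda>n. (c * real (Suc n)) ^ DIM('a) / exp (c * real (Suc n)) * (1 / c ^ DIM('a))) \<longlonglongrightarrow> 0"
        by (intro tendsto_mult_left_zero)
      show ?thesis
      proof (rule Lim_null_comparison[OF _ l], intro always_eventually allI)
        fix n
        have "c * real (Suc n) \<le> (\<delta> * real (Suc n))\<^sup>2 / 2"
          using mult_left_mono[of "real (Suc n)" "(real (Suc n))\<^sup>2" c] c
          by (simp add: c_def power_mult_distrib) (simp add: power2_eq_square)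
        then have "k n \<le> exp (- (c * real (Suc n))) * real (Suc n) ^ DIM('a)"
          unfolding k_def by (intro mult_right_mono) auto
        also have "\<dots> = (c * real (Suc n)) ^ DIM('a) / exp (c * real (Suc n)) * (1 / c ^ DIM('a))"
          using c by (simp add: power_mult_distrib exp_minus divide_inverse mult_ac del: of_nat_Suc)
        finally show "norm (k n) \<le> (c * real (Suc n)) ^ DIM('a) / exp (c * real (Suc n)) * (1 / c ^ DIM('a))"
          by (simp add: k_def)
      qed
    qed
    then show "(\<lambda>n. (LINT x|lborel. \<bar>u x\<bar>) * k n) \<longlonglongrightarrow> 0" by (intro tendsto_mult_right_zero)
  qed
  have "(\<lambda>n. N * (A n v + A n w)) \<longlonglongrightarrow> N * (u a * N + 0)" by (intro tendsto_intros Av Aw)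
  then show "I \<longlonglongrightarrow> (2 * pi) ^ DIM('a) * u a"
    unfolding N(2)[symmetric] I[abs_def] A by (simp add: mult_ac)
qed

section \<open>The matrix flow and its decay\<close>

text \<open>The vector exp (t A) v, taken as a real power series in each coordinate, so that
  termwise differentiation of scalar series yields the differential equation.\<close>

definition mat_flow :: "real^'n^'n \<Rightarrow> real \<Rightarrow> real^'n \<Rightarrow> real^'n" where
  "mat_flow A t v = (\<chi> i. \<Sum>k. (((*v) A ^^ k) v $ i / fact k) * t ^ k)"

lemma mat_flow_summable:
  fixes A :: "real^'n^'n"
  shows "summable (\<lambda>k. (((*v) A ^^ k) v $ i / fact k) * (t::real) ^ k)"
proof -
  obtain K where K: "0 < K" "\<And>x. norm (A *v x) \<le> norm x * K"
    using bounded_linear.pos_bounded[OF matrix_vector_mul_bounded_linear[of A]] by blast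
  have pow: "norm (((*v) A ^^ k) v) \<le> K ^ k * norm v" for k
  proof (induction k)
    case (Suc k)
    have "norm (((*v) A ^^ Suc k) v) \<le> norm (((*v) A ^^ k) v) * K" using K(2) by simp
    also have "\<dots> \<le> K ^ k * norm v * K" using Suc K(1) by (intro mult_right_mono) auto
    finally show ?case by (simp add: mult_ac)
  qed simp
  have "summable (\<lambda>k. norm v * (inverse (fact k) * (K * \<bar>t\<bar>) ^ k))"
    by (intro summable_mult summable_exp)
  then show ?thesis
  proof (rule summable_comparison_test')
    fix k
    have "\<bar>((*v) A ^^ k) v $ i\<bar> \<le> K ^ k * norm v" using component_le_norm_cart pow order_trans by blast
    then have "\<bar>((*v) A ^^ k) v $ i\<bar> * (inverse (fact k) * \<bar>t\<bar> ^ k) \<le> K ^ k * norm v * (inverse (fact k) * \<bar>t\<bar> ^ k)"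
      by (intro mult_right_mono) auto
    then show "norm ((((*v) A ^^ k) v $ i / fact k) * t ^ k) \<le> norm v * (inverse (fact k) * (K * \<bar>t\<bar>) ^ k)"
      by (simp add: abs_mult power_abs divide_inverse power_mult_distrib mult_ac)
  qed
qed

lemma funpow_matrix_add:
  fixes A :: "real^'n^'n"
  shows "((*v) A ^^ k) (u + v) = ((*v) A ^^ k) u + ((*v) A ^^ k) v"
  by (induction k) (simp_all add: matrix_vector_right_distrib)

lemma funpow_matrix_scale:
  fixes A :: "real^'n^'n"
  shows "((*v) A ^^ k) (c *\<^sub>R v) = c *\<^sub>R ((*v) A ^^ k) v"
  by (induction k) (simp_all add: matrix_vector_mult_scaleR)

lemma linear_mat_flow: "linear (mat_flow A t)"
proof (rule linearI)
  show "mat_flow A t (u + v) = mat_flow A t u + mat_flow A t v" for u v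
    unfolding mat_flow_def vec_eq_iff
    by (simp only: vec_lambda_beta vector_add_component funpow_matrix_add add_divide_distrib
        distrib_right suminf_add[OF mat_flow_summable mat_flow_summable] simp_thms)
  show "mat_flow A t (c *\<^sub>R v) = c *\<^sub>R mat_flow A t v" for c v
    unfolding mat_flow_def vec_eq_iff
    using suminf_mult[OF mat_flow_summable[of A v _ t], of c, symmetric]
    by (simp add: funpow_matrix_scale mult_ac)
qed

lemma mat_flow_0 [simp]: "mat_flow A 0 v = v"
  unfolding mat_flow_def vec_eq_iff vec_lambda_beta powser_zero by simp

text \<open>Differentiating the series of \<open>v\<close> termwise gives the series of
  \<open>A *v v\<close>; this identity turns that into the vector field at the current
  point.\<close>

lemma mat_flow_mult: "mat_flow A t (A *v v) = A *v mat_flow A t v"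
proof -
  have "(\<Sum>k. (((*v) A ^^ k) (A *v v) $ i / fact k) * t ^ k) = (A *v mat_flow A t v) $ i" for i
  proof -
    have "(A *v mat_flow A t v) $ i = (\<Sum>j\<in>UNIV. \<Sum>k. A $ i $ j * ((((*v) A ^^ k) v $ j / fact k) * t ^ k))"
    proof -
      have "(A *v mat_flow A t v) $ i = (\<Sum>j\<in>UNIV. A $ i $ j * mat_flow A t v $ j)"
        by (simp add: matrix_vector_mult_def)
      then show ?thesis by (simp only: mat_flow_def vec_lambda_beta suminf_mult[OF mat_flow_summable])
    qed
    also have "\<dots> = (\<Sum>k. \<Sum>j\<in>UNIV. A $ i $ j * ((((*v) A ^^ k) v $ j / fact k) * t ^ k))"
      by (rule suminf_sum[symmetric]) (intro summable_mult mat_flow_summable)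
    also have "\<dots> = (\<Sum>k. ((A *v (((*v) A ^^ k) v)) $ i / fact k) * t ^ k)"
    proof -
      have "(\<Sum>j\<in>UNIV. A $ i $ j * ((((*v) A ^^ k) v $ j / fact k) * t ^ k)) = ((A *v w) $ i / fact k) * t ^ k"
        if "w = ((*v) A ^^ k) v" for k w
        by (simp add: that[symmetric] matrix_vector_mult_def sum_distrib_right sum_divide_distrib mult.assoc)
      then show ?thesis by simp
    qed
    finally show ?thesis by (simp add: funpow_swap1)
  qed
  then show ?thesis by (simp add: mat_flow_def vec_eq_iff)
qed

lemma mat_flow_deriv: "((\<lambda>t. mat_flow A t v) has_vector_derivative A *v mat_flow A t v) (at t)"
proof -
  have "((\<lambda>t. mat_flow A t v $ i) has_vector_derivative (A *v mat_flow A t v) $ i) (at t)" for i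
  proof -
    have "((\<lambda>t. \<Sum>k. (((*v) A ^^ k) v $ i / fact k) * t ^ k) has_field_derivative
       (\<Sum>k. diffs (\<lambda>k. ((*v) A ^^ k) v $ i / fact k) k * t ^ k)) (at t)"
      by (rule termdiffs_strong_converges_everywhere) (rule mat_flow_summable)
    moreover have "diffs (\<lambda>k. ((*v) A ^^ k) v $ i / fact k) k = ((*v) A ^^ k) (A *v v) $ i / fact k" for k
      by (simp add: diffs_def funpow_swap1 del: of_nat_Suc)
    ultimately show ?thesis
      unfolding mat_flow_mult[symmetric]
      by (simp add: mat_flow_def has_real_derivative_iff_has_vector_derivative)
  qed
  then show ?thesis
    unfolding has_vector_derivative_def
    by (subst has_derivative_componentwise_within) (auto simp: Basis_vec_def inner_axis)
qed

lemma mat_flow_norm_deriv: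
  "((\<lambda>t. (norm (mat_flow A t v))\<^sup>2) has_real_derivative 2 * (mat_flow A t v \<bullet> (A *v mat_flow A t v))) (at t)"
  unfolding power2_norm_eq_inner has_real_derivative_iff_has_vector_derivative
  by (rule has_vector_derivative_eq_rhs[OF bounded_bilinear.has_vector_derivative[OF bounded_bilinear_inner mat_flow_deriv mat_flow_deriv]])
    (simp add: inner_commute)

context
  fixes A :: "real^'n^'n"
  assumes dissip: "\<And>v. v \<bullet> (A *v v) \<le> 0"
begin

lemma mat_flow_antimono:
  assumes "s \<le> t" shows "(norm (mat_flow A t v))\<^sup>2 \<le> (norm (mat_flow A s v))\<^sup>2"
  by (rule DERIV_nonpos_imp_nonincreasing[OF assms]) (use mat_flow_norm_deriv dissip in fastforce)

text \<open>For dissipative \<open>A\<close> the difference of two solutions has non-increasing norm, so forward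
  solutions are unique.\<close>

lemma mat_flow_add:
  assumes "0 \<le> t" shows "mat_flow A (t + s) v = mat_flow A t (mat_flow A s v)"
proof -
  define d where "d t = mat_flow A (t + s) v - mat_flow A t (mat_flow A s v)" for t
  have "(d has_vector_derivative A *v d t) (at t)" for t
  proof -
    have "((\<lambda>t. mat_flow A (t + s) v) has_vector_derivative A *v mat_flow A (t + s) v) (at t)"
    proof -
      have "((\<lambda>t. t + s) has_vector_derivative 1) (at t)" by (auto intro!: derivative_eq_intros)
      from vector_diff_chain_at[OF this mat_flow_deriv] show ?thesis by (simp add: o_def)
    qed
    then show ?thesis unfolding d_def
      by (auto intro!: derivative_eq_intros mat_flow_deriv simp: matrix_vector_mult_diff_distrib)
  qed
  then have "((\<lambda>t. (norm (d t))\<^sup>2) has_real_derivative 2 * (d t \<bullet> (A *v d t))) (at t)" for t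
    unfolding power2_norm_eq_inner has_real_derivative_iff_has_vector_derivative
    by (intro has_vector_derivative_eq_rhs[OF bounded_bilinear.has_vector_derivative[OF bounded_bilinear_inner]])
      (auto simp: inner_commute)
  then have "(norm (d t))\<^sup>2 \<le> (norm (d 0))\<^sup>2"
    using dissip by (intro DERIV_nonpos_imp_nonincreasing[OF assms]) fastforce
  then show ?thesis by (simp add: d_def)
qed

text \<open>Compactness of the unit sphere upgrades strict contraction at time 1 to one factor
  \<rho> < 1 for all vectors, by homogeneity. The semigroup law iterates it over integer times and
  monotonicity of the norm covers all later times.\<close>

lemma mat_flow_decay:
  assumes strict: "\<And>v. v \<noteq> 0 \<Longrightarrow> norm (mat_flow A 1 v) \<noteq> norm v" and "0 < \<eta>"
  shows "\<exists>t0>0. \<forall>t\<ge>t0. \<forall>v. (norm (mat_flow A t v))\<^sup>2 \<le> \<eta> * (norm v)\<^sup>2"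
proof -
  let ?g = "\<lambda>v. (norm (mat_flow A 1 v))\<^sup>2"
  have "continuous_on UNIV (mat_flow A 1)"
    using linear_mat_flow by (intro linear_continuous_on linear_conv_bounded_linear[THEN iffD1])
  then have "continuous_on (sphere 0 1) ?g"
    by (intro continuous_intros) (auto intro: continuous_on_subset)
  moreover have "(sphere (0::real^'n) 1) \<noteq> {}" by simp
  ultimately obtain m where m: "m \<in> sphere 0 1" "\<And>v. v \<in> sphere 0 1 \<Longrightarrow> ?g v \<le> ?g m"
    using continuous_attains_sup[of "sphere (0::real^'n) 1" ?g] by auto
  define \<rho> where "\<rho> = ?g m"
  have "?g m \<le> (norm m)\<^sup>2" using mat_flow_antimono[of 0 1 m] by simp
  moreover have "?g m \<noteq> (norm m)\<^sup>2" using strict[of m] m(1)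
    by (metis mem_sphere_0 norm_ge_zero norm_zero power2_eq_iff_nonneg zero_neq_one)
  ultimately have "?g m < (norm m)\<^sup>2" by linarith
  then have \<rho>: "0 \<le> \<rho>" "\<rho> < 1" using m(1) by (simp_all add: \<rho>_def)
  have step: "(norm (mat_flow A 1 v))\<^sup>2 \<le> \<rho> * (norm v)\<^sup>2" for v
  proof (cases "v = 0")
    case True then show ?thesis using linear_0[OF linear_mat_flow[of A 1]] by simp
  next
    case False
    have "mat_flow A 1 (v /\<^sub>R norm v) = mat_flow A 1 v /\<^sub>R norm v"
      by (rule linear_cmul[OF linear_mat_flow])
    moreover have "?g (v /\<^sub>R norm v) \<le> \<rho>" unfolding \<rho>_def by (rule m(2)) (use False in simp)
    ultimately show ?thesis using False by (simp add: power_mult_distrib field_simps)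
  qed
  have iter: "(norm (mat_flow A (real n) v))\<^sup>2 \<le> \<rho> ^ n * (norm v)\<^sup>2" for n v
  proof (induction n)
    case (Suc n)
    have "(norm (mat_flow A (real (Suc n)) v))\<^sup>2 \<le> \<rho> * (norm (mat_flow A (real n) v))\<^sup>2"
      using step[of "mat_flow A (real n) v"] mat_flow_add[of 1 "real n" v] by simp
    also have "\<dots> \<le> \<rho> * (\<rho> ^ n * (norm v)\<^sup>2)" using Suc \<rho> by (intro mult_left_mono) auto
    finally show ?case by simp
  qed simp
  obtain n where n: "\<rho> ^ n < \<eta>" using real_arch_pow_inv[OF \<open>0 < \<eta>\<close> \<rho>(2)] by blast
  show ?thesis
  proof (intro exI[of _ "real n + 1"] conjI allI impI)
    fix t v assume "real n + 1 \<le> t"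
    then have "(norm (mat_flow A t v))\<^sup>2 \<le> (norm (mat_flow A (real n) v))\<^sup>2" by (intro mat_flow_antimono) simp
    also have "\<dots> \<le> \<rho> ^ n * (norm v)\<^sup>2" by (rule iter)
    also have "\<dots> \<le> \<eta> * (norm v)\<^sup>2" using n by (intro mult_right_mono) auto
    finally show "(norm (mat_flow A t v))\<^sup>2 \<le> \<eta> * (norm v)\<^sup>2" .
  qed simp
qed

end

section \<open>Strict contraction from Condition (C)\<close>

lemma matrix_transpose_inner: "x \<bullet> (transpose C *v y) = (C *v x) \<bullet> (y :: real^'n)"
  by (metis dot_lmul_matrix inner_commute transpose_matrix_vector)

lemma neg_matrix_mult: "(- C) *v x = - (C *v (x :: real^'n))"
  by (simp add: matrix_vector_mult_def vec_eq_iff sum_negf)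

text \<open>The antisymmetric part of C drops out of the quadratic form, so D alone dissipates the
  norm along the flow.\<close>

lemma inner_symmetric_part:
  assumes "(1/2) *\<^sub>R (C + transpose C) = D"
  shows "x \<bullet> ((- transpose C) *v x) = - (x \<bullet> (D *v (x :: real^'n)))" "x \<bullet> (C *v x) = x \<bullet> (D *v x)"
proof -
  have t: "x \<bullet> (transpose C *v x) = x \<bullet> (C *v x)" by (metis matrix_transpose_inner inner_commute)
  have "x \<bullet> (D *v x) = (x \<bullet> (C *v x) + x \<bullet> (transpose C *v x)) / 2"
    unfolding assms[symmetric]
    by (simp add: scaleR_matrix_vector_assoc[symmetric] matrix_vector_mult_add_rdistrib inner_add_right)
  then show "x \<bullet> ((- transpose C) *v x) = - (x \<bullet> (D *v x))" "x \<bullet> (C *v x) = x \<bullet> (D *v x)"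
    using t by (simp_all add: neg_matrix_mult)
qed

text \<open>If \<open>\<bar>\<xi>\<^sub>t\<bar>\<close> does not decrease strictly on \<open>[0,1]\<close>, then the orbit stays in \<open>Ker D\<close>, and the vectors
  with this property form a \<open>C\<^sup>T\<close>-invariant subspace.\<close>

lemma cond_C_strict_decay:
  assumes psd: "\<And>x. 0 \<le> x \<bullet> (D *v x)" and ker: "\<And>x. x \<bullet> (D *v x) = 0 \<Longrightarrow> D *v x = 0"
    and sym: "(1/2) *\<^sub>R (C + transpose C) = D" and C: "cond_C D C" and v: "v \<noteq> 0"
  shows "norm (mat_flow (- transpose C) 1 v) \<noteq> norm v"
proof
  let ?A = "- transpose C"
  have dissip: "x \<bullet> (?A *v x) \<le> 0" for x using inner_symmetric_part(1)[OF sym, of x] psd[of x] by simp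
  \<comment> \<open>Vanishing is required on [0,1] only, the interval on which equality of the end
    norms forces it.\<close>
  define V where "V = {x. \<forall>t\<in>{0..1}. D *v mat_flow ?A t x = 0}"
  have "subspace V"
    unfolding V_def subspace_def
    using linear_mat_flow[of ?A]
    by (auto simp: linear_0 linear_add linear_cmul matrix_vector_right_distrib matrix_vector_mult_scaleR)
  moreover have "V \<subseteq> {x. D *v x = 0}"
  proof
    fix x assume "x \<in> V"
    then have "D *v mat_flow ?A 0 x = 0" unfolding V_def by fastforce
    then show "x \<in> {x. D *v x = 0}" by simp
  qed
  moreover have "\<forall>x\<in>V. transpose C *v x \<in> V"
  proof
    fix x assume x: "x \<in> V"
    \<comment> \<open>This is the derivative of a curve that vanishes on [0,1]; differentiating
      within the closed interval includes both endpoints.\<close>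
    have "D *v mat_flow ?A t (?A *v x) = 0" if t: "t \<in> {0..1}" for t
    proof (rule vector_derivative_unique_within_closed_interval[of 0 1 t "\<lambda>t. D *v mat_flow ?A t x"])
      show "((\<lambda>t. D *v mat_flow ?A t x) has_vector_derivative D *v mat_flow ?A t (?A *v x)) (at t within cbox 0 1)"
        unfolding mat_flow_mult
        by (rule bounded_linear.has_vector_derivative[OF matrix_vector_mul_bounded_linear
              has_vector_derivative_at_within[OF mat_flow_deriv]])
      show "((\<lambda>t. D *v mat_flow ?A t x) has_vector_derivative 0) (at t within cbox 0 1)"
        by (rule has_vector_derivative_transform[OF _ _ has_vector_derivative_const])
          (use x t in \<open>simp_all add: V_def\<close>)
    qed (use t in auto)
    moreover have "mat_flow ?A t (?A *v x) = - mat_flow ?A t (transpose C *v x)" for t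
      unfolding neg_matrix_mult by (rule linear_neg[OF linear_mat_flow])
    moreover have "D *v (- y) = - (D *v y)" for y
      by (rule linear_neg[OF matrix_vector_mul_linear])
    ultimately show "transpose C *v x \<in> V"
      unfolding V_def by (simp only: mem_Collect_eq) (metis neg_equal_0_iff_equal)
  qed
  ultimately have V0: "V = {0}" using C unfolding cond_C_def by blast
  assume eq: "norm (mat_flow ?A 1 v) = norm v"
  have "D *v mat_flow ?A t v = 0" if t: "t \<in> {0..1}" for t
  proof (rule ker)
    have const: "(norm (mat_flow ?A s v))\<^sup>2 = (norm v)\<^sup>2" if "s \<in> {0..1}" for s
      using mat_flow_antimono[OF dissip, of 0 s v] mat_flow_antimono[OF dissip, of s 1 v] that eq by auto
    \<comment> \<open>The non-increasing squared norm has equal values at 0 and 1, hence is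
      constant, and its derivative is -2 times the energy in D.\<close>
    have "2 * (mat_flow ?A t v \<bullet> (?A *v mat_flow ?A t v)) = 0"
    proof (rule vector_derivative_unique_within_closed_interval[of 0 1 t "\<lambda>t. (norm (mat_flow ?A t v))\<^sup>2"])
      show "((\<lambda>t. (norm (mat_flow ?A t v))\<^sup>2) has_vector_derivative 2 * (mat_flow ?A t v \<bullet> (?A *v mat_flow ?A t v))) (at t within cbox 0 1)"
        using mat_flow_norm_deriv[of ?A v t] unfolding has_real_derivative_iff_has_vector_derivative
        by (rule has_vector_derivative_at_within)
      show "((\<lambda>t. (norm (mat_flow ?A t v))\<^sup>2) has_vector_derivative 0) (at t within cbox 0 1)"
        by (rule has_vector_derivative_transform[OF _ _ has_vector_derivative_const])
          (use const t in \<open>simp_all del: power2_eq_iff_nonneg\<close>)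
    qed (use t in auto)
    then show "mat_flow ?A t v \<bullet> (D *v mat_flow ?A t v) = 0"
      by (simp add: inner_symmetric_part(1)[OF sym])
  qed
  then have "v \<in> V" by (simp add: V_def)
  then show False using V0 v by simp
qed

section \<open>Calculus with a logarithmic cutoff\<close>

text \<open>Links integrals over a box, where the Leibniz rule needs only continuity, with the
  Lebesgue integrals over the whole space in which the pairings are stated.\<close>

lemma compact_support_integral:
  fixes h :: "'a::euclidean_space \<Rightarrow> real"
  assumes "continuous_on UNIV h" and out: "\<And>x. x \<notin> cbox a b \<Longrightarrow> h x = 0"
  shows "integrable lborel h" "integral (cbox a b) h = (LINT x|lborel. h x)"
proof -
  have eq: "indicator (cbox a b) x *\<^sub>R h x = h x" for x using out[of x] by (auto simp: indicator_def)
  have si: "set_integrable lborel (cbox a b) h"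
    unfolding set_integrable_def
    by (rule borel_integrable_compact) (auto intro: continuous_on_subset[OF assms(1)])
  then show "integrable lborel h" unfolding set_integrable_def eq .
  show "integral (cbox a b) h = (LINT x|lborel. h x)"
    using set_borel_integral_eq_integral(2)[OF si] unfolding set_lebesgue_integral_def eq by simp
qed

lemma cball_subset_cbox_symmetric: "\<exists>a. cball (0::'a::euclidean_space) R \<subseteq> cbox (- a) a"
  using bounded_subset_cbox_symmetric[OF bounded_cball] by blast

text \<open>By translation invariance the integral of h (x + s e) does not depend on s;
  differentiating under the integral at s = 0 gives the claim. This is integration by parts without
  boundary terms.\<close>

lemma integral_directional_derivative_eq_0:
  fixes h h' :: "'a::euclidean_space \<Rightarrow> real"
  assumes deriv: "\<And>x. ((\<lambda>s. h (x + s *\<^sub>R e)) has_real_derivative h' x) (at 0)"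
    and h: "continuous_on UNIV h" and h': "continuous_on UNIV h'"
    and out: "\<And>x. R < norm x \<Longrightarrow> h x = 0" "\<And>x. R < norm x \<Longrightarrow> h' x = 0"
  shows "(LINT x|lborel. h' x) = 0"
proof -
  \<comment> \<open>The margin \<open>norm e\<close> keeps the support of every translate with |s| <
    1 inside one fixed box.\<close>
  obtain a :: 'a where a: "cball 0 (R + norm e) \<subseteq> cbox (- a) a" using cball_subset_cbox_symmetric by blast
  have big: "R + norm e < norm x" if "x \<notin> cbox (- a) a" for x using a that by force
  have z0: "h x = 0" and z0': "h' x = 0" if "x \<notin> cbox (- a) a" for x
    using big[OF that] norm_ge_zero[of e] by (intro out; linarith)+
  have deriv': "((\<lambda>s. h (x + s *\<^sub>R e)) has_real_derivative h' (x + s *\<^sub>R e)) (at s)" for x s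
    using deriv[of "x + s *\<^sub>R e"] DERIV_shift[of "\<lambda>r. h (x + r *\<^sub>R e)" _ 0 s]
    by (simp add: algebra_simps)
  define U where "U = {-1<..<1::real}"
  have gi: "integral (cbox (- a) a) (\<lambda>x. h (x + s *\<^sub>R e)) = (LINT x|lborel. h x)"
   and gint: "(\<lambda>x. h (x + s *\<^sub>R e)) integrable_on cbox (- a) a" if s: "s \<in> U" for s
  proof -
    have c: "continuous_on UNIV (\<lambda>x. h (x + s *\<^sub>R e))"
      by (intro continuous_on_compose2[OF h] continuous_intros) auto
    have z: "h (x + s *\<^sub>R e) = 0" if "x \<notin> cbox (- a) a" for x
    proof (rule out(1))
      have "norm x \<le> norm (x + s *\<^sub>R e) + norm (s *\<^sub>R e)" by (metis add_diff_cancel norm_triangle_ineq4)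
      moreover have "norm (s *\<^sub>R e) \<le> norm e" using s by (auto simp: U_def intro!: mult_left_le_one_le)
      ultimately show "R < norm (x + s *\<^sub>R e)" using big[OF that] by linarith
    qed
    have ih: "integrable lborel h"
      by (rule compact_support_integral(1)[OF h z0])
    show "integral (cbox (- a) a) (\<lambda>x. h (x + s *\<^sub>R e)) = (LINT x|lborel. h x)"
      using compact_support_integral(2)[OF c z] lborel_translate(2)[OF ih, of "s *\<^sub>R e"] by (simp add: add.commute)
    show "(\<lambda>x. h (x + s *\<^sub>R e)) integrable_on cbox (- a) a"
      by (rule integrable_continuous[OF continuous_on_subset[OF c]]) simp
  qed
  have "((\<lambda>s. integral (cbox (- a) a) (\<lambda>x. h (x + s *\<^sub>R e))) has_field_derivative
      integral (cbox (- a) a) (\<lambda>x. h' (x + 0 *\<^sub>R e))) (at 0 within U)"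
  proof (rule leibniz_rule_field_derivative)
    show "((\<lambda>s. h (x + s *\<^sub>R e)) has_field_derivative h' (x + s *\<^sub>R e)) (at s within U)" for x s
      by (rule has_field_derivative_at_within[OF deriv'])
    show "continuous_on (U \<times> cbox (- a) a) (\<lambda>(s, x). h' (x + s *\<^sub>R e))"
      unfolding split_beta by (intro continuous_on_compose2[OF h'] continuous_intros) auto
  qed (auto simp: U_def intro: gint[unfolded U_def])
  moreover have "((\<lambda>s. integral (cbox (- a) a) (\<lambda>x. h (x + s *\<^sub>R e))) has_field_derivative 0) (at 0 within U)"
    by (rule has_field_derivative_at_within,
        rule has_field_derivative_transform_within_open[of "\<lambda>_. LINT x|lborel. h x" _ _ U])
      (auto simp: gi, auto simp: U_def)
  moreover have "at (0::real) within U = at 0" by (rule at_within_open) (auto simp: U_def)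
  ultimately have "integral (cbox (- a) a) h' = 0" by (auto dest: DERIV_unique)
  moreover have "integral (cbox (- a) a) h' = (LINT x|lborel. h' x)"
    by (rule compact_support_integral(2)[OF h' z0'])
  ultimately show ?thesis by simp
qed

text \<open>The cube is the smallest integer power of the positive part that is twice continuously
  differentiable, the regularity that a second-order equation asks of a test function.\<close>

lemma pos_part_cube_deriv: "((\<lambda>u::real. (max 0 u)^3) has_real_derivative 3 * (max 0 u)\<^sup>2) (at u)"
proof -
  consider "u > 0" | "u < 0" | "u = 0" by linarith
  then show ?thesis
  proof cases
    case 1
    show ?thesis
      by (rule has_field_derivative_transform_within_open[of "\<lambda>u. u^3" _ _ "{0<..}"]) (use 1 in \<open>auto intro!: derivative_eq_intros\<close>)
  next
    case 2
    show ?thesis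
      by (rule has_field_derivative_transform_within_open[of "\<lambda>u. 0" _ _ "{..<0}"]) (use 2 in \<open>auto intro!: derivative_eq_intros\<close>)
  next
    case 3
    have "((\<lambda>h::real. (max 0 h)^3 / h) \<longlongrightarrow> 0) (at 0)"
    proof (rule Lim_null_comparison)
      show "\<forall>\<^sub>F h in at 0. norm ((max 0 h)^3 / h) \<le> h\<^sup>2"
        by (intro always_eventually allI) (auto simp: max_def power3_eq_cube power2_eq_square)
      show "((\<lambda>h::real. h\<^sup>2) \<longlongrightarrow> 0) (at 0)" by (auto intro!: tendsto_eq_intros)
    qed
    then show ?thesis using 3 by (simp add: DERIV_def)
  qed
qed

lemma pos_part_square_deriv: "((\<lambda>u::real. (max 0 u)\<^sup>2) has_real_derivative 2 * max 0 u) (at u)"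
proof -
  consider "u > 0" | "u < 0" | "u = 0" by linarith
  then show ?thesis
  proof cases
    case 1
    show ?thesis
      by (rule has_field_derivative_transform_within_open[of "\<lambda>u. u\<^sup>2" _ _ "{0<..}"]) (use 1 in \<open>auto intro!: derivative_eq_intros\<close>)
  next
    case 2
    show ?thesis
      by (rule has_field_derivative_transform_within_open[of "\<lambda>u. 0" _ _ "{..<0}"]) (use 2 in \<open>auto intro!: derivative_eq_intros\<close>)
  next
    case 3
    have "((\<lambda>h::real. (max 0 h)\<^sup>2 / h) \<longlongrightarrow> 0) (at 0)"
    proof (rule Lim_null_comparison)
      show "\<forall>\<^sub>F h in at 0. norm ((max 0 h)\<^sup>2 / h) \<le> \<bar>h\<bar>"
        by (intro always_eventually allI) (auto simp: max_def power2_eq_square)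
      show "((\<lambda>h::real. \<bar>h\<bar>) \<longlongrightarrow> 0) (at 0)" by (auto intro!: tendsto_eq_intros)
    qed
    then show ?thesis using 3 by (simp add: DERIV_def)
  qed
qed

text \<open>A logarithmic cutoff: since \<open>\<bar>x\<bar> \<bar>\<nabla>\<chi>\<bar>\<close> is of order \<open>\<epsilon>\<close> uniformly in \<open>x\<close>, the linearly growing drift
  acting on it contributes an error that is uniformly small.\<close>

definition cutoff_base :: "real \<Rightarrow> real^'n \<Rightarrow> real" where
  "cutoff_base \<epsilon> x = max 0 (1 - \<epsilon> * ln (1 + (norm x)\<^sup>2))"

definition cutoff :: "real \<Rightarrow> real^'n \<Rightarrow> real" where
  "cutoff \<epsilon> x = (cutoff_base \<epsilon> x)^3"

definition cutoff_d1 :: "real \<Rightarrow> 'n \<Rightarrow> real^'n \<Rightarrow> real" where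
  "cutoff_d1 \<epsilon> i x = - (6 * \<epsilon> * (x $ i / (1 + (norm x)\<^sup>2)) * (cutoff_base \<epsilon> x)\<^sup>2)"

text \<open>Only pure second derivatives are recorded, since D is diagonal. With y = x_i / (1 +
  |x|^2), the argument of the positive part has derivative -2 \<epsilon> y, and y has derivative 1 /
  (1 + |x|^2) - 2 y^2.\<close>

definition cutoff_d2 :: "real \<Rightarrow> 'n \<Rightarrow> real^'n \<Rightarrow> real" where
  "cutoff_d2 \<epsilon> i x = 24 * \<epsilon>\<^sup>2 * (x $ i / (1 + (norm x)\<^sup>2))\<^sup>2 * cutoff_base \<epsilon> x
    - 6 * \<epsilon> * (1 / (1 + (norm x)\<^sup>2) - 2 * (x $ i / (1 + (norm x)\<^sup>2))\<^sup>2) * (cutoff_base \<epsilon> x)\<^sup>2"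

lemma norm_sq_line_deriv:
  "((\<lambda>s. (norm (x + s *\<^sub>R axis i 1 :: real^'n))\<^sup>2) has_real_derivative 2 * x $ i) (at 0)"
proof -
  have "(norm (x + s *\<^sub>R axis i 1))\<^sup>2 = (norm x)\<^sup>2 + 2 * s * x $ i + s\<^sup>2" for s
    unfolding power2_norm_eq_inner
    by (simp add: inner_add_left inner_add_right inner_axis inner_axis' power2_eq_square distrib_left)
  then show ?thesis by (auto intro!: derivative_eq_intros)
qed

lemma one_plus_norm_sq_pos: "0 < 1 + (norm x)\<^sup>2" by (simp add: add_pos_nonneg)

lemma norm_le_one_plus_norm_sq: "norm x \<le> 1 + (norm x)\<^sup>2"
  using sum_squares_bound[of 1 "norm x"] norm_ge_zero[of x] unfolding power_one mult_1_right by linarith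

lemma one_plus_norm_sq_line_deriv:
  "((\<lambda>s. 1 + (norm (x + s *\<^sub>R axis i 1 :: real^'n))\<^sup>2) has_real_derivative 2 * x $ i) (at 0)"
  using DERIV_add[OF DERIV_const norm_sq_line_deriv, of 1 x i] by simp

lemma cutoff_arg_line_deriv:
  "((\<lambda>s. 1 - \<epsilon> * ln (1 + (norm (x + s *\<^sub>R axis i 1 :: real^'n))\<^sup>2)) has_real_derivative
     - (2 * \<epsilon> * (x $ i / (1 + (norm x)\<^sup>2)))) (at 0)"
proof -
  have "0 < 1 + (norm (x + 0 *\<^sub>R axis i 1))\<^sup>2" by (rule one_plus_norm_sq_pos)
  from DERIV_chain2[OF DERIV_ln[OF this] one_plus_norm_sq_line_deriv]
  have "((\<lambda>s. ln (1 + (norm (x + s *\<^sub>R axis i 1))\<^sup>2)) has_real_derivative 2 * (x $ i / (1 + (norm x)\<^sup>2))) (at 0)"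
    by (simp add: divide_inverse mult_ac)
  from DERIV_diff[OF DERIV_const DERIV_cmult[OF this], of 1 \<epsilon>] show ?thesis by (simp add: mult_ac)
qed

lemma cutoff_line_deriv:
  "((\<lambda>s. cutoff \<epsilon> (x + s *\<^sub>R axis i 1 :: real^'n)) has_real_derivative cutoff_d1 \<epsilon> i x) (at 0)"
  unfolding cutoff_def cutoff_base_def
  by (rule DERIV_cong[OF DERIV_chain2[OF pos_part_cube_deriv cutoff_arg_line_deriv]])
    (simp add: cutoff_d1_def cutoff_base_def)

lemma cutoff_d1_line_deriv:
  "((\<lambda>s. cutoff_d1 \<epsilon> i (x + s *\<^sub>R axis i 1 :: real^'n)) has_real_derivative cutoff_d2 \<epsilon> i x) (at 0)"
proof -
  have sq: "((\<lambda>s. (cutoff_base \<epsilon> (x + s *\<^sub>R axis i 1))\<^sup>2) has_real_derivative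
      2 * cutoff_base \<epsilon> x * - (2 * \<epsilon> * (x $ i / (1 + (norm x)\<^sup>2)))) (at 0)"
    unfolding cutoff_base_def
    by (rule DERIV_cong[OF DERIV_chain2[OF pos_part_square_deriv cutoff_arg_line_deriv]]) simp
  have co: "((\<lambda>s. (x + s *\<^sub>R axis i 1) $ i) has_real_derivative 1) (at 0)"
    by (auto intro!: derivative_eq_intros simp: axis_def)
  have nz: "1 + (norm (x + 0 *\<^sub>R axis i 1))\<^sup>2 \<noteq> 0" using one_plus_norm_sq_pos[of x] by simp
  have alg: "(1 * d - c * (2 * c)) / (d * d) = 1 / d - 2 * (c / d)\<^sup>2" if "d \<noteq> 0" for c d :: real
    using that by (simp add: field_simps power2_eq_square)
  have q: "((\<lambda>s. (x + s *\<^sub>R axis i 1) $ i / (1 + (norm (x + s *\<^sub>R axis i 1))\<^sup>2)) has_real_derivative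
      1 / (1 + (norm x)\<^sup>2) - 2 * (x $ i / (1 + (norm x)\<^sup>2))\<^sup>2) (at 0)"
    by (rule DERIV_cong[OF DERIV_divide[OF co one_plus_norm_sq_line_deriv nz]])
      (use alg[of "1 + (norm x)\<^sup>2" "x $ i"] nz in simp)
  show ?thesis unfolding cutoff_d1_def
    by (rule DERIV_cong[OF DERIV_minus[OF DERIV_mult[OF DERIV_cmult[OF q, of "6 * \<epsilon>"] sq]]])
      (simp add: cutoff_d2_def power2_eq_square algebra_simps)
qed

lemma continuous_cut:
  "continuous_on UNIV (cutoff \<epsilon> :: real^'n \<Rightarrow> real)" "continuous_on UNIV (cutoff_d1 \<epsilon> i :: real^'n \<Rightarrow> real)"
  "continuous_on UNIV (cutoff_d2 \<epsilon> i :: real^'n \<Rightarrow> real)"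
proof -
  have nz: "1 + (norm x)\<^sup>2 \<noteq> 0" for x :: "real^'n" using one_plus_norm_sq_pos[of x] by simp
  have b: "continuous_on UNIV (cutoff_base \<epsilon> :: real^'n \<Rightarrow> real)"
    unfolding cutoff_base_def using one_plus_norm_sq_pos by (intro continuous_intros) (simp add: nz)
  show "continuous_on UNIV (cutoff \<epsilon> :: real^'n \<Rightarrow> real)" unfolding cutoff_def by (intro continuous_intros b)
  show "continuous_on UNIV (cutoff_d1 \<epsilon> i :: real^'n \<Rightarrow> real)" "continuous_on UNIV (cutoff_d2 \<epsilon> i :: real^'n \<Rightarrow> real)"
    unfolding cutoff_d1_def cutoff_d2_def by (intro continuous_intros b; simp add: nz)+
qed

text \<open>The logarithm reaches 1 / \<epsilon> once 1 + |x|^2 \<ge> exp (1 / \<epsilon>); the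
  crude bound |x| \<le> 1 + |x|^2 gives a radius without square roots.\<close>

lemma cutoff_support:
  assumes "0 < \<epsilon>" "exp (1 / \<epsilon>) < norm x"
  shows "cutoff \<epsilon> x = 0" "cutoff_d1 \<epsilon> i x = 0" "cutoff_d2 \<epsilon> i x = 0"
proof -
  have "norm x \<le> 1 + (norm x)\<^sup>2" by (rule norm_le_one_plus_norm_sq)
  then have "exp (1 / \<epsilon>) \<le> 1 + (norm x)\<^sup>2" using assms(2) by linarith
  then have "1 / \<epsilon> \<le> ln (1 + (norm x)\<^sup>2)" using one_plus_norm_sq_pos[of x] by (simp add: ln_ge_iff)
  then have "cutoff_base \<epsilon> x = 0" using assms(1) by (simp add: cutoff_base_def field_simps)
  then show "cutoff \<epsilon> x = 0" "cutoff_d1 \<epsilon> i x = 0" "cutoff_d2 \<epsilon> i x = 0" by (simp_all add: cutoff_def cutoff_d1_def cutoff_d2_def)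
qed

lemma cutoff_base_bounds: assumes "0 \<le> \<epsilon>" shows "0 \<le> cutoff_base \<epsilon> x" "cutoff_base \<epsilon> x \<le> 1"
  using assms by (auto simp: cutoff_base_def)

lemma cutoff_bounds: assumes "0 \<le> \<epsilon>" shows "0 \<le> cutoff \<epsilon> x" "cutoff \<epsilon> x \<le> 1"
  using cutoff_base_bounds[OF assms, of x] by (auto simp: cutoff_def power_le_one)

lemma quotient_bounds:
  fixes x :: "real^'n"
  shows "\<bar>x $ i / (1 + (norm x)\<^sup>2)\<bar> \<le> 1" "(norm x)\<^sup>2 / (1 + (norm x)\<^sup>2) \<le> 1" "1 / (1 + (norm x)\<^sup>2) \<le> 1"
proof -
  have "\<bar>x $ i\<bar> \<le> norm x" by (rule component_le_norm_cart)
  moreover have "norm x \<le> 1 + (norm x)\<^sup>2" by (rule norm_le_one_plus_norm_sq)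
  ultimately show "\<bar>x $ i / (1 + (norm x)\<^sup>2)\<bar> \<le> 1" using one_plus_norm_sq_pos[of x] by (simp add: abs_divide)
qed (use one_plus_norm_sq_pos[of x] in simp_all)

lemma cutoff_d1_bound:
  assumes "0 \<le> \<epsilon>" shows "\<bar>cutoff_d1 \<epsilon> i x\<bar> \<le> 6 * \<epsilon>"
proof -
  have "\<bar>cutoff_d1 \<epsilon> i x\<bar> = 6 * \<epsilon> * (\<bar>x $ i / (1 + (norm x)\<^sup>2)\<bar> * (cutoff_base \<epsilon> x)\<^sup>2)"
    using assms by (simp add: cutoff_d1_def abs_mult)
  also have "\<dots> \<le> 6 * \<epsilon> * (1 * 1)"
    using assms cutoff_base_bounds[OF assms, of x] quotient_bounds(1)[of x i]
    by (intro mult_left_mono mult_mono) (auto simp: power_le_one)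
  finally show ?thesis by simp
qed

text \<open>The constant is 24 + 18: \<epsilon>^2 \<le> \<epsilon> in the first term, and a bracket
  of modulus at most 3 in the second.\<close>

lemma cutoff_d2_bound:
  assumes "0 \<le> \<epsilon>" "\<epsilon> \<le> 1" shows "\<bar>cutoff_d2 \<epsilon> i x\<bar> \<le> 42 * \<epsilon>"
proof -
  define a where "a = (x $ i / (1 + (norm x)\<^sup>2))\<^sup>2"
  define b where "b = 1 / (1 + (norm x)\<^sup>2)"
  have a: "0 \<le> a" "a \<le> 1" using quotient_bounds(1)[of x i] by (auto simp: a_def abs_square_le_1)
  have b: "0 \<le> b" "b \<le> 1" using quotient_bounds(3)[of x] by (auto simp: b_def)
  note c = cutoff_base_bounds[OF assms(1), of x]
  have c2: "0 \<le> (cutoff_base \<epsilon> x)\<^sup>2" "(cutoff_base \<epsilon> x)\<^sup>2 \<le> 1" using c by (auto simp: power_le_one)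
  have "\<epsilon>\<^sup>2 * (a * cutoff_base \<epsilon> x) \<le> \<epsilon> * (1 * 1)"
    using assms a c by (intro mult_mono) (auto simp: power2_eq_square mult_left_le)
  then have 1: "\<bar>24 * \<epsilon>\<^sup>2 * a * cutoff_base \<epsilon> x\<bar> \<le> 24 * \<epsilon>" using a c by (simp add: abs_mult mult.assoc)
  have "\<bar>b - 2 * a\<bar> * (cutoff_base \<epsilon> x)\<^sup>2 \<le> 3 * 1" using a b c2 by (intro mult_mono) auto
  then have "6 * \<epsilon> * (\<bar>b - 2 * a\<bar> * (cutoff_base \<epsilon> x)\<^sup>2) \<le> 6 * \<epsilon> * (3 * 1)" using assms(1) by (intro mult_left_mono) auto
  then have 2: "\<bar>6 * \<epsilon> * (b - 2 * a) * (cutoff_base \<epsilon> x)\<^sup>2\<bar> \<le> 18 * \<epsilon>" using assms(1) by (simp add: abs_mult mult.assoc)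
  show ?thesis unfolding cutoff_d2_def a_def[symmetric] b_def[symmetric] using 1 2 by linarith
qed

lemma cutoff_drift_bound:
  assumes "0 \<le> \<epsilon>" and K: "\<And>x. norm (C *v x) \<le> norm x * K"
  shows "\<bar>\<Sum>i\<in>UNIV. (C *v x) $ i * cutoff_d1 \<epsilon> i x\<bar> \<le> 6 * \<epsilon> * K"
proof -
  have "(\<Sum>i\<in>UNIV. (C *v x) $ i * cutoff_d1 \<epsilon> i x) = - (6 * \<epsilon> * (((C *v x) \<bullet> x) / (1 + (norm x)\<^sup>2)) * (cutoff_base \<epsilon> x)\<^sup>2)"
    by (simp add: cutoff_d1_def inner_vec_def sum_negf sum_distrib_left sum_distrib_right sum_divide_distrib mult_ac)
  then have eq: "\<bar>\<Sum>i\<in>UNIV. (C *v x) $ i * cutoff_d1 \<epsilon> i x\<bar> = 6 * \<epsilon> * (\<bar>(C *v x) \<bullet> x\<bar> / (1 + (norm x)\<^sup>2) * (cutoff_base \<epsilon> x)\<^sup>2)"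
    using assms(1) one_plus_norm_sq_pos[of x] by (simp add: abs_mult abs_divide mult.assoc)
  have K0: "0 \<le> K" using order_trans[OF norm_ge_zero K[of "axis undefined 1"]] by simp
  have "\<bar>(C *v x) \<bullet> x\<bar> \<le> norm (C *v x) * norm x" by (rule Cauchy_Schwarz_ineq2)
  also have "\<dots> \<le> norm x * K * norm x" by (intro mult_right_mono K) simp
  finally have "\<bar>(C *v x) \<bullet> x\<bar> / (1 + (norm x)\<^sup>2) \<le> K * ((norm x)\<^sup>2 / (1 + (norm x)\<^sup>2))"
    using one_plus_norm_sq_pos[of x] by (simp add: divide_right_mono power2_eq_square mult_ac)
  also have "\<dots> \<le> K * 1" using K0 quotient_bounds(2)[of x] by (intro mult_left_mono)
  finally have "\<bar>(C *v x) \<bullet> x\<bar> / (1 + (norm x)\<^sup>2) * (cutoff_base \<epsilon> x)\<^sup>2 \<le> K * 1"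
    using K0 cutoff_base_bounds[OF assms(1), of x] by (intro mult_mono) (auto simp: power_le_one)
  then have "6 * \<epsilon> * (\<bar>(C *v x) \<bullet> x\<bar> / (1 + (norm x)\<^sup>2) * (cutoff_base \<epsilon> x)\<^sup>2) \<le> 6 * \<epsilon> * (K * 1)"
    using assms(1) by (intro mult_left_mono) auto
  then show ?thesis unfolding eq by simp
qed

lemma cutoff_tendsto: "((\<lambda>\<epsilon>. cutoff \<epsilon> x) \<longlongrightarrow> 1) (at_right 0)"
  unfolding cutoff_def cutoff_base_def by (auto intro!: tendsto_eq_intros)

section \<open>Regularity of solutions and the weak formulation\<close>

lemma differentiable_section:
  fixes F :: "'a::real_normed_vector \<times> 'b::real_normed_vector \<Rightarrow> real"
  assumes "F differentiable (at (t, x))"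
  shows "(\<lambda>y. F (t, y)) differentiable (at x)"
    and "frechet_derivative (\<lambda>y. F (t, y)) (at x) e = frechet_derivative F (at (t, x)) (0, e)"
    and "(\<lambda>s. F (s, x)) differentiable (at t)"
    and "frechet_derivative (\<lambda>s. F (s, x)) (at t) r = frechet_derivative F (at (t, x)) (r, 0)"
proof -
  have F: "(F has_derivative frechet_derivative F (at (t, x))) (at (t, x))"
    using assms frechet_derivative_works by blast
  have "((\<lambda>y. (t, y)) has_derivative (\<lambda>h. (0, h))) (at x)" by (auto intro!: derivative_eq_intros)
  from diff_chain_at[OF this F]
  have d1: "((\<lambda>y. F (t, y)) has_derivative (\<lambda>h. frechet_derivative F (at (t, x)) (0, h))) (at x)"
    by (simp add: o_def)
  have "((\<lambda>s. (s, x)) has_derivative (\<lambda>h. (h, 0))) (at t)" by (auto intro!: derivative_eq_intros)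
  from diff_chain_at[OF this F]
  have d2: "((\<lambda>s. F (s, x)) has_derivative (\<lambda>h. frechet_derivative F (at (t, x)) (h, 0))) (at t)"
    by (simp add: o_def)
  show "(\<lambda>y. F (t, y)) differentiable (at x)" "(\<lambda>s. F (s, x)) differentiable (at t)"
    using d1 d2 unfolding differentiable_def by blast+
  show "frechet_derivative (\<lambda>y. F (t, y)) (at x) e = frechet_derivative F (at (t, x)) (0, e)"
    "frechet_derivative (\<lambda>s. F (s, x)) (at t) r = frechet_derivative F (at (t, x)) (r, 0)"
    using frechet_derivative_at[OF d1] frechet_derivative_at[OF d2] by metis+
qed

lemma differentiable_line_deriv:
  fixes g :: "'a::real_normed_vector \<Rightarrow> real"
  assumes "g differentiable (at x)"
  shows "((\<lambda>s. g (x + s *\<^sub>R e)) has_real_derivative frechet_derivative g (at x) e) (at 0)"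
proof -
  have g: "(g has_derivative frechet_derivative g (at x)) (at (x + 0 *\<^sub>R e))"
    using frechet_derivative_works[THEN iffD1, OF assms] by simp
  have "((\<lambda>s. x + s *\<^sub>R e) has_derivative (\<lambda>h. h *\<^sub>R e)) (at 0)"
    by (auto intro!: derivative_eq_intros)
  from diff_chain_at[OF this g]
  have "((\<lambda>s. g (x + s *\<^sub>R e)) has_derivative (\<lambda>h. frechet_derivative g (at x) (h *\<^sub>R e))) (at 0)"
    by (simp add: o_def)
  moreover have "frechet_derivative g (at x) (h *\<^sub>R e) = frechet_derivative g (at x) e * h" for h
    using linear_cmul[OF linear_frechet_derivative[OF assms]] by simp
  ultimately show ?thesis by (simp add: has_field_derivative_def)
qed

lemma partial_deriv_eqI:
  assumes "g differentiable (at x)" "((\<lambda>s. g (x + s *\<^sub>R axis i 1)) has_real_derivative d) (at 0)"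
  shows "partial_deriv i g x = d"
  unfolding partial_deriv_def using DERIV_unique[OF differentiable_line_deriv[OF assms(1)] assms(2)] .

lemma Ck_on_imp_continuous_on:
  assumes "open S" "Ck_on k S g" shows "continuous_on S g"
  using assms by (cases k) (auto intro!: continuous_at_imp_continuous_on differentiable_imp_continuous_within)

text \<open>\<open>D = diag \<delta>\<close>; \<open>ft\<close>, \<open>fi i\<close>, \<open>fii i\<close> are \<open>\<partial>\<^sub>t f\<close>, \<open>\<partial>\<^sub>i f\<close>, \<open>\<partial>\<^sub>i\<^sup>2 f\<close>.\<close>

locale fp_data =
  fixes \<delta> :: "'n::finite \<Rightarrow> real" and C :: "real^'n^'n" and f ft :: "real \<Rightarrow> real^'n \<Rightarrow> real"
    and fi fii :: "'n \<Rightarrow> real \<Rightarrow> real^'n \<Rightarrow> real"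
  assumes cont_f: "continuous_on ({0<..} \<times> UNIV) (\<lambda>(t, x). f t x)"
    and cont_ft: "continuous_on ({0<..} \<times> UNIV) (\<lambda>(t, x). ft t x)"
    and cont_fi: "0 < t \<Longrightarrow> continuous_on UNIV (fi i t)"
    and cont_fii: "0 < t \<Longrightarrow> continuous_on UNIV (fii i t)"
    and deriv_t: "0 < t \<Longrightarrow> ((\<lambda>s. f s x) has_real_derivative ft t x) (at t)"
    and deriv_i: "0 < t \<Longrightarrow> ((\<lambda>s. f t (x + s *\<^sub>R axis i 1)) has_real_derivative fi i t x) (at 0)"
    and deriv_ii: "0 < t \<Longrightarrow> ((\<lambda>s. fi i t (x + s *\<^sub>R axis i 1)) has_real_derivative fii i t x) (at 0)"
    and eqn: "0 < t \<Longrightarrow> ft t x = (\<Sum>i\<in>UNIV. \<delta> i * fii i t x + fi i t x * (C *v x) $ i + f t x * C $ i $ i)"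

lemma diag_matrix_vector:
  "((\<chi> i j. if i = j then \<delta> i else 0) *v x) $ i = \<delta> i * (x :: real^'n) $ i"
  by (simp add: matrix_vector_mult_def if_distrib[of "\<lambda>a. a * _"] sum.delta cong: if_cong)

lemma matrix_vector_line_deriv:
  "((\<lambda>s. (C *v (x + s *\<^sub>R axis i 1)) $ i) has_real_derivative (C :: real^'n^'n) $ i $ i) (at 0)"
proof -
  have "(C *v (x + s *\<^sub>R axis i 1)) $ i = (C *v x) $ i + s * C $ i $ i" for s
    by (simp add: matrix_vector_right_distrib matrix_vector_mult_scaleR matrix_vector_mult_basis column_def)
  then show ?thesis by (auto intro!: derivative_eq_intros)
qed

text \<open>Reduces joint smoothness to the few continuous derivatives needed below. As D is
  diagonal, the product rule expands the divergence into pure second derivatives, the drift term and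
  the trace of C.\<close>

lemma fp_solution_fp_data:
  fixes C :: "real^'n^'n"
  assumes sol: "fp_solution (\<chi> i j. if i = j then \<delta> i else 0) C f0 f"
  shows "\<exists>ft fi fii. fp_data \<delta> C f ft fi fii"
proof -
  define S where "S = {0::real<..} \<times> (UNIV :: (real^'n) set)"
  have oS: "open S" unfolding S_def by (intro open_Times) auto
  define F where "F = (\<lambda>(t, x). f t x)"
  define Fd where "Fd b p = frechet_derivative F (at p) b" for b p
  define Fdd where "Fdd b p = frechet_derivative (Fd b) (at p) b" for b p
  have Ck: "Ck_on k S F" for k using sol unfolding fp_solution_def Cinf_on_def F_def S_def by blast
  have dF: "F differentiable (at p)" if "p \<in> S" for p using Ck[of 1] that by simp
  have CF: "Ck_on k S (Fd b)" if "b \<in> Basis" for k b using Ck[of "Suc k"] that by (simp add: Fd_def[abs_def])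
  have dFd: "Fd b differentiable (at p)" if "p \<in> S" "b \<in> Basis" for p b using CF[OF that(2), of 1] that by simp
  have cFd: "continuous_on S (Fd b)" if "b \<in> Basis" for b using Ck_on_imp_continuous_on[OF oS CF[OF that]] .
  have cFdd: "continuous_on S (Fdd b)" if "b \<in> Basis" for b
    using CF[OF that, of "Suc 0"] that by (simp add: Fdd_def[abs_def])
  have bt: "(1, 0) \<in> (Basis :: (real \<times> (real^'n)) set)" by (simp add: Basis_prod_def)
  have bi: "(0, axis i 1) \<in> (Basis :: (real \<times> (real^'n)) set)" for i by (auto simp: Basis_prod_def axis_in_Basis_iff)
  define ft where "ft t x = Fd (1, 0) (t, x)" for t x
  define fi where "fi i t x = Fd (0, axis i 1) (t, x)" for i t x
  define fii where "fii i t x = Fdd (0, axis i 1) (t, x)" for i t x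
  have inS: "(t, x) \<in> S" if "0 < t" for t x using that by (simp add: S_def)
  have df: "f t differentiable (at x)" and pf: "partial_deriv i (f t) x = fi i t x" if "0 < t" for t x i
    using differentiable_section(1,2)[OF dF[OF inS[OF that, of x]]] by (simp_all add: F_def fi_def Fd_def partial_deriv_def)
  have dfi: "fi i t differentiable (at x)" and pfi: "frechet_derivative (fi i t) (at x) (axis i 1) = fii i t x" if "0 < t" for t x i
    using differentiable_section(1,2)[OF dFd[OF inS[OF that, of x] bi[of i]]] by (simp_all add: fi_def[abs_def] fii_def Fdd_def)
  have D_t: "((\<lambda>s. f s x) has_real_derivative ft t x) (at t)" if "0 < t" for t x
  proof -
    have "((\<lambda>s. f (t + s *\<^sub>R 1) x) has_real_derivative ft t x) (at 0)"
      using differentiable_line_deriv[OF differentiable_section(3)[OF dF[OF inS[OF that, of x]]], of 1]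
      unfolding differentiable_section(4)[OF dF[OF inS[OF that, of x]]] by (simp add: F_def ft_def Fd_def)
    then show ?thesis using DERIV_shift[of "\<lambda>s. f s x" _ 0 t] by (simp add: add.commute)
  qed
  have D_i: "((\<lambda>s. f t (x + s *\<^sub>R axis i 1)) has_real_derivative fi i t x) (at 0)" if "0 < t" for t x i
    using differentiable_line_deriv[OF df[OF that, of x], of "axis i 1"] pf[OF that] by (simp add: partial_deriv_def)
  have D_ii: "((\<lambda>s. fi i t (x + s *\<^sub>R axis i 1)) has_real_derivative fii i t x) (at 0)" if "0 < t" for t x i
    using differentiable_line_deriv[OF dfi[OF that, of i x], of "axis i 1"] pfi[OF that] by simp
  have "fp_data \<delta> C f ft fi fii"
  proof
    show "continuous_on ({0<..} \<times> UNIV) (\<lambda>(t, x). f t x)"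
      using Ck_on_imp_continuous_on[OF oS Ck] unfolding F_def S_def .
    show "continuous_on ({0<..} \<times> UNIV) (\<lambda>(t, x). ft t x)"
      using cFd[OF bt] unfolding S_def by (simp add: ft_def split_beta)
    show "continuous_on UNIV (fi i t)" "continuous_on UNIV (fii i t)" if "0 < t" for i t
      unfolding fi_def[abs_def] fii_def[abs_def]
      by (rule continuous_on_compose2[OF cFd[OF bi]] continuous_on_compose2[OF cFdd[OF bi]];
          use inS[OF that] in \<open>auto intro!: continuous_intros\<close>)+
    fix t :: real and x :: "real^'n" assume t: "0 < t"
    have "ft t x = deriv (\<lambda>s. f s x) t" using DERIV_imp_deriv[OF D_t[OF t]] by simp
    also have "\<dots> = divergence (\<lambda>y. (\<chi> i j. if i = j then \<delta> i else 0) *v gradient (f t) y + f t y *\<^sub>R (C *v y)) x"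
      using sol t unfolding fp_solution_def by blast
    also have "\<dots> = (\<Sum>i\<in>UNIV. partial_deriv i (\<lambda>y. \<delta> i * fi i t y + f t y * (C *v y) $ i) x)"
      unfolding divergence_def by (simp add: diag_matrix_vector gradient_def pf[OF t])
    also have "\<dots> = (\<Sum>i\<in>UNIV. \<delta> i * fii i t x + fi i t x * (C *v x) $ i + f t x * C $ i $ i)"
    proof (intro sum.cong refl partial_deriv_eqI)
      fix i
      have "(\<lambda>y. (C *v y) $ i) differentiable (at x)"
        by (intro linear_imp_differentiable linearI) (simp_all add: matrix_vector_right_distrib matrix_vector_mult_scaleR)
      then show "(\<lambda>y. \<delta> i * fi i t y + f t y * (C *v y) $ i) differentiable (at x)"
        using df[OF t] dfi[OF t] by (intro derivative_intros) auto
      show "((\<lambda>s. \<delta> i * fi i t (x + s *\<^sub>R axis i 1) + f t (x + s *\<^sub>R axis i 1) * (C *v (x + s *\<^sub>R axis i 1)) $ i)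
         has_real_derivative \<delta> i * fii i t x + fi i t x * (C *v x) $ i + f t x * C $ i $ i) (at 0)"
        by (rule DERIV_cong[OF DERIV_add[OF DERIV_cmult[OF D_ii[OF t]] DERIV_mult[OF D_i[OF t] matrix_vector_line_deriv]]]) simp
    qed
    finally show "ft t x = (\<Sum>i\<in>UNIV. \<delta> i * fii i t x + fi i t x * (C *v x) $ i + f t x * C $ i $ i)" .
  qed (use D_t D_i D_ii in auto)
  then show ?thesis by blast
qed

lemma continuous_on_matrix_vector: "continuous_on UNIV (\<lambda>x. (C *v (x :: real^'n)) $ i)"
  by (intro continuous_intros linear_continuous_on matrix_vector_mul_bounded_linear)

context fp_data
begin

lemma cont_f':
  assumes "0 < t" shows "continuous_on UNIV (f t)"
proof -
  have "continuous_on UNIV (\<lambda>x. (\<lambda>(t, x). f t x) (t, x))"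
    by (rule continuous_on_compose2[OF cont_f]) (use assms in \<open>auto intro!: continuous_intros\<close>)
  then show ?thesis by simp
qed

lemma cont_ft':
  assumes "0 < t" shows "continuous_on UNIV (ft t)"
proof -
  have "continuous_on UNIV (\<lambda>x. (\<lambda>(t, x). ft t x) (t, x))"
    by (rule continuous_on_compose2[OF cont_ft]) (use assms in \<open>auto intro!: continuous_intros\<close>)
  then show ?thesis by simp
qed

text \<open>The difference of the two integrands is a sum of directional derivatives of compactly
  supported functions, so it integrates to 0.\<close>

lemma weak_formulation:
  fixes p :: "real^'n \<Rightarrow> real" and p1 p2 :: "'n \<Rightarrow> real^'n \<Rightarrow> real"
  assumes t: "0 < t"
    and p: "continuous_on UNIV p" "\<And>i. continuous_on UNIV (p1 i)" "\<And>i. continuous_on UNIV (p2 i)"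
    and d1: "\<And>i x. ((\<lambda>s. p (x + s *\<^sub>R axis i 1)) has_real_derivative p1 i x) (at 0)"
    and d2: "\<And>i x. ((\<lambda>s. p1 i (x + s *\<^sub>R axis i 1)) has_real_derivative p2 i x) (at 0)"
    and out: "\<And>x. R < norm x \<Longrightarrow> p x = 0" "\<And>i x. R < norm x \<Longrightarrow> p1 i x = 0" "\<And>i x. R < norm x \<Longrightarrow> p2 i x = 0"
  shows "(LINT x|lborel. ft t x * p x) = (LINT x|lborel. f t x * (\<Sum>i\<in>UNIV. \<delta> i * p2 i x - (C *v x) $ i * p1 i x))"
proof -
  \<comment> \<open>The flux in direction i times \<open>p\<close>, corrected by a term that makes
    the products of first derivatives of f and \<open>p\<close> cancel in \<open>h'\<close>.\<close>
  define h where "h i x = (\<delta> i * fi i t x + f t x * (C *v x) $ i) * p x - \<delta> i * f t x * p1 i x" for i x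
  define h' where "h' i x = (\<delta> i * fii i t x + fi i t x * (C *v x) $ i + f t x * C $ i $ i) * p x
      + f t x * (C *v x) $ i * p1 i x - \<delta> i * f t x * p2 i x" for i x
  note cont = cont_f'[OF t] cont_fi[OF t] cont_fii[OF t] p continuous_on_matrix_vector
  have ch: "continuous_on UNIV (h i)" and ch': "continuous_on UNIV (h' i)" for i
    unfolding h_def h'_def by (intro continuous_intros cont)+
  have oh: "h i x = 0" and oh': "h' i x = 0" if "R < norm x" for i x using out that by (simp_all add: h_def h'_def)
  have "((\<lambda>s. h i (x + s *\<^sub>R axis i 1)) has_real_derivative h' i x) (at 0)" for i x
    unfolding h_def
    by (rule DERIV_cong[OF DERIV_diff[OF DERIV_mult[OF DERIV_add[OF DERIV_cmult[OF deriv_ii[OF t]]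
              DERIV_mult[OF deriv_i[OF t] matrix_vector_line_deriv]] d1] DERIV_mult[OF DERIV_cmult[OF deriv_i[OF t]] d2]]])
      (simp add: h'_def algebra_simps)
  then have 0: "(LINT x|lborel. h' i x) = 0" for i
    by (rule integral_directional_derivative_eq_0[OF _ ch ch' oh oh'])
  obtain a :: "real^'n" where a: "cball 0 R \<subseteq> cbox (- a) a" using cball_subset_cbox_symmetric by blast
  have big: "R < norm x" if "x \<notin> cbox (- a) a" for x using a that by force
  have ih': "integrable lborel (h' i)" for i
    by (rule compact_support_integral(1)[OF ch']) (rule oh'[OF big])
  have sum: "(\<Sum>i\<in>UNIV. h' i x) = ft t x * p x - f t x * (\<Sum>i\<in>UNIV. \<delta> i * p2 i x - (C *v x) $ i * p1 i x)" for x
    unfolding h'_def eqn[OF t] by (simp add: sum.distrib sum_subtractf sum_distrib_left sum_distrib_right algebra_simps)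
  have "integrable lborel (\<lambda>x. ft t x * p x)"
    by (rule compact_support_integral(1)[of _ "- a" a])
      (use out(1)[OF big] in \<open>auto intro!: continuous_intros cont_ft'[OF t] p\<close>)
  moreover have "integrable lborel (\<lambda>x. f t x * (\<Sum>i\<in>UNIV. \<delta> i * p2 i x - (C *v x) $ i * p1 i x))"
    by (rule compact_support_integral(1)[of _ "- a" a])
      (use out[OF big] in \<open>auto intro!: continuous_intros cont\<close>)
  ultimately have "(LINT x|lborel. ft t x * p x) - (LINT x|lborel. f t x * (\<Sum>i\<in>UNIV. \<delta> i * p2 i x - (C *v x) $ i * p1 i x))
      = (LINT x|lborel. (\<Sum>i\<in>UNIV. h' i x))"
    unfolding sum by simp
  also have "\<dots> = 0" using ih' 0 by simp
  finally show ?thesis by simp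
qed

end

section \<open>Duality and the Fourier transform of a solution\<close>

locale fp_duality = fp_data \<delta> C f ft fi fii
  for \<delta> :: "'n::finite \<Rightarrow> real" and C :: "real^'n^'n" and f ft :: "real \<Rightarrow> real^'n \<Rightarrow> real"
    and fi fii :: "'n \<Rightarrow> real \<Rightarrow> real^'n \<Rightarrow> real" +
  fixes f0 :: "real^'n \<Rightarrow> real"
  assumes \<delta>_nonneg: "0 \<le> \<delta> i"
    and sym_part: "(1/2) *\<^sub>R (C + transpose C) = (\<chi> i j. if i = j then \<delta> i else 0)"
    and int_f: "0 < t \<Longrightarrow> integrable lborel (f t)"
    and int_f0: "integrable lborel f0"
    and L1_cont: "0 < t \<Longrightarrow> ((\<lambda>s. LINT x|lborel. \<bar>f s x - f t x\<bar>) \<longlongrightarrow> 0) (at t)"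
    and L1_init: "((\<lambda>s. LINT x|lborel. \<bar>f s x - f0 x\<bar>) \<longlongrightarrow> 0) (at_right 0)"
begin

lemma energy: "v \<bullet> (C *v v) = (\<Sum>i\<in>UNIV. \<delta> i * (v $ i)\<^sup>2)"
proof -
  have "v \<bullet> (C *v v) = v \<bullet> ((\<chi> i j. if i = j then \<delta> i else 0) *v v)" by (rule inner_symmetric_part(2)[OF sym_part])
  also have "\<dots> = (\<Sum>i\<in>UNIV. \<delta> i * (v $ i)\<^sup>2)"
    by (simp add: inner_vec_def diag_matrix_vector power2_eq_square mult_ac)
  finally show ?thesis .
qed

lemma dissipative: "v \<bullet> ((- transpose C) *v v) \<le> 0"
proof -
  have "v \<bullet> ((- transpose C) *v v) = - (\<Sum>i\<in>UNIV. \<delta> i * (v $ i)\<^sup>2)"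
    using inner_symmetric_part[OF sym_part, of v] energy[of v] by linarith
  then show ?thesis by (simp add: sum_nonneg \<delta>_nonneg)
qed

text \<open>Gives one L^1 bound on every compact interval of positive times, so that the cutoff
  error can be made small uniformly in time.\<close>

lemma L1_norm_continuous: "continuous_on {0<..} (\<lambda>t. LINT x|lborel. \<bar>f t x\<bar>)"
proof -
  have "((\<lambda>s. LINT x|lborel. \<bar>f s x\<bar>) \<longlongrightarrow> (LINT x|lborel. \<bar>f t x\<bar>)) (at t)" if t: "0 < t" for t
  proof (rule Lim_transform)
    show "((\<lambda>s. (LINT x|lborel. \<bar>f t x\<bar>)) \<longlongrightarrow> (LINT x|lborel. \<bar>f t x\<bar>)) (at t)" by simp
    have "\<forall>\<^sub>F s in at t. 0 < s"
      using t by (intro eventually_at_in_open'[of "{0<..}", THEN eventually_mono]) auto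
    then have "\<forall>\<^sub>F s in at t. norm ((LINT x|lborel. \<bar>f s x\<bar>) - (LINT x|lborel. \<bar>f t x\<bar>)) \<le> (LINT x|lborel. \<bar>f s x - f t x\<bar>)"
    proof eventually_elim
      case (elim s)
      note i = int_f[OF elim] int_f[OF t]
      have "(LINT x|lborel. \<bar>f s x\<bar>) - (LINT x|lborel. \<bar>f t x\<bar>) = (LINT x|lborel. \<bar>f s x\<bar> - \<bar>f t x\<bar>)" using i by simp
      also have "norm \<dots> \<le> (LINT x|lborel. \<bar>f s x - f t x\<bar>)"
        by (rule Bochner_Integration.integral_norm_bound_integral) (use i in auto)
      finally show ?case .
    qed
    then show "((\<lambda>s. (LINT x|lborel. \<bar>f s x\<bar>) - (LINT x|lborel. \<bar>f t x\<bar>)) \<longlongrightarrow> 0) (at t)"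
      by (rule Lim_null_comparison) (rule L1_cont[OF t])
  qed
  then show ?thesis
    by (auto simp: continuous_on_def intro: tendsto_within_subset)
qed

section \<open>Plane-wave solutions of the backward equation\<close>

context
  fixes T c :: real and \<xi> :: "real^'n"
  assumes T: "0 < T"
begin

definition dual_freq :: "real \<Rightarrow> real^'n" where "dual_freq t = mat_flow (- transpose C) (T - t) \<xi>"

text \<open>Because the frequency obeys \<xi>_t' = C^T \<xi>_t, this is exp of minus the integral of
  \<xi>_s . D \<xi>_s over s from t to T: the damping by diffusion, in closed form. It equals 1 at t
  = T.\<close>

definition dual_amp :: "real \<Rightarrow> real" where "dual_amp t = exp (- ((norm \<xi>)\<^sup>2 - (norm (dual_freq t))\<^sup>2) / 2)"

text \<open>The phase \<open>c\<close> covers cosine and sine at once, and later carries the point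
  at which the transform is inverted.\<close>

definition test :: "real \<Rightarrow> real^'n \<Rightarrow> real" where "test t x = dual_amp t * cos (dual_freq t \<bullet> x - c)"

definition test_d1 :: "'n \<Rightarrow> real \<Rightarrow> real^'n \<Rightarrow> real" where "test_d1 i t x = - (dual_amp t * dual_freq t $ i * sin (dual_freq t \<bullet> x - c))"

definition test_d2 :: "'n \<Rightarrow> real \<Rightarrow> real^'n \<Rightarrow> real" where "test_d2 i t x = - (dual_amp t * (dual_freq t $ i)\<^sup>2 * cos (dual_freq t \<bullet> x - c))"

definition test_dt :: "real \<Rightarrow> real^'n \<Rightarrow> real" where
  "test_dt t x = dual_amp t * (dual_freq t \<bullet> (C *v dual_freq t)) * cos (dual_freq t \<bullet> x - c) - dual_amp t * (dual_freq t \<bullet> (C *v x)) * sin (dual_freq t \<bullet> x - c)"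

lemma dual_freq_deriv: "(dual_freq has_vector_derivative transpose C *v dual_freq t) (at t)"
proof -
  have "((\<lambda>s. T - s) has_vector_derivative - 1) (at t)" by (auto intro!: derivative_eq_intros)
  from vector_diff_chain_at[OF this mat_flow_deriv[of "- transpose C" \<xi>]]
  show ?thesis by (simp add: dual_freq_def[abs_def] o_def neg_matrix_mult del: transpose_matrix_vector)
qed

lemma dual_freq_continuous: "continuous_on UNIV dual_freq"
  using dual_freq_deriv by (meson continuous_at_imp_continuous_on has_vector_derivative_continuous)

lemma dual_freq_norm: assumes "t \<le> T" shows "norm (dual_freq t) \<le> norm \<xi>"
  using mat_flow_antimono[OF dissipative, of 0 "T - t" \<xi>] assms
  by (simp add: dual_freq_def)

lemma dual_amp_bounds: assumes "t \<le> T" shows "0 < dual_amp t" "dual_amp t \<le> 1"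
  using dual_freq_norm[OF assms] by (simp_all add: dual_amp_def power_mono)

lemma dual_amp_deriv: "(dual_amp has_real_derivative dual_amp t * (dual_freq t \<bullet> (C *v dual_freq t))) (at t)"
proof -
  have "((\<lambda>t. (norm (dual_freq t))\<^sup>2) has_real_derivative 2 * (dual_freq t \<bullet> (C *v dual_freq t))) (at t)"
    unfolding power2_norm_eq_inner has_real_derivative_iff_has_vector_derivative
    by (rule has_vector_derivative_eq_rhs[OF bounded_bilinear.has_vector_derivative[OF bounded_bilinear_inner dual_freq_deriv dual_freq_deriv]])
      (simp add: matrix_transpose_inner inner_commute del: transpose_matrix_vector)
  from DERIV_chain2[OF DERIV_exp DERIV_cdivide[OF DERIV_minus[OF DERIV_diff[OF DERIV_const[where k = "(norm \<xi>)\<^sup>2"] this]], where c = 2]]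
  show ?thesis unfolding dual_amp_def by (rule DERIV_cong) simp
qed

lemma dual_amp_continuous: "continuous_on UNIV dual_amp"
  using dual_amp_deriv by (meson continuous_at_imp_continuous_on DERIV_isCont)

lemma phase_deriv_t: "((\<lambda>t. dual_freq t \<bullet> x - c) has_real_derivative dual_freq t \<bullet> (C *v x)) (at t)"
proof -
  have "((\<lambda>t. dual_freq t \<bullet> x) has_vector_derivative (transpose C *v dual_freq t) \<bullet> x) (at t)"
    by (rule bounded_linear.has_vector_derivative[OF bounded_linear_inner_left dual_freq_deriv])
  moreover have "(transpose C *v dual_freq t) \<bullet> x = dual_freq t \<bullet> (C *v x)"
    by (metis matrix_transpose_inner inner_commute)
  ultimately show ?thesis
    unfolding has_real_derivative_iff_has_vector_derivative by (auto intro!: derivative_eq_intros)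
qed

lemma test_deriv_t: "((\<lambda>t. test t x) has_real_derivative test_dt t x) (at t)"
  unfolding test_def
  by (rule DERIV_cong[OF DERIV_mult[OF dual_amp_deriv DERIV_chain2[OF DERIV_cos phase_deriv_t]]])
    (simp add: test_dt_def algebra_simps)

lemma phase_deriv_i: "((\<lambda>s. dual_freq t \<bullet> (x + s *\<^sub>R axis i 1) - c) has_real_derivative dual_freq t $ i) (at 0)"
  by (auto intro!: derivative_eq_intros simp: inner_add_right inner_axis)

lemma test_deriv_i: "((\<lambda>s. test t (x + s *\<^sub>R axis i 1)) has_real_derivative test_d1 i t x) (at 0)"
  unfolding test_def
  by (rule DERIV_cong[OF DERIV_cmult[OF DERIV_chain2[OF DERIV_cos phase_deriv_i]]]) (simp add: test_d1_def)

lemma test_d1_deriv_i: "((\<lambda>s. test_d1 i t (x + s *\<^sub>R axis i 1)) has_real_derivative test_d2 i t x) (at 0)"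
  unfolding test_d1_def
  by (rule DERIV_cong[OF DERIV_minus[OF DERIV_cmult[OF DERIV_chain2[OF DERIV_sin phase_deriv_i]]]])
    (simp add: test_d2_def power2_eq_square)

text \<open>The cosine terms cancel because growth of the amplitude compensates diffusion, by
  \<open>energy\<close>; the sine terms cancel because the motion of the frequency compensates the
  drift.\<close>

lemma test_adjoint_equation: "test_dt t x + (\<Sum>i\<in>UNIV. \<delta> i * test_d2 i t x - (C *v x) $ i * test_d1 i t x) = 0"
  unfolding test_dt_def test_d1_def test_d2_def energy
  by (simp add: inner_vec_def sum_subtractf sum_negf sum_distrib_left sum_distrib_right mult_ac)

lemma test_bounds:
  assumes "t \<le> T" shows "\<bar>test t x\<bar> \<le> 1" "\<bar>test_d1 i t x\<bar> \<le> norm \<xi>"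
proof -
  note a = dual_amp_bounds[OF assms]
  show "\<bar>test t x\<bar> \<le> 1" unfolding test_def abs_mult using a mult_mono[of "dual_amp t" 1 "\<bar>cos (dual_freq t \<bullet> x - c)\<bar>" 1] by simp
  have "\<bar>dual_freq t $ i\<bar> \<le> norm \<xi>" using component_le_norm_cart dual_freq_norm[OF assms] order_trans by blast
  then have "dual_amp t * \<bar>dual_freq t $ i\<bar> * \<bar>sin (dual_freq t \<bullet> x - c)\<bar> \<le> 1 * norm \<xi> * 1" using a by (intro mult_mono) auto
  then show "\<bar>test_d1 i t x\<bar> \<le> norm \<xi>" unfolding test_d1_def abs_minus_cancel abs_mult using a by simp
qed

lemma test_continuous:
  "continuous_on UNIV (test t)" "continuous_on UNIV (test_d1 i t)" "continuous_on UNIV (test_d2 i t)"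
  unfolding test_def[abs_def] test_d1_def[abs_def] test_d2_def[abs_def] by (intro continuous_intros)+

lemma test_joint_continuous:
  "continuous_on UNIV (\<lambda>p. test (fst p) (snd p))" "continuous_on UNIV (\<lambda>p. test_dt (fst p) (snd p))"
proof -
  have a: "continuous_on UNIV (\<lambda>p. dual_freq (fst p))" "continuous_on UNIV (\<lambda>p. dual_amp (fst p))"
    by (rule continuous_on_compose2[OF dual_freq_continuous] continuous_on_compose2[OF dual_amp_continuous];
        auto intro!: continuous_intros)+
  have m: "continuous_on UNIV (\<lambda>p. C *v g p)" if "continuous_on UNIV g" for g :: "real \<times> (real^'n) \<Rightarrow> real^'n"
    using bounded_linear.continuous_on[OF matrix_vector_mul_bounded_linear that] .
  show "continuous_on UNIV (\<lambda>p. test (fst p) (snd p))" "continuous_on UNIV (\<lambda>p. test_dt (fst p) (snd p))"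
    unfolding test_def test_dt_def by (intro continuous_intros a m)+
qed

definition drift_const :: real where "drift_const = (SOME K. \<forall>x. norm (C *v x) \<le> norm x * K)"

lemma drift_const: "norm (C *v x) \<le> norm x * drift_const"
proof -
  have "\<exists>K. \<forall>x. norm (C *v x) \<le> norm x * K"
    using bounded_linear.bounded[OF matrix_vector_mul_bounded_linear[of C]] .
  from someI_ex[OF this] show ?thesis unfolding drift_const_def by blast
qed

text \<open>What the backward operator leaves of \<open>test\<close> times \<open>cutoff\<close>:
  exactly the product-rule terms with at least one derivative on the cutoff.\<close>

definition cutoff_error :: "real \<Rightarrow> real \<Rightarrow> real^'n \<Rightarrow> real" where
  "cutoff_error \<epsilon> t x = (\<Sum>i\<in>UNIV. \<delta> i * (2 * test_d1 i t x * cutoff_d1 \<epsilon> i x + test t x * cutoff_d2 \<epsilon> i x))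
     - test t x * (\<Sum>i\<in>UNIV. (C *v x) $ i * cutoff_d1 \<epsilon> i x)"

text \<open>Linear in \<epsilon> and uniform in x and in t \<le> T. The constant 12 is twice the
  first-derivative bound 6, 42 is the second-derivative bound, and the last term bounds the drift
  acting on the cutoff.\<close>

lemma cutoff_error_bound:
  assumes "t \<le> T" "0 \<le> \<epsilon>" "\<epsilon> \<le> 1"
  shows "\<bar>cutoff_error \<epsilon> t x\<bar> \<le> \<epsilon> * ((\<Sum>i\<in>UNIV. \<delta> i * (12 * norm \<xi> + 42)) + 6 * drift_const)"
proof -
  note b = test_bounds[OF assms(1)]
  have "\<bar>\<delta> i * (2 * test_d1 i t x * cutoff_d1 \<epsilon> i x + test t x * cutoff_d2 \<epsilon> i x)\<bar> \<le> \<delta> i * (\<epsilon> * (12 * norm \<xi> + 42))" for i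
  proof -
    have "\<bar>test_d1 i t x\<bar> * \<bar>cutoff_d1 \<epsilon> i x\<bar> \<le> norm \<xi> * (6 * \<epsilon>)"
      by (intro mult_mono b cutoff_d1_bound assms) auto
    moreover have "\<bar>test t x\<bar> * \<bar>cutoff_d2 \<epsilon> i x\<bar> \<le> 1 * (42 * \<epsilon>)"
      by (intro mult_mono b cutoff_d2_bound assms) auto
    ultimately have "\<bar>2 * test_d1 i t x * cutoff_d1 \<epsilon> i x + test t x * cutoff_d2 \<epsilon> i x\<bar> \<le> \<epsilon> * (12 * norm \<xi> + 42)"
      unfolding abs_mult[symmetric] by (simp add: algebra_simps)
    then show ?thesis using \<delta>_nonneg[of i] by (simp add: abs_mult mult_left_mono)
  qed
  then have "\<bar>\<Sum>i\<in>UNIV. \<delta> i * (2 * test_d1 i t x * cutoff_d1 \<epsilon> i x + test t x * cutoff_d2 \<epsilon> i x)\<bar>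
      \<le> (\<Sum>i\<in>UNIV. \<delta> i * (\<epsilon> * (12 * norm \<xi> + 42)))"
    by (intro order_trans[OF sum_abs] sum_mono)
  moreover have "\<bar>test t x\<bar> * \<bar>\<Sum>i\<in>UNIV. (C *v x) $ i * cutoff_d1 \<epsilon> i x\<bar> \<le> 1 * (6 * \<epsilon> * drift_const)"
    by (intro mult_mono b cutoff_drift_bound assms drift_const) auto
  moreover have "(\<Sum>i\<in>UNIV. \<delta> i * (\<epsilon> * (12 * norm \<xi> + 42))) = \<epsilon> * (\<Sum>i\<in>UNIV. \<delta> i * (12 * norm \<xi> + 42))"
    unfolding sum_distrib_left by (intro sum.cong) auto
  ultimately show ?thesis unfolding cutoff_error_def abs_mult[symmetric] distrib_left by linarith
qed

text \<open>Differentiate under the integral over a box containing the support, move the equation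
  for f onto the product test function, and use the backward equation: only derivatives of the
  cutoff survive.\<close>

lemma truncated_pairing_deriv:
  assumes t: "0 < t" and \<epsilon>: "0 < \<epsilon>"
  shows "((\<lambda>s. LINT x|lborel. f s x * (test s x * cutoff \<epsilon> x)) has_real_derivative (LINT x|lborel. f t x * cutoff_error \<epsilon> t x)) (at t)"
proof -
  obtain a :: "real^'n" where a: "cball 0 (exp (1 / \<epsilon>)) \<subseteq> cbox (- a) a" using cball_subset_cbox_symmetric by blast
  have big: "exp (1 / \<epsilon>) < norm x" if "x \<notin> cbox (- a) a" for x using a that by force
  note out = cutoff_support[OF \<epsilon> big]
  have int: "integral (cbox (- a) a) (\<lambda>x. f s x * (test s x * cutoff \<epsilon> x)) = (LINT x|lborel. f s x * (test s x * cutoff \<epsilon> x))"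
    if "0 < s" for s
    by (rule compact_support_integral(2))
      (use that in \<open>auto simp: out intro!: continuous_intros cont_f' test_continuous continuous_cut\<close>)
  define g' where "g' s x = ft s x * (test s x * cutoff \<epsilon> x) + f s x * (test_dt s x * cutoff \<epsilon> x)" for s x
  have j: "continuous_on UNIV (\<lambda>p::real \<times> (real^'n). cutoff \<epsilon> (snd p))"
    by (rule continuous_on_compose2[OF continuous_cut(1)]) (auto intro!: continuous_intros)
  have "((\<lambda>s. integral (cbox (- a) a) (\<lambda>x. f s x * (test s x * cutoff \<epsilon> x))) has_field_derivative
      integral (cbox (- a) a) (g' t)) (at t within {0<..})"
  proof (rule leibniz_rule_field_derivative)
    show "((\<lambda>s. f s x * (test s x * cutoff \<epsilon> x)) has_field_derivative g' s x) (at s within {0<..})" if "s \<in> {0<..}" for s x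
    proof (rule has_field_derivative_at_within)
      have "0 < s" using that by simp
      show "((\<lambda>s. f s x * (test s x * cutoff \<epsilon> x)) has_field_derivative g' s x) (at s)"
        by (rule DERIV_cong[OF DERIV_mult[OF deriv_t[OF \<open>0 < s\<close>] DERIV_cmult_right[OF test_deriv_t]]]) (simp add: g'_def)
    qed
    show "(\<lambda>x. f s x * (test s x * cutoff \<epsilon> x)) integrable_on cbox (- a) a" if "s \<in> {0<..}" for s
      by (rule integrable_continuous)
        (use that in \<open>auto intro!: continuous_intros continuous_on_subset[OF cont_f'] continuous_on_subset[OF test_continuous(1)] continuous_on_subset[OF continuous_cut(1)]\<close>)
    show "continuous_on ({0<..} \<times> cbox (- a) a) (\<lambda>(s, x). g' s x)"
      unfolding g'_def split_beta
      by (intro continuous_intros continuous_on_subset[OF cont_f[unfolded split_beta]] continuous_on_subset[OF cont_ft[unfolded split_beta]]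
          continuous_on_subset[OF test_joint_continuous(1)] continuous_on_subset[OF test_joint_continuous(2)]
          continuous_on_subset[OF j]) auto
  qed (use t in auto)
  moreover have "at t within {0<..} = at t" using t by (intro at_within_open) auto
  ultimately have d: "((\<lambda>s. integral (cbox (- a) a) (\<lambda>x. f s x * (test s x * cutoff \<epsilon> x))) has_field_derivative
      integral (cbox (- a) a) (g' t)) (at t)" by simp
  have c1: "continuous_on UNIV (\<lambda>x. ft t x * (test t x * cutoff \<epsilon> x))"
    by (intro continuous_intros cont_ft' t test_continuous continuous_cut)
  have ct: "continuous_on UNIV (\<lambda>x. test_dt t x)"
    by (rule continuous_on_compose2[OF test_joint_continuous(2), of UNIV "\<lambda>x. (t, x)", simplified]) (auto intro!: continuous_intros)
  have c2: "continuous_on UNIV (\<lambda>x. f t x * (test_dt t x * cutoff \<epsilon> x))"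
    by (intro continuous_intros cont_f' t ct continuous_cut)
  define p1 where "p1 i x = test_d1 i t x * cutoff \<epsilon> x + test t x * cutoff_d1 \<epsilon> i x" for i x
  define p2 where "p2 i x = test_d2 i t x * cutoff \<epsilon> x + 2 * test_d1 i t x * cutoff_d1 \<epsilon> i x + test t x * cutoff_d2 \<epsilon> i x" for i x
  have w: "(LINT x|lborel. ft t x * (test t x * cutoff \<epsilon> x)) = (LINT x|lborel. f t x * (\<Sum>i\<in>UNIV. \<delta> i * p2 i x - (C *v x) $ i * p1 i x))"
  proof (rule weak_formulation[OF t])
    show "((\<lambda>s. test t (x + s *\<^sub>R axis i 1) * cutoff \<epsilon> (x + s *\<^sub>R axis i 1)) has_real_derivative p1 i x) (at 0)" for i x
      by (rule DERIV_cong[OF DERIV_mult[OF test_deriv_i cutoff_line_deriv]]) (simp add: p1_def)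
    show "((\<lambda>s. p1 i (x + s *\<^sub>R axis i 1)) has_real_derivative p2 i x) (at 0)" for i x
      unfolding p1_def
      by (rule DERIV_cong[OF DERIV_add[OF DERIV_mult[OF test_d1_deriv_i cutoff_line_deriv] DERIV_mult[OF test_deriv_i cutoff_d1_line_deriv]]])
        (simp add: p2_def)
    show "continuous_on UNIV (\<lambda>x. test t x * cutoff \<epsilon> x)" "continuous_on UNIV (p1 i)" "continuous_on UNIV (p2 i)" for i
      unfolding p1_def p2_def by (intro continuous_intros test_continuous continuous_cut)+
  next
    fix x :: "real^'n" and i assume "exp (1 / \<epsilon>) < norm x"
    from cutoff_support[OF \<epsilon> this]
    show "test t x * cutoff \<epsilon> x = 0" "p1 i x = 0" "p2 i x = 0" by (simp_all add: p1_def p2_def)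
  qed
  have errp: "(\<Sum>i\<in>UNIV. \<delta> i * p2 i x - (C *v x) $ i * p1 i x) + test_dt t x * cutoff \<epsilon> x = cutoff_error \<epsilon> t x" for x
  proof -
    have "(\<Sum>i\<in>UNIV. \<delta> i * p2 i x - (C *v x) $ i * p1 i x)
        = (\<Sum>i\<in>UNIV. \<delta> i * test_d2 i t x - (C *v x) $ i * test_d1 i t x) * cutoff \<epsilon> x + cutoff_error \<epsilon> t x"
      unfolding p1_def p2_def cutoff_error_def
      by (simp add: sum_distrib_left sum_distrib_right sum.distrib sum_subtractf algebra_simps)
    moreover have "(\<Sum>i\<in>UNIV. \<delta> i * test_d2 i t x - (C *v x) $ i * test_d1 i t x) = - test_dt t x"
      using test_adjoint_equation[of t x] by linarith
    ultimately show ?thesis by simp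
  qed
  have cp: "continuous_on UNIV (\<lambda>x. f t x * (\<Sum>i\<in>UNIV. \<delta> i * p2 i x - (C *v x) $ i * p1 i x))"
    unfolding p1_def p2_def
    by (intro continuous_intros cont_f' t test_continuous continuous_cut continuous_on_matrix_vector)
  have "integral (cbox (- a) a) (g' t) = (LINT x|lborel. g' t x)"
    by (rule compact_support_integral(2)) (use c1 c2 in \<open>auto simp: g'_def out intro!: continuous_intros\<close>)
  also have "\<dots> = (LINT x|lborel. ft t x * (test t x * cutoff \<epsilon> x)) + (LINT x|lborel. f t x * (test_dt t x * cutoff \<epsilon> x))"
    unfolding g'_def
    by (intro Bochner_Integration.integral_add compact_support_integral(1)[OF c1, of "- a" a]
        compact_support_integral(1)[OF c2, of "- a" a]) (auto simp: out)
  also have "\<dots> = (LINT x|lborel. f t x * (\<Sum>i\<in>UNIV. \<delta> i * p2 i x - (C *v x) $ i * p1 i x) + f t x * (test_dt t x * cutoff \<epsilon> x))"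
    unfolding w
    by (intro Bochner_Integration.integral_add[symmetric] compact_support_integral(1)[OF cp, of "- a" a]
        compact_support_integral(1)[OF c2, of "- a" a]) (auto simp: out p1_def p2_def)
  also have "\<dots> = (LINT x|lborel. f t x * cutoff_error \<epsilon> t x)"
    unfolding distrib_left[symmetric] errp ..
  finally have eq: "integral (cbox (- a) a) (g' t) = (LINT x|lborel. f t x * cutoff_error \<epsilon> t x)" .
  show ?thesis
    by (rule has_field_derivative_transform_within_open[OF d[unfolded eq], of "{0<..}"]) (use t int in auto)
qed

section \<open>Removing the cutoff and reaching the initial time\<close>

lemma tendsto_cut_seq: "(\<lambda>k. cutoff (1 / real (Suc k)) x) \<longlonglongrightarrow> 1"
proof (rule filterlim_compose[OF cutoff_tendsto])
  show "filterlim (\<lambda>k. 1 / real (Suc k)) (at_right 0) sequentially"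
    unfolding filterlim_at using LIMSEQ_Suc[OF lim_1_over_n] by (auto simp: eventually_sequentially)
qed

lemma pairing_untruncate:
  assumes t: "0 < t" "t \<le> T"
  shows "(\<lambda>k. LINT x|lborel. f t x * (test t x * cutoff (1 / real (Suc k)) x)) \<longlonglongrightarrow> (LINT x|lborel. f t x * test t x)"
proof (rule integral_dominated_convergence[where w = "\<lambda>x. \<bar>f t x\<bar>"])
  have [measurable]: "f t \<in> borel_measurable borel" "test t \<in> borel_measurable borel" "cutoff \<epsilon> \<in> borel_measurable borel" for \<epsilon>
    using borel_measurable_continuous_onI cont_f'[OF t(1)] test_continuous continuous_cut by blast+
  show "(\<lambda>x. f t x * test t x) \<in> borel_measurable lborel"
    "(\<lambda>x. f t x * (test t x * cutoff (1 / real (Suc k)) x)) \<in> borel_measurable lborel" for k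
    by measurable
  show "integrable lborel (\<lambda>x. \<bar>f t x\<bar>)" using int_f[OF t(1)] by simp
  show "AE x in lborel. (\<lambda>k. f t x * (test t x * cutoff (1 / real (Suc k)) x)) \<longlonglongrightarrow> f t x * test t x"
  proof (rule AE_I2)
    fix x
    have "(\<lambda>k. f t x * (test t x * cutoff (1 / real (Suc k)) x)) \<longlonglongrightarrow> f t x * (test t x * 1)"
      by (intro tendsto_mult tendsto_const tendsto_cut_seq)
    then show "(\<lambda>k. f t x * (test t x * cutoff (1 / real (Suc k)) x)) \<longlonglongrightarrow> f t x * test t x" by simp
  qed
  show "AE x in lborel. norm (f t x * (test t x * cutoff (1 / real (Suc k)) x)) \<le> \<bar>f t x\<bar>" for k
  proof (rule AE_I2)
    fix x
    have "\<bar>test t x\<bar> * \<bar>cutoff (1 / real (Suc k)) x\<bar> \<le> 1 * 1"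
      using test_bounds(1)[OF t(2), of x] cutoff_bounds[of "1 / real (Suc k)" x] by (intro mult_mono) auto
    then have "\<bar>f t x\<bar> * (\<bar>test t x\<bar> * \<bar>cutoff (1 / real (Suc k)) x\<bar>) \<le> \<bar>f t x\<bar> * 1" by (intro mult_left_mono) auto
    then show "norm (f t x * (test t x * cutoff (1 / real (Suc k)) x)) \<le> \<bar>f t x\<bar>" by (simp add: abs_mult del: of_nat_Suc)
  qed
qed

text \<open>By the mean value theorem the truncated pairing changes between s and T by at most a
  constant times \<epsilon>, with \<epsilon> = 1 / (k+1). The time s stays positive because the
  equation and the L^1 bound are available on [s,T] only.\<close>

lemma pairing_conserved:
  assumes s: "0 < s" "s < T"
  shows "(LINT x|lborel. f T x * test T x) = (LINT x|lborel. f s x * test s x)"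
proof -
  define M where "M = (\<Sum>i\<in>UNIV. \<delta> i * (12 * norm \<xi> + 42)) + 6 * drift_const"
  define Q where "Q k t = (LINT x|lborel. f t x * (test t x * cutoff (1 / real (Suc k)) x))" for k t
  define E where "E k t = (LINT x|lborel. f t x * cutoff_error (1 / real (Suc k)) t x)" for k t
  have "compact ((\<lambda>t. LINT x|lborel. \<bar>f t x\<bar>) ` {s..T})"
    using s by (intro compact_continuous_image continuous_on_subset[OF L1_norm_continuous]) auto
  then obtain B where B: "\<And>t. t \<in> {s..T} \<Longrightarrow> (LINT x|lborel. \<bar>f t x\<bar>) \<le> B"
    using compact_imp_bounded[THEN bounded_imp_bdd_above] unfolding bdd_above_def by (metis imageI)
  \<comment> \<open>The sign of M is read off from the error bound at \<epsilon> = 1.\<close>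
  have M0: "0 \<le> M" using cutoff_error_bound[of T 1 0] T unfolding M_def by (simp add: order_trans[OF abs_ge_zero])
  have E: "\<bar>E k t\<bar> \<le> 1 / real (Suc k) * (M * B)" if t: "t \<in> {s..T}" for k t
  proof -
    have "norm (E k t) \<le> (LINT x|lborel. \<bar>f t x\<bar> * (1 / real (Suc k) * M))"
      unfolding E_def
    proof (rule Bochner_Integration.integral_norm_bound_integral)
      have [measurable]: "f t \<in> borel_measurable borel" "test t \<in> borel_measurable borel"
        "test_d1 i t \<in> borel_measurable borel" "cutoff_d1 \<epsilon> i \<in> borel_measurable borel" "cutoff_d2 \<epsilon> i \<in> borel_measurable borel"
        "(\<lambda>x. (C *v x) $ i) \<in> borel_measurable borel" for \<epsilon> i
        using t s by (auto intro!: borel_measurable_continuous_onI cont_f' test_continuous continuous_cut continuous_on_matrix_vector)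
      have i: "integrable lborel (\<lambda>x. \<bar>f t x\<bar> * (1 / real (Suc k) * M))"
        using int_f[of t] t s by (intro integrable_mult_left integrable_abs) auto
      show "norm (f t x * cutoff_error (1 / real (Suc k)) t x) \<le> \<bar>f t x\<bar> * (1 / real (Suc k) * M)" for x
        using cutoff_error_bound[of t "1 / real (Suc k)" x] t unfolding M_def[symmetric] norm_mult
        by (intro mult_mono) (auto simp: M0)
      then show "integrable lborel (\<lambda>x. f t x * cutoff_error (1 / real (Suc k)) t x)"
      proof (intro Bochner_Integration.integrable_bound[OF i] AE_I2)
        show "(\<lambda>x. f t x * cutoff_error (1 / real (Suc k)) t x) \<in> borel_measurable lborel" unfolding cutoff_error_def by measurable
      qed (use M0 in simp)
      show "integrable lborel (\<lambda>x. \<bar>f t x\<bar> * (1 / real (Suc k) * M))" by (rule i)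
    qed
    also have "\<dots> = 1 / real (Suc k) * M * (LINT x|lborel. \<bar>f t x\<bar>)" by simp
    also have "\<dots> \<le> 1 / real (Suc k) * M * B" using M0 by (intro mult_left_mono B t) auto
    finally show ?thesis by (simp add: mult.assoc del: of_nat_Suc)
  qed
  have "\<bar>Q k T - Q k s\<bar> \<le> 1 / real (Suc k) * (M * B * (T - s))" for k
  proof -
    have "(Q k has_real_derivative E k t) (at t)" if "s \<le> t" "t \<le> T" for t
      unfolding Q_def E_def by (rule truncated_pairing_deriv) (use that s in auto)
    from MVT2[OF s(2) this] obtain z where z: "s < z" "z < T" "Q k T - Q k s = (T - s) * E k z" by blast
    have "\<bar>Q k T - Q k s\<bar> = (T - s) * \<bar>E k z\<bar>" unfolding z(3) using s by (simp add: abs_mult)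
    also have "\<dots> \<le> (T - s) * (1 / real (Suc k) * (M * B))" using s z by (intro mult_left_mono E) auto
    finally show ?thesis by (simp add: mult_ac)
  qed
  moreover have "(\<lambda>k. 1 / real (Suc k) * (M * B * (T - s))) \<longlonglongrightarrow> 0"
    by (intro tendsto_mult_left_zero LIMSEQ_Suc[OF lim_1_over_n])
  ultimately have "(\<lambda>k. Q k T - Q k s) \<longlonglongrightarrow> 0"
    by (intro Lim_null_comparison[of "\<lambda>k. Q k T - Q k s"]) auto
  moreover have "(\<lambda>k. Q k T - Q k s) \<longlonglongrightarrow> (LINT x|lborel. f T x * test T x) - (LINT x|lborel. f s x * test s x)"
    unfolding Q_def using s T by (intro tendsto_diff pairing_untruncate) auto
  ultimately show ?thesis using LIMSEQ_unique by fastforce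
qed

text \<open>Let s tend to 0 in the conserved pairing: f(s) - f0 is small in L^1 against test
  functions bounded by 1, while f0 against the moving test function converges by domination.\<close>

lemma pairing_initial: "(LINT x|lborel. f T x * test T x) = (LINT x|lborel. f0 x * test 0 x)"
proof -
  \<comment> \<open>The denominator starts at 2, so that every \<open>s k\<close> is strictly below
    T.\<close>
  define s where "s k = T / real (Suc (Suc k))" for k
  have s: "0 < s k" "s k < T" for k using T by (auto simp: s_def divide_less_eq)
  have s0: "s \<longlonglongrightarrow> 0"
    unfolding s_def by (rule LIMSEQ_Suc[OF LIMSEQ_Suc[OF lim_const_over_n]])
  then have sr: "filterlim s (at_right 0) sequentially"
    unfolding filterlim_at using s by (auto intro!: always_eventually simp: less_imp_neq[OF s(1), symmetric])
  have m: "f (s k) \<in> borel_measurable borel" "test t \<in> borel_measurable borel" for k t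
    using borel_measurable_continuous_onI cont_f'[OF s(1)] test_continuous by blast+
  have [measurable]: "f0 \<in> borel_measurable borel" using borel_measurable_integrable[OF int_f0] by simp
  note [measurable] = m
  have bt: "\<bar>test (s k) x\<bar> \<le> 1" for k x using test_bounds(1)[of "s k" x] s(2)[of k] by simp
  have "(\<lambda>k. LINT x|lborel. (f (s k) x - f0 x) * test (s k) x) \<longlonglongrightarrow> 0"
  proof (rule Lim_null_comparison[OF _ filterlim_compose[OF L1_init sr]], intro always_eventually allI)
    fix k
    have i: "integrable lborel (\<lambda>x. f (s k) x - f0 x)" using int_f[OF s(1)] int_f0 by simp
    have le: "\<bar>(f (s k) x - f0 x) * test (s k) x\<bar> \<le> \<bar>f (s k) x - f0 x\<bar>" for x
      using bt[of k x] by (simp add: abs_mult mult_left_le)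
    show "norm (LINT x|lborel. (f (s k) x - f0 x) * test (s k) x) \<le> (LINT x|lborel. \<bar>f (s k) x - f0 x\<bar>)"
    proof (rule Bochner_Integration.integral_norm_bound_integral)
      show "integrable lborel (\<lambda>x. (f (s k) x - f0 x) * test (s k) x)"
        by (rule Bochner_Integration.integrable_bound[OF i]) (use le in auto)
    qed (use i le in auto)
  qed
  moreover have "(\<lambda>k. LINT x|lborel. f0 x * test (s k) x) \<longlonglongrightarrow> (LINT x|lborel. f0 x * test 0 x)"
  proof (rule integral_dominated_convergence[where w = "\<lambda>x. \<bar>f0 x\<bar>"])
    have "(\<lambda>k. test (s k) x) \<longlonglongrightarrow> test 0 x" for x
      by (rule isCont_tendsto_compose[OF DERIV_isCont[OF test_deriv_t] s0])
    then show "AE x in lborel. (\<lambda>k. f0 x * test (s k) x) \<longlonglongrightarrow> f0 x * test 0 x" by (intro AE_I2 tendsto_mult) auto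
    show "AE x in lborel. norm (f0 x * test (s k) x) \<le> \<bar>f0 x\<bar>" for k
      using bt by (intro AE_I2) (auto simp: abs_mult mult_left_le)
  qed (use int_f0 in auto)
  ultimately have "(\<lambda>k. (LINT x|lborel. (f (s k) x - f0 x) * test (s k) x) + (LINT x|lborel. f0 x * test (s k) x))
      \<longlonglongrightarrow> 0 + (LINT x|lborel. f0 x * test 0 x)" by (rule tendsto_add)
  moreover have "(LINT x|lborel. (f (s k) x - f0 x) * test (s k) x) + (LINT x|lborel. f0 x * test (s k) x)
      = (LINT x|lborel. f T x * test T x)" for k
  proof -
    have i: "integrable lborel (\<lambda>x. u x * test (s k) x)" if u: "integrable lborel u" for u
      by (rule Bochner_Integration.integrable_bound[OF u])
        (use bt borel_measurable_integrable[OF u] in \<open>auto simp: abs_mult mult_left_le\<close>)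
    have "(LINT x|lborel. (f (s k) x - f0 x) * test (s k) x) + (LINT x|lborel. f0 x * test (s k) x) = (LINT x|lborel. f (s k) x * test (s k) x)"
      using i[OF int_f[OF s(1)[of k]]] i[OF int_f0] by (simp add: left_diff_distrib)
    then show ?thesis using pairing_conserved[OF s] by simp
  qed
  ultimately have "(\<lambda>k. LINT x|lborel. f T x * test T x) \<longlonglongrightarrow> (LINT x|lborel. f0 x * test 0 x)" by simp
  then show ?thesis by (simp add: LIMSEQ_const_iff)
qed

end

text \<open>The backward wave has amplitude 1 and frequency \<xi> at time T, and frequency exp (-T
  C^T) \<xi> at time 0. Taking \<open>c\<close> equal to \<xi> . a centres the transform at a;
  frequency 0 gives conservation of mass.\<close>

theorem fourier_transform_solution:
  assumes "0 < T"
  shows "(LINT x|lborel. f T x * cos (\<xi> \<bullet> x - c))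
    = exp (- ((norm \<xi>)\<^sup>2 - (norm (mat_flow (- transpose C) T \<xi>))\<^sup>2) / 2) *
      (LINT x|lborel. f0 x * cos (mat_flow (- transpose C) T \<xi> \<bullet> x - c))"
  using pairing_initial[OF assms, where \<xi> = \<xi> and c = c]
  unfolding test_def[OF assms] dual_amp_def[OF assms] dual_freq_def[OF assms]
  by (simp add: mult.left_commute[of "f0 _"])

end

section \<open>Pointwise bounds and the theorem\<close>

context fp_duality
begin

text \<open>Invert the transform at \<open>a\<close> and interchange the integrals: moving B to the
  other side of the inner product turns the frequency integral, for fixed y, into the kernel at B^T
  y - a, to which the uniform bound applies.\<close>

lemma solution_gaussian_bound:
  assumes T: "0 < T" and \<eta>: "0 \<le> \<eta>" "\<eta> < 1"
    and small: "\<And>v. (norm (mat_flow (- transpose C) T v))\<^sup>2 \<le> \<eta> * (norm v)\<^sup>2"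
  shows "(2 * pi) ^ CARD('n) * \<bar>f T a\<bar> \<le> (2 * pi / (1 - \<eta>)) powr (real CARD('n) / 2) *
    (LINT y|lborel. \<bar>f0 y\<bar> * exp (- (norm (adjoint (mat_flow (- transpose C) T) y - a))\<^sup>2 / 2))"
proof -
  define B where "B = mat_flow (- transpose C) T"
  define M where "M = adjoint B"
  have lin: "linear B" unfolding B_def by (rule linear_mat_flow)
  have linM: "linear M" unfolding M_def by (rule adjoint_linear[OF lin])
  have [measurable]: "B \<in> borel_measurable borel" "M \<in> borel_measurable borel"
    using lin linM by (auto intro: linear_borel_measurable)
  have [measurable]: "f0 \<in> borel_measurable borel" using borel_measurable_integrable[OF int_f0] by simp
  define e where "e \<xi> = exp (- ((norm \<xi>)\<^sup>2 - (norm (B \<xi>))\<^sup>2) / 2)" for \<xi>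
  have [measurable]: "e \<in> borel_measurable borel" unfolding e_def by measurable
  \<comment> \<open>The contraction leaves Gaussian damping of rate (1 - \<eta>) / 2; this supplies
    the integrable transform required for inversion.\<close>
  have e: "integrable lborel e"
  proof (rule Bochner_Integration.integrable_bound[OF gaussian_integral(1)[of "(1 - \<eta>) / 2"]])
    have "- ((norm \<xi>)\<^sup>2 - (norm (B \<xi>))\<^sup>2) / 2 \<le> - ((1 - \<eta>) / 2) * (norm \<xi>)\<^sup>2" for \<xi>
      using small[of \<xi>] by (simp add: B_def field_simps)
    then show "AE \<xi> in lborel. norm (e \<xi>) \<le> norm (exp (- ((1 - \<eta>) / 2) * (norm \<xi>)\<^sup>2))"
      unfolding e_def by (intro AE_I2) (simp del: divide_minus_left)
  qed (use \<eta> in auto)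
  have phase: "B \<xi> \<bullet> y - \<xi> \<bullet> a = \<xi> \<bullet> (M y - a)" for \<xi> y
    by (simp add: M_def adjoint_works[OF lin] inner_diff_right)
  have \<Phi>: "(LINT x|lborel. f T x * cos (\<xi> \<bullet> (x - a))) = (LINT y|lborel. e \<xi> * f0 y * cos (\<xi> \<bullet> (M y - a)))" for \<xi>
    using fourier_transform_solution[OF T, of \<xi> "\<xi> \<bullet> a"]
    unfolding B_def[symmetric] e_def[symmetric] phase by (simp add: inner_diff_right mult.assoc)
  let ?G = "\<lambda>(\<xi>, y). e \<xi> * f0 y * cos (\<xi> \<bullet> (M y - a))"
  have G: "integrable (lborel \<Otimes>\<^sub>M lborel) ?G"
    by (rule Bochner_Integration.integrable_bound[OF integrable_pair_mult[OF e int_f0]])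
      (auto simp: abs_mult split_beta intro!: mult_right_le_one_le)
  have k: "\<bar>LINT \<xi>|lborel. e \<xi> * cos (\<xi> \<bullet> z)\<bar> \<le> (2 * pi / (1 - \<eta>)) powr (real CARD('n) / 2) * exp (- (norm z)\<^sup>2 / 2)" for z
    using gaussian_kernel_bound[OF lin \<eta>, of z] small unfolding B_def e_def by simp
  have "isCont (f T) a" using cont_f'[OF T] by (simp add: continuous_on_eq_continuous_at)
  from fourier_inversion_cos[OF int_f[OF T] this]
  have "(2 * pi) ^ CARD('n) * f T a = (LINT \<xi>|lborel. LINT y|lborel. e \<xi> * f0 y * cos (\<xi> \<bullet> (M y - a)))"
    unfolding \<Phi> using lborel_pair.integrable_fst[OF G] by simp
  also have "\<dots> = (LINT y|lborel. LINT \<xi>|lborel. e \<xi> * f0 y * cos (\<xi> \<bullet> (M y - a)))"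
    using lborel_pair.Fubini_integral[OF G] by simp
  finally have eq: "(2 * pi) ^ CARD('n) * f T a = (LINT y|lborel. LINT \<xi>|lborel. e \<xi> * f0 y * cos (\<xi> \<bullet> (M y - a)))" .
  have "(2 * pi) ^ CARD('n) * \<bar>f T a\<bar> = norm (LINT y|lborel. LINT \<xi>|lborel. e \<xi> * f0 y * cos (\<xi> \<bullet> (M y - a)))"
    unfolding eq[symmetric] by (simp add: abs_mult)
  also have "\<dots> \<le> (LINT y|lborel. (2 * pi / (1 - \<eta>)) powr (real CARD('n) / 2) * (\<bar>f0 y\<bar> * exp (- (norm (M y - a))\<^sup>2 / 2)))"
  proof (rule Bochner_Integration.integral_norm_bound_integral)
    show "integrable lborel (\<lambda>y. LINT \<xi>|lborel. e \<xi> * f0 y * cos (\<xi> \<bullet> (M y - a)))"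
      using lborel_pair.integrable_snd[OF G] by simp
    show "integrable lborel (\<lambda>y. (2 * pi / (1 - \<eta>)) powr (real CARD('n) / 2) * (\<bar>f0 y\<bar> * exp (- (norm (M y - a))\<^sup>2 / 2)))"
      by (intro integrable_mult_right Bochner_Integration.integrable_bound[OF int_f0])
        (auto simp: abs_mult intro!: mult_right_le_one_le)
    fix y
    have "norm (LINT \<xi>|lborel. e \<xi> * f0 y * cos (\<xi> \<bullet> (M y - a))) = \<bar>f0 y\<bar> * \<bar>LINT \<xi>|lborel. e \<xi> * cos (\<xi> \<bullet> (M y - a))\<bar>"
      by (simp add: abs_mult[symmetric] integral_mult_right_zero[symmetric] mult_ac del: integral_mult_right_zero)
    also have "\<dots> \<le> \<bar>f0 y\<bar> * ((2 * pi / (1 - \<eta>)) powr (real CARD('n) / 2) * exp (- (norm (M y - a))\<^sup>2 / 2))"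
      by (intro mult_left_mono k) auto
    finally show "norm (LINT \<xi>|lborel. e \<xi> * f0 y * cos (\<xi> \<bullet> (M y - a)))
        \<le> (2 * pi / (1 - \<eta>)) powr (real CARD('n) / 2) * (\<bar>f0 y\<bar> * exp (- (norm (M y - a))\<^sup>2 / 2))"
      by (simp add: mult_ac)
  qed
  finally show ?thesis unfolding M_def B_def by simp
qed

text \<open>With M the adjoint flow, 2 (M y . a) \<le> \<kappa> |a|^2 + |M y|^2 / \<kappa>. The
  first term lowers the decay rate in a, and \<eta> \<le> 2 \<kappa> \<epsilon> makes the second at
  most 2 \<epsilon> |y|^2, which the exponential moment pays for.\<close>

lemma solution_moment_bound:
  assumes T: "0 < T" and \<eta>: "0 \<le> \<eta>" "\<eta> < 1" and \<kappa>: "0 < \<kappa>" "\<eta> \<le> 2 * \<kappa> * \<epsilon>"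
    and small: "\<And>v. (norm (mat_flow (- transpose C) T v))\<^sup>2 \<le> \<eta> * (norm v)\<^sup>2"
    and nonneg: "AE x in lborel. 0 \<le> f0 x" and mom: "integrable lborel (\<lambda>x. exp (\<epsilon> * (norm x)\<^sup>2) * f0 x)"
  shows "\<bar>f T a\<bar> \<le> (1 / (2 * pi * (1 - \<eta>))) powr (real CARD('n) / 2) *
    exp (- ((1 - \<kappa>) / 2) * (norm a)\<^sup>2) * (LINT x|lborel. exp (\<epsilon> * (norm x)\<^sup>2) * f0 x)"
proof -
  let ?M = "adjoint (mat_flow (- transpose C) T)"
  have lin: "linear (mat_flow (- transpose C) T)" by (rule linear_mat_flow)
  have [measurable]: "?M \<in> borel_measurable borel" by (rule linear_borel_measurable[OF adjoint_linear[OF lin]])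
  have [measurable]: "f0 \<in> borel_measurable borel" using borel_measurable_integrable[OF int_f0] by simp
  have expo: "- (norm (?M y - a))\<^sup>2 / 2 \<le> - ((1 - \<kappa>) / 2) * (norm a)\<^sup>2 + \<epsilon> * (norm y)\<^sup>2" for y
  proof -
    have "(norm (?M y - a))\<^sup>2 = (norm (?M y))\<^sup>2 - 2 * (?M y \<bullet> a) + (norm a)\<^sup>2"
      by (simp add: power2_norm_eq_inner inner_diff_left inner_diff_right inner_commute)
    moreover have "2 * (?M y \<bullet> a) \<le> \<kappa> * (norm a)\<^sup>2 + (norm (?M y))\<^sup>2 / \<kappa>"
    proof -
      have "0 \<le> (norm (?M y - \<kappa> *\<^sub>R a))\<^sup>2" by simp
      also have "\<dots> = (norm (?M y))\<^sup>2 - 2 * \<kappa> * (?M y \<bullet> a) + \<kappa>\<^sup>2 * (norm a)\<^sup>2"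
        unfolding power2_norm_eq_inner
        by (simp add: inner_diff_left inner_diff_right inner_commute power2_eq_square algebra_simps)
      finally show ?thesis using \<kappa>(1) by (simp add: field_simps power2_eq_square)
    qed
    moreover have "(norm (?M y))\<^sup>2 / \<kappa> \<le> 2 * \<epsilon> * (norm y)\<^sup>2"
    proof -
      have "(norm (?M y))\<^sup>2 \<le> \<eta> * (norm y)\<^sup>2" by (rule norm_adjoint_sq_le[OF lin \<eta>(1) small])
      also have "\<dots> \<le> 2 * \<kappa> * \<epsilon> * (norm y)\<^sup>2" by (intro mult_right_mono \<kappa>) auto
      finally show ?thesis using \<kappa>(1) by (simp add: field_simps)
    qed
    moreover have "0 \<le> (norm (?M y))\<^sup>2" by simp
    ultimately have "- (norm (?M y - a))\<^sup>2 \<le> \<kappa> * (norm a)\<^sup>2 + 2 * \<epsilon> * (norm y)\<^sup>2 - (norm a)\<^sup>2" by linarith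
    then show ?thesis by (simp add: algebra_simps)
  qed
  have "(LINT y|lborel. \<bar>f0 y\<bar> * exp (- (norm (?M y - a))\<^sup>2 / 2))
      \<le> (LINT y|lborel. exp (- ((1 - \<kappa>) / 2) * (norm a)\<^sup>2) * (exp (\<epsilon> * (norm y)\<^sup>2) * f0 y))"
  proof (rule integral_mono_AE)
    show "integrable lborel (\<lambda>y. \<bar>f0 y\<bar> * exp (- (norm (?M y - a))\<^sup>2 / 2))"
      by (rule Bochner_Integration.integrable_bound[OF int_f0]) (auto simp: abs_mult intro!: mult_right_le_one_le)
    show "integrable lborel (\<lambda>y. exp (- ((1 - \<kappa>) / 2) * (norm a)\<^sup>2) * (exp (\<epsilon> * (norm y)\<^sup>2) * f0 y))"
      by (intro integrable_mult_right mom)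
    show "AE y in lborel. \<bar>f0 y\<bar> * exp (- (norm (?M y - a))\<^sup>2 / 2)
        \<le> exp (- ((1 - \<kappa>) / 2) * (norm a)\<^sup>2) * (exp (\<epsilon> * (norm y)\<^sup>2) * f0 y)"
      using nonneg
    proof eventually_elim
      case (elim y)
      have "exp (- (norm (?M y - a))\<^sup>2 / 2) \<le> exp (- ((1 - \<kappa>) / 2) * (norm a)\<^sup>2) * exp (\<epsilon> * (norm y)\<^sup>2)"
        unfolding exp_add[symmetric] exp_le_cancel_iff by (rule expo)
      from mult_right_mono[OF this elim] show ?case using elim by (simp add: mult_ac)
    qed
  qed
  also have "\<dots> = exp (- ((1 - \<kappa>) / 2) * (norm a)\<^sup>2) * (LINT y|lborel. exp (\<epsilon> * (norm y)\<^sup>2) * f0 y)"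
    by (rule integral_mult_right_zero)
  finally have le: "(2 * pi) ^ CARD('n) * \<bar>f T a\<bar> \<le> (2 * pi / (1 - \<eta>)) powr (real CARD('n) / 2) *
      (exp (- ((1 - \<kappa>) / 2) * (norm a)\<^sup>2) * (LINT y|lborel. exp (\<epsilon> * (norm y)\<^sup>2) * f0 y))"
    by (intro order_trans[OF solution_gaussian_bound[OF T \<eta> small] mult_left_mono]) auto
  have p2: "(2 * pi) ^ CARD('n) = (2 * pi) powr (real CARD('n) / 2) * (2 * pi) powr (real CARD('n) / 2)"
    by (simp add: powr_add[symmetric] powr_realpow)
  have "(2 * pi / (1 - \<eta>)) powr (real CARD('n) / 2)
      = (2 * pi) ^ CARD('n) * (1 / (2 * pi * (1 - \<eta>))) powr (real CARD('n) / 2)"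
  proof -
    have "2 * pi / (1 - \<eta>) = (2 * pi) * (2 * pi) * (1 / (2 * pi * (1 - \<eta>)))" using \<eta> by (simp add: field_simps)
    then show ?thesis by (simp only: p2 powr_mult)
  qed
  from le[unfolded this] show ?thesis by (simp add: mult.assoc)
qed

lemma mass_conservation: assumes "0 < T" shows "(LINT x|lborel. f T x) = (LINT x|lborel. f0 x)"
  using fourier_transform_solution[OF assms, of 0 0] linear_0[OF linear_mat_flow[of "- transpose C" T]] by simp

end

text \<open>The diagonal \<delta> extends the given entries by 0 outside S. It is fixed before datum
  and solution, so that a time threshold can be chosen from the coefficients first.\<close>

lemma fp_duality_intro:
  assumes "normalized D C"
  shows "\<exists>\<delta>. (\<forall>i. 0 \<le> \<delta> i) \<and> D = (\<chi> i j. if i = j then \<delta> i else 0) \<and>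
    (\<forall>f0 f. L1_plus f0 \<longrightarrow> fp_solution D C f0 f \<longrightarrow> (\<exists>ft fi fii. fp_duality \<delta> C f ft fi fii f0))"
proof -
  obtain S d where S: "\<forall>j\<in>S. 0 < d j" "D = (\<chi> i j. if i = j \<and> i \<in> S then d i else 0)"
    and sym: "(1/2) *\<^sub>R (C + transpose C) = D"
    using assms unfolding normalized_def by blast
  define \<delta> where "\<delta> i = (if i \<in> S then d i else 0)" for i
  have \<delta>: "0 \<le> \<delta> i" for i using S(1) by (auto simp: \<delta>_def less_imp_le)
  have D: "D = (\<chi> i j. if i = j then \<delta> i else 0)" unfolding S(2) \<delta>_def by (simp add: vec_eq_iff)
  have "\<exists>ft fi fii. fp_duality \<delta> C f ft fi fii f0" if "L1_plus f0" and sol: "fp_solution D C f0 f" for f0 f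
  proof -
    obtain ft fi fii where "fp_data \<delta> C f ft fi fii" using fp_solution_fp_data sol unfolding D by blast
    moreover have "fp_duality_axioms \<delta> C f f0"
      using \<delta> sym[unfolded D] that(1) sol unfolding fp_solution_def L1_plus_def by unfold_locales blast+
    ultimately show ?thesis unfolding fp_duality_def by blast
  qed
  with \<delta> D show ?thesis by blast
qed

text \<open>Real \<open>ln\<close> takes the same value at x and -x, so \<open>powr\<close> sees
  only the modulus of its base; hence a bound on |f(t)| controls
  \<open>f t x powr q\<close>.\<close>

lemma powr_abs: "\<bar>x\<bar> powr a = (x::real) powr a"
  by (simp add: abs_if powr_def ln_minus)

section \<open>From Gaussian decay to the weighted integral\<close>

lemma f_inf_pos: "0 < f_inf x"
  by (simp add: f_inf_def)

text \<open>The q-th power decays at rate (q+1)/4 and the weight grows at rate 1/2, leaving (q-1)/4.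
  Per pair of dimensions, its integral 4 pi / (q-1) times the factor 2 pi of the weight gives 8 pi^2
  / (q-1).\<close>

lemma weighted_power_integral_bound:
  fixes g :: "real^'n \<Rightarrow> real"
  assumes q: "1 < q" and E: "0 \<le> E"
    and g: "\<And>x. \<bar>g x\<bar> \<le> (q / (pi * (q + 1))) powr (real CARD('n) / 2) * exp (- ((q + 1) / (4 * q)) * (norm x)\<^sup>2) * E"
  shows "(\<integral>\<^sup>+x. ennreal (g x powr q * inverse (f_inf x)) \<partial>lborel) \<le>
    ennreal ((q / (pi * (q + 1))) powr (q * real CARD('n) / 2) * (8 * pi\<^sup>2 / (q - 1)) powr (real CARD('n) / 2) * E powr q)"
proof -
  define K where "K = (q / (pi * (q + 1))) powr (q * real CARD('n) / 2) * E powr q * (2 * pi) powr (real CARD('n) / 2)"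
  have c: "0 < (q - 1) / 4" using q by simp
  have "g x powr q * inverse (f_inf x) \<le> K * exp (- ((q - 1) / 4) * (norm x)\<^sup>2)" for x
  proof -
    have "g x powr q = \<bar>g x\<bar> powr q" by (simp add: powr_abs)
    also have "\<dots> \<le> ((q / (pi * (q + 1))) powr (real CARD('n) / 2) * exp (- ((q + 1) / (4 * q)) * (norm x)\<^sup>2) * E) powr q"
      using q by (intro powr_mono2 g) auto
    also have "\<dots> = (q / (pi * (q + 1))) powr (q * real CARD('n) / 2) * E powr q * exp (- ((q + 1) / (4 * q)) * (norm x)\<^sup>2 * q)"
      using q E by (simp add: powr_mult powr_powr exp_powr_real mult_ac)
    also have "- ((q + 1) / (4 * q)) * (norm x)\<^sup>2 * q = - ((q - 1) / 4) * (norm x)\<^sup>2 + - (norm x)\<^sup>2 / 2"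
      using q by (simp add: field_simps)
    finally have 1: "g x powr q \<le> (q / (pi * (q + 1))) powr (q * real CARD('n) / 2) * E powr q *
        exp (- ((q - 1) / 4) * (norm x)\<^sup>2 + - (norm x)\<^sup>2 / 2)" .
    have 2: "inverse (f_inf x) = (2 * pi) powr (real CARD('n) / 2) * exp (- (- (norm x)\<^sup>2 / 2))"
      by (simp add: f_inf_def powr_minus exp_minus)
    have "g x powr q * inverse (f_inf x) \<le> (q / (pi * (q + 1))) powr (q * real CARD('n) / 2) * E powr q *
        exp (- ((q - 1) / 4) * (norm x)\<^sup>2 + - (norm x)\<^sup>2 / 2) * inverse (f_inf x)"
      by (intro mult_right_mono 1) (use f_inf_pos[of x] in simp)
    also have "\<dots> = K * (exp (- ((q - 1) / 4) * (norm x)\<^sup>2 + - (norm x)\<^sup>2 / 2) * exp (- (- (norm x)\<^sup>2 / 2)))"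
      unfolding 2 K_def by (simp only: mult_ac)
    finally show ?thesis by (simp add: exp_add[symmetric])
  qed
  then have "(\<integral>\<^sup>+x. ennreal (g x powr q * inverse (f_inf x)) \<partial>lborel)
      \<le> (\<integral>\<^sup>+x. ennreal (K * exp (- ((q - 1) / 4) * (norm (x::real^'n))\<^sup>2)) \<partial>lborel)"
    by (intro nn_integral_mono ennreal_leI)
  also have "\<dots> = ennreal (LINT x|lborel. K * exp (- ((q - 1) / 4) * (norm (x::real^'n))\<^sup>2))"
    by (intro nn_integral_eq_integral integrable_mult_right gaussian_integral(1)[OF c]) (simp add: K_def)
  also have "(LINT x|lborel. K * exp (- ((q - 1) / 4) * (norm (x::real^'n))\<^sup>2)) = K * (pi / ((q - 1) / 4)) powr (real CARD('n) / 2)"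
    by (simp only: integral_mult_right_zero gaussian_integral(2)[OF c] DIM_cart DIM_real mult_1_right)
  also have "\<dots> = (q / (pi * (q + 1))) powr (q * real CARD('n) / 2) * (8 * pi\<^sup>2 / (q - 1)) powr (real CARD('n) / 2) * E powr q"
  proof -
    have "(8 * pi\<^sup>2 / (q - 1)) powr (real CARD('n) / 2) = (2 * pi) powr (real CARD('n) / 2) * (pi / ((q - 1) / 4)) powr (real CARD('n) / 2)"
      using q by (subst powr_mult[symmetric]) (auto simp: power2_eq_square field_simps)
    then show ?thesis by (simp add: K_def mult_ac)
  qed
  finally show ?thesis .
qed

text \<open>Here the quantifiers are put in order: the decay of the flow yields \<open>t0\<close>
  from \<eta>, hence from C, q and \<epsilon>, before any datum is introduced.\<close>

theorem hypercontractive_bound: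
  fixes D C :: "real^'d^'d"
  assumes A: "cond_A D" and C: "cond_C D C" and norm: "normalized D C" and q: "1 < q" and \<epsilon>: "0 < \<epsilon>"
  shows "\<exists>t0>0. \<forall>f0 f. L1_plus f0 \<and> integrable lborel (\<lambda>x. exp (\<epsilon> * (norm x)\<^sup>2) * f0 x) \<and>
      fp_solution D C f0 f \<longrightarrow>
      (\<forall>t\<ge>t0. (\<integral>\<^sup>+x. ennreal (f t x powr q * inverse (f_inf x)) \<partial>lborel) \<le>
          ennreal ((q / (pi * (q + 1))) powr (q * real CARD('d) / 2) *
            (8 * pi\<^sup>2 / (q - 1)) powr (real CARD('d) / 2) *
            (LINT x|lborel. exp (\<epsilon> * (norm x)\<^sup>2) * f0 x) powr q))"
proof -
  obtain \<delta> where \<delta>: "\<And>i. 0 \<le> \<delta> i" and D: "D = (\<chi> i j. if i = j then \<delta> i else 0)"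
    and dual: "\<And>f0 f. L1_plus f0 \<Longrightarrow> fp_solution D C f0 f \<Longrightarrow> \<exists>ft fi fii. fp_duality \<delta> C f ft fi fii f0"
    using fp_duality_intro[OF norm] by blast
  have sym: "(1/2) *\<^sub>R (C + transpose C) = D" using norm unfolding normalized_def by blast
  have psd: "0 \<le> x \<bullet> (D *v x)" for x using A unfolding cond_A_def by blast
  have ker: "D *v x = 0" if "x \<bullet> (D *v x) = 0" for x
  proof -
    have "(\<Sum>i\<in>UNIV. \<delta> i * (x $ i)\<^sup>2) = 0"
      using that unfolding D inner_vec_def by (simp add: diag_matrix_vector power2_eq_square mult_ac)
    then have "\<forall>i. \<delta> i * (x $ i)\<^sup>2 = 0" using \<delta> by (simp add: sum_nonneg_eq_0_iff)
    then show ?thesis unfolding D vec_eq_iff diag_matrix_vector by auto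
  qed
  have dissip: "v \<bullet> ((- transpose C) *v v) \<le> 0" for v
    using inner_symmetric_part(1)[OF sym, of v] psd[of v] by linarith
  \<comment> \<open>The first entry keeps 1 - \<eta> at least (q+1)/(2q), which controls the
    prefactor; the second is 2 \<kappa> \<epsilon>, the smallness required by the moment
    bound.\<close>
  define \<eta> where "\<eta> = min ((q - 1) / (2 * q)) ((q - 1) * \<epsilon> / q)"
  define \<kappa> where "\<kappa> = (q - 1) / (2 * q)"
  have "2 * \<kappa> * \<epsilon> = (q - 1) * \<epsilon> / q" using q by (simp add: \<kappa>_def field_simps)
  then have \<kappa>: "0 < \<kappa>" "\<eta> \<le> 2 * \<kappa> * \<epsilon>" using q by (simp_all add: \<kappa>_def \<eta>_def)
  have \<eta>0: "0 < \<eta>" using q \<epsilon> by (auto simp: \<eta>_def)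
  have \<eta>q: "(q + 1) / (2 * q) \<le> 1 - \<eta>"
  proof -
    have "\<eta> \<le> (q - 1) / (2 * q)" by (simp add: \<eta>_def)
    moreover have "(q - 1) / (2 * q) + (q + 1) / (2 * q) = 1" using q by (simp add: field_simps)
    ultimately show ?thesis by linarith
  qed
  have \<eta>1: "\<eta> < 1" using \<eta>q q by (smt (verit) divide_pos_pos)
  obtain t0 where t0: "0 < t0" "\<And>t v. t0 \<le> t \<Longrightarrow> (norm (mat_flow (- transpose C) t v))\<^sup>2 \<le> \<eta> * (norm v)\<^sup>2"
    using mat_flow_decay[OF dissip cond_C_strict_decay[OF psd ker sym C] \<eta>0] by blast
  show ?thesis
  proof (intro exI[of _ t0] conjI allI impI t0(1))
    fix f0 f t
    assume h: "L1_plus f0 \<and> integrable lborel (\<lambda>x. exp (\<epsilon> * (norm x)\<^sup>2) * f0 x) \<and> fp_solution D C f0 f"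
      and t: "t0 \<le> t"
    have nonneg: "AE x in lborel. 0 \<le> f0 x" using h unfolding L1_plus_def by blast
    define E where "E = (LINT x|lborel. exp (\<epsilon> * (norm x)\<^sup>2) * f0 x)"
    have E: "0 \<le> E" unfolding E_def by (rule integral_nonneg_AE) (use nonneg in auto)
    obtain ft fi fii where "fp_duality \<delta> C f ft fi fii f0" using dual h by blast
    then interpret fp_duality \<delta> C f ft fi fii f0 .
    have "\<bar>f t x\<bar> \<le> (q / (pi * (q + 1))) powr (real CARD('d) / 2) * exp (- ((q + 1) / (4 * q)) * (norm x)\<^sup>2) * E" for x
    proof -
      have "\<bar>f t x\<bar> \<le> (1 / (2 * pi * (1 - \<eta>))) powr (real CARD('d) / 2) * exp (- ((1 - \<kappa>) / 2) * (norm x)\<^sup>2) * E"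
        unfolding E_def
        by (rule solution_moment_bound[OF _ less_imp_le[OF \<eta>0] \<eta>1 \<kappa> t0(2)[OF t] nonneg]) (use t t0(1) h in auto)
      also have "(1 - \<kappa>) / 2 = (q + 1) / (4 * q)" using q by (simp add: \<kappa>_def field_simps)
      also have "(1 / (2 * pi * (1 - \<eta>))) powr (real CARD('d) / 2) * exp (- ((q + 1) / (4 * q)) * (norm x)\<^sup>2) * E
          \<le> (q / (pi * (q + 1))) powr (real CARD('d) / 2) * exp (- ((q + 1) / (4 * q)) * (norm x)\<^sup>2) * E"
      proof (intro mult_right_mono powr_mono2 E)
        have "1 / (2 * pi * (1 - \<eta>)) \<le> 1 / (2 * pi * ((q + 1) / (2 * q)))"
          using \<eta>q \<eta>1 q by (intro divide_left_mono mult_left_mono) auto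
        also have "2 * pi * ((q + 1) / (2 * q)) = pi * (q + 1) / q" using q by (simp add: field_simps)
        also have "1 / (pi * (q + 1) / q) = q / (pi * (q + 1))" by simp
        finally show "1 / (2 * pi * (1 - \<eta>)) \<le> q / (pi * (q + 1))" .
      qed (use \<eta>1 in auto)
      finally show ?thesis .
    qed
    from weighted_power_integral_bound[OF q E this]
    show "(\<integral>\<^sup>+x. ennreal (f t x powr q * inverse (f_inf x)) \<partial>lborel) \<le>
          ennreal ((q / (pi * (q + 1))) powr (q * real CARD('d) / 2) *
            (8 * pi\<^sup>2 / (q - 1)) powr (real CARD('d) / 2) *
            (LINT x|lborel. exp (\<epsilon> * (norm x)\<^sup>2) * f0 x) powr q)"
      unfolding E_def .
  qed
qed

section \<open>Relative entropies and part (ii)\<close>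

lemma f_inf_alt: "f_inf (x::real^'n) = (2 * pi) powr (- real CARD('n) / 2) * exp (- (1/2) * (norm x)\<^sup>2)"
  by (simp add: f_inf_def)

lemma f_inf_integral: "integrable lborel (f_inf :: real^'n \<Rightarrow> real)" "(LINT x|lborel. f_inf (x::real^'n)) = 1"
proof -
  show "integrable lborel (f_inf :: real^'n \<Rightarrow> real)"
    unfolding f_inf_alt[abs_def] by (intro integrable_mult_right gaussian_integral(1)) simp
  have "(LINT x|lborel. f_inf (x::real^'n)) = (2 * pi) powr (- real CARD('n) / 2) * (2 * pi) powr (real CARD('n) / 2)"
    unfolding f_inf_alt by (simp only: integral_mult_right_zero gaussian_integral(2)[of "1/2"] DIM_cart DIM_real) (simp add: mult.commute)
  then show "(LINT x|lborel. f_inf (x::real^'n)) = 1" by (simp add: powr_add[symmetric])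
qed

lemma powr_two: "x powr 2 = (x::real)\<^sup>2"
  using powr_abs[of x 2] powr_numeral[of "\<bar>x\<bar>"] by simp

text \<open>Young's inequality for the product of y and 1, with exponents p and p / (p-1).\<close>

lemma psi_nonneg:
  assumes "1 < p" "0 \<le> y" shows "0 \<le> psi p y"
proof -
  have "1 / p + 1 / (p / (p - 1)) = 1" using assms(1) by (simp add: field_simps)
  from Youngs_inequality[OF assms(1) _ this assms(2), of 1]
  have "y \<le> y powr p / p + (p - 1) / p" using assms(1) by simp
  then have "y * p \<le> (y powr p / p + (p - 1) / p) * p" using assms(1) by (intro mult_right_mono) auto
  also have "\<dots> = y powr p + (p - 1)" using assms(1) by (simp add: distrib_right)
  finally have "y * p \<le> y powr p + (p - 1)" .
  then show ?thesis using assms(1) by (simp add: psi_def algebra_simps)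
qed

text \<open>Since psi_2 (y) = (y-1)^2 / 2 and both functions have unit mass, the quadratic entropy
  is half of the weighted square integral minus 1.\<close>

lemma rel_entropy_2_le:
  fixes g :: "real^'n \<Rightarrow> real"
  assumes g: "integrable lborel g" "(LINT x|lborel. g x) = 1" and R: "0 \<le> R"
    and le: "(\<integral>\<^sup>+x. ennreal (g x powr 2 * inverse (f_inf x)) \<partial>lborel) \<le> ennreal R"
  shows "rel_entropy 2 g f_inf \<le> ennreal (1 / 2 * (R - 1))"
proof -
  let ?h = "\<lambda>x. g x powr 2 * inverse (f_inf x)"
  have [measurable]: "g \<in> borel_measurable borel" "(f_inf :: real^'n \<Rightarrow> real) \<in> borel_measurable borel"
    using borel_measurable_integrable[OF g(1)] borel_measurable_integrable[OF f_inf_integral(1)] by simp_all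
  have pos: "0 \<le> ?h x" for x using f_inf_pos[of x] by simp
  have h: "integrable lborel ?h"
    by (rule integrableI_nonneg) (use pos le in \<open>auto intro: order.strict_trans1\<close>)
  have "ennreal (LINT x|lborel. ?h x) \<le> ennreal R"
    using le nn_integral_eq_integral[OF h] pos by simp
  then have hR: "(LINT x|lborel. ?h x) \<le> R" using R by simp
  have eq: "psi 2 (g x / f_inf x) * f_inf x = (?h x - 2 * g x + f_inf x) / 2" for x
    using f_inf_pos[of x] by (simp add: psi_def powr_two power2_eq_square field_simps)
  have "0 \<le> psi 2 (g x / f_inf x) * f_inf x" for x
  proof -
    have "psi 2 y = (y - 1)\<^sup>2 / 2" for y by (simp add: psi_def powr_two power2_eq_square field_simps)
    then have "0 \<le> psi 2 (g x / f_inf x)" by (metis divide_nonneg_nonneg zero_le_numeral zero_le_power2)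
    then show ?thesis using f_inf_pos[of x] by simp
  qed
  then have "rel_entropy 2 g f_inf = ennreal (LINT x|lborel. (?h x - 2 * g x + f_inf x) / 2)"
    unfolding rel_entropy_def eq
    by (intro nn_integral_eq_integral AE_I2 integrable_divide_zero Bochner_Integration.integrable_add
        Bochner_Integration.integrable_diff integrable_mult_right h g(1) f_inf_integral(1)) auto
  also have "(LINT x|lborel. (?h x - 2 * g x + f_inf x) / 2) = ((LINT x|lborel. ?h x) - 2 * 1 + 1) / 2"
    using h g f_inf_integral[where 'n = 'n] by simp
  also have "ennreal \<dots> \<le> ennreal (1 / 2 * (R - 1))" using hR by (intro ennreal_leI) simp
  finally show ?thesis .
qed

text \<open>Hoelder's inequality with respect to the measure \<open>f_inf\<close> dx. Unit mass
  makes A the integral of (f0 / f_inf)^p. The exponent (p-1)/(4p) equals 1/(4p') for the conjugate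
  exponent p', so the weight to the power p' is exp (|x|^2 / 4), whose Gaussian mean is
  2^(d/2).\<close>

lemma gaussian_moment_le_entropy:
  fixes f0 :: "real^'n \<Rightarrow> real"
  assumes p: "1 < p" and f0: "L1_plus f0" "(LINT x|lborel. f0 x) = 1" and fin: "rel_entropy p f0 f_inf < \<infinity>"
  defines "A \<equiv> p * (p - 1) * enn2real (rel_entropy p f0 f_inf) + 1"
  shows "integrable lborel (\<lambda>x. exp ((p - 1) / (4 * p) * (norm x)\<^sup>2) * f0 x)"
    and "(LINT x|lborel. exp ((p - 1) / (4 * p) * (norm x)\<^sup>2) * f0 x) \<le> A powr (1 / p) * 2 powr (real CARD('n) / 2 * (1 - 1 / p))"
proof -
  have if0: "integrable lborel f0" and nonneg: "AE x in lborel. 0 \<le> f0 x" using f0(1) unfolding L1_plus_def by auto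
  have [measurable]: "f0 \<in> borel_measurable borel" "(f_inf :: real^'n \<Rightarrow> real) \<in> borel_measurable borel"
    using borel_measurable_integrable[OF if0] borel_measurable_integrable[OF f_inf_integral(1)] by simp_all
  define k where "k x = psi p (f0 x / f_inf x) * f_inf x" for x
  have [measurable]: "k \<in> borel_measurable borel" unfolding k_def psi_def by measurable
  have k0: "AE x in lborel. 0 \<le> k x" using nonneg
  proof eventually_elim
    case (elim x)
    then show ?case using psi_nonneg[OF p, of "f0 x / f_inf x"] f_inf_pos[of x] by (simp add: k_def)
  qed
  have ik: "integrable lborel k"
    by (rule integrableI_nonneg) (use k0 fin in \<open>auto simp: rel_entropy_def k_def\<close>)
  have "(LINT x|lborel. k x) = enn2real (rel_entropy p f0 f_inf)"
    unfolding rel_entropy_def k_def[symmetric] by (rule integral_eq_nn_integral) (use k0 in auto)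
  then have A: "A = p * (p - 1) * (LINT x|lborel. k x) + 1" by (simp add: A_def)
  have A1: "1 \<le> A" using p by (simp add: A_def)
  define h where "h x = (f0 x / f_inf x) powr p * f_inf x" for x
  have hk: "h x = p * (p - 1) * k x + p * (f0 x - f_inf x) + f_inf x" for x
    using p f_inf_pos[of x] unfolding h_def k_def psi_def by (simp add: field_simps)
  have ih: "integrable lborel h" unfolding hk[abs_def]
    by (intro Bochner_Integration.integrable_add Bochner_Integration.integrable_diff integrable_mult_right
        ik if0 f_inf_integral(1))
  have hA: "(LINT x|lborel. h x) = A" unfolding hk A using ik if0 f_inf_integral[where 'n = 'n] f0(2) by simp
  define p' where "p' = p / (p - 1)"
  have p': "1 < p'" "1 / p + 1 / p' = 1" "1 / p' = 1 - 1 / p" using p by (auto simp: p'_def field_simps)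
  define w where "w x = exp ((p - 1) / (4 * p) * (norm x)\<^sup>2)" for x :: "real^'n"
  have wp: "w x powr p' = exp ((norm x)\<^sup>2 / 4)" for x
  proof -
    have "(p - 1) / (4 * p) * (norm x)\<^sup>2 * p' = (norm x)\<^sup>2 / 4"
      unfolding p'_def times_divide_times_eq times_divide_eq_left using p by (subst frac_eq_eq) auto
    then show ?thesis by (simp add: w_def exp_powr_real)
  qed
  \<comment> \<open>The norms of f0 / f_inf in L^p and of the weight in L^p', both with respect to
    \<open>f_inf\<close> dx.\<close>
  define \<alpha> \<beta> where "\<alpha> = A powr (1 / p)" and "\<beta> = 2 powr (real CARD('n) / 2 * (1 / p'))"
  have \<alpha>: "0 < \<alpha>" "\<alpha> powr p = A" and \<beta>: "0 < \<beta>" "\<beta> powr p' = 2 powr (real CARD('n) / 2)"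
    using A1 p p'(1) by (auto simp: \<alpha>_def \<beta>_def powr_powr)
  define G where "G x = (2 * pi) powr (- real CARD('n) / 2) * exp (- (1/4) * (norm x)\<^sup>2)" for x :: "real^'n"
  have G: "G x = f_inf x * exp ((norm x)\<^sup>2 / 4)" for x
    unfolding G_def f_inf_alt mult.assoc exp_add[symmetric] by simp
  have iG: "integrable lborel G" unfolding G_def by (intro integrable_mult_right gaussian_integral(1)) simp
  have "(LINT x|lborel. G x) = (2 * pi) powr (- real CARD('n) / 2) * (pi * 4) powr (real CARD('n) / 2)"
    unfolding G_def by (simp only: integral_mult_right_zero gaussian_integral(2)[of "1/4"] DIM_cart DIM_real) simp
  also have "(pi * 4) powr (real CARD('n) / 2) = 2 powr (real CARD('n) / 2) * (2 * pi) powr (real CARD('n) / 2)"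
    by (subst powr_mult[symmetric]) (simp_all add: mult.commute)
  also have "(2 * pi) powr (- real CARD('n) / 2) * (2 powr (real CARD('n) / 2) * (2 * pi) powr (real CARD('n) / 2)) = 2 powr (real CARD('n) / 2)"
    by (simp add: powr_minus)
  finally have G1: "(LINT x|lborel. G x) = 2 powr (real CARD('n) / 2)" .
  \<comment> \<open>Young's inequality for the two factors divided by their norms, multiplied back
    by \<open>f_inf\<close>. This pointwise majorant gives integrability and the bound together,
    since its integral is \<alpha> \<beta> (1/p + 1/p').\<close>
  define b where "b x = \<alpha> * \<beta> * (h x / (A * p) + G x / (2 powr (real CARD('n) / 2) * p'))" for x
  have ib: "integrable lborel b" unfolding b_def using ih iG by simp
  have le: "AE x in lborel. w x * f0 x \<le> b x" using nonneg
  proof eventually_elim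
    case (elim x)
    define y where "y = f0 x / f_inf x"
    have y: "0 \<le> y" "f0 x = y * f_inf x" using elim f_inf_pos[of x] by (auto simp: y_def)
    have "(y / \<alpha>) * (w x / \<beta>) \<le> (y / \<alpha>) powr p / p + (w x / \<beta>) powr p' / p'"
      by (rule Youngs_inequality[OF p p'(1,2)]) (use y \<alpha> \<beta> in \<open>auto simp: w_def\<close>)
    also have "\<dots> = y powr p / (A * p) + exp ((norm x)\<^sup>2 / 4) / (2 powr (real CARD('n) / 2) * p')"
      using y \<alpha> \<beta> by (simp add: powr_divide wp w_def[symmetric])
    finally have "\<alpha> * \<beta> * ((y / \<alpha>) * (w x / \<beta>)) * f_inf x
        \<le> \<alpha> * \<beta> * (y powr p / (A * p) + exp ((norm x)\<^sup>2 / 4) / (2 powr (real CARD('n) / 2) * p')) * f_inf x"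
      using \<alpha> \<beta> f_inf_pos[of x] by (intro mult_right_mono mult_left_mono) auto
    moreover have "\<alpha> * \<beta> * ((y / \<alpha>) * (w x / \<beta>)) * f_inf x = w x * f0 x" using \<alpha> \<beta> y by simp
    moreover have "\<alpha> * \<beta> * (y powr p / (A * p) + exp ((norm x)\<^sup>2 / 4) / (2 powr (real CARD('n) / 2) * p')) * f_inf x = b x"
      unfolding b_def h_def G y_def by (simp add: algebra_simps)
    ultimately show ?case by simp
  qed
  have int: "integrable lborel (\<lambda>x. w x * f0 x)"
  proof (rule Bochner_Integration.integrable_bound[OF ib])
    show "AE x in lborel. norm (w x * f0 x) \<le> norm (b x)" using le nonneg
    proof eventually_elim
      case (elim x)
      then have "0 \<le> w x * f0 x" by (simp add: w_def)
      then show ?case using elim by simp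
    qed
  qed (simp add: w_def)
  then show "integrable lborel (\<lambda>x. exp ((p - 1) / (4 * p) * (norm x)\<^sup>2) * f0 x)" by (simp add: w_def)
  have "(LINT x|lborel. w x * f0 x) \<le> (LINT x|lborel. b x)" by (rule integral_mono_AE[OF int ib le])
  also have "\<dots> = \<alpha> * \<beta> * (A / (A * p) + 2 powr (real CARD('n) / 2) / (2 powr (real CARD('n) / 2) * p'))"
    unfolding b_def using ih iG by (simp add: hA G1)
  also have "\<dots> = \<alpha> * \<beta> * (1 / p + 1 / p')" using A1 by simp
  finally show "(LINT x|lborel. exp ((p - 1) / (4 * p) * (norm x)\<^sup>2) * f0 x) \<le> A powr (1 / p) * 2 powr (real CARD('n) / 2 * (1 - 1 / p))"
    unfolding p'(2) w_def \<alpha>_def \<beta>_def p'(3) by simp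
qed

text \<open>Each factor is an n-th power apart from that of A; per dimension the product is 2/(3 pi)
  times 2 sqrt 2 pi times 2 / 2^(1/p).\<close>

lemma constant_identity:
  fixes A p :: real and n :: nat
  assumes p: "0 < p" and A: "0 \<le> A"
  shows "(2 / (pi * (2 + 1))) powr (2 * real n / 2) * (8 * pi\<^sup>2 / (2 - 1)) powr (real n / 2) *
      (A powr (1 / p) * 2 powr (real n / 2 * (1 - 1 / p))) powr 2
    = (8 * sqrt 2 / (3 * 2 powr (1 / p))) ^ n * A powr (2 / p)"
proof -
  have 1: "(2 / (pi * (2 + 1))) powr (2 * real n / 2) = (2 / (3 * pi)) ^ n" by (simp add: powr_realpow mult.commute)
  have "(8 * pi\<^sup>2 / (2 - 1)) powr (real n / 2) = ((8 * pi\<^sup>2) powr (1 / 2)) powr real n"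
    by (simp add: powr_powr)
  also have "\<dots> = (2 * sqrt 2 * pi) ^ n"
  proof -
    have "sqrt (8 * pi\<^sup>2) = 2 * sqrt 2 * pi"
      by (rule real_sqrt_unique) (simp_all add: power_mult_distrib)
    then show ?thesis by (simp add: powr_half_sqrt powr_realpow)
  qed
  finally have 2: "(8 * pi\<^sup>2 / (2 - 1)) powr (real n / 2) = (2 * sqrt 2 * pi) ^ n" .
  have "(2 powr (real n / 2 * (1 - 1 / p))) powr 2 = (2 powr (1 - 1 / p)) powr real n" by (simp add: powr_powr mult.commute)
  also have "\<dots> = (2 / 2 powr (1 / p)) ^ n" by (simp add: powr_diff powr_realpow)
  finally have 3: "(2 powr (real n / 2 * (1 - 1 / p))) powr 2 = (2 / 2 powr (1 / p)) ^ n" .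
  have 4: "(A powr (1 / p)) powr 2 = A powr (2 / p)" by (simp add: powr_powr)
  have "2 / (3 * pi) * (2 * sqrt 2 * pi) * (2 / 2 powr (1 / p)) = 8 * sqrt 2 / (3 * 2 powr (1 / p))" by simp
  then show ?thesis unfolding 1 2 powr_mult 3 4 by (simp add: power_mult_distrib[symmetric] mult_ac)
qed

theorem theorem4p3:
  fixes D C :: "real^'d^'d"
  assumes "cond_A D" and "cond_B C" and "cond_C D C" and "normalized D C"
  shows
    "(\<forall>q>1. \<forall>\<epsilon>>0. \<exists>t0>0. \<forall>f0 f.
        L1_plus f0 \<and> (LINT x|lborel. f0 x) = 1 \<and>
        integrable lborel (\<lambda>x. exp (\<epsilon> * (norm x)\<^sup>2) * f0 x) \<and>
        fp_solution D C f0 f \<longrightarrow>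
        (\<forall>t\<ge>t0.
          (\<integral>\<^sup>+x. ennreal (f t x powr q * inverse (f_inf x)) \<partial>lborel) \<le>
          ennreal ((q / (pi * (q + 1))) powr (q * real CARD('d) / 2) *
            (8 * pi\<^sup>2 / (q - 1)) powr (real CARD('d) / 2) *
            (LINT x|lborel. exp (\<epsilon> * (norm x)\<^sup>2) * f0 x) powr q)))
     \<and>
     (\<forall>p. 1 < p \<and> p < 2 \<longrightarrow> (\<exists>t0>0. \<forall>f0 f.
        L1_plus f0 \<and> (LINT x|lborel. f0 x) = 1 \<and>
        (\<exists>\<epsilon>>0. integrable lborel (\<lambda>x. exp (\<epsilon> * (norm x)\<^sup>2) * f0 x)) \<and>
        fp_solution D C f0 f \<and>
        rel_entropy p f0 f_inf < \<infinity> \<longrightarrow>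
        (\<forall>t\<ge>t0.
          rel_entropy 2 (f t) f_inf \<le>
          ennreal (1 / 2 *
            ((8 * sqrt 2 / (3 * 2 powr (1 / p))) ^ CARD('d) *
             (p * (p - 1) * enn2real (rel_entropy p f0 f_inf) + 1) powr (2 / p) - 1)))))"
proof (intro conjI allI impI)
  fix q \<epsilon> :: real assume "1 < q" "0 < \<epsilon>"
  from hypercontractive_bound[OF assms(1,3,4) this]
  show "\<exists>t0>0. \<forall>f0 f.
        L1_plus f0 \<and> (LINT x|lborel. f0 x) = 1 \<and>
        integrable lborel (\<lambda>x. exp (\<epsilon> * (norm x)\<^sup>2) * f0 x) \<and>
        fp_solution D C f0 f \<longrightarrow>
        (\<forall>t\<ge>t0.
          (\<integral>\<^sup>+x. ennreal (f t x powr q * inverse (f_inf x)) \<partial>lborel) \<le>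
          ennreal ((q / (pi * (q + 1))) powr (q * real CARD('d) / 2) *
            (8 * pi\<^sup>2 / (q - 1)) powr (real CARD('d) / 2) *
            (LINT x|lborel. exp (\<epsilon> * (norm x)\<^sup>2) * f0 x) powr q))"
    by blast
next
  fix p :: real assume "1 < p \<and> p < 2"
  then have p: "1 < p" by simp
  \<comment> \<open>Computed from p alone, so that \<open>t0\<close> is the same for all data of
    finite entropy; the entropy itself controls this moment.\<close>
  define \<epsilon> where "\<epsilon> = (p - 1) / (4 * p)"
  have \<epsilon>: "0 < \<epsilon>" using p by (simp add: \<epsilon>_def)
  have q: "1 < (2::real)" by simp
  obtain t0 where t0: "0 < t0" and bound: "\<And>f0 f t. L1_plus f0 \<Longrightarrow> integrable lborel (\<lambda>x. exp (\<epsilon> * (norm x)\<^sup>2) * f0 x) \<Longrightarrow>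
      fp_solution D C f0 f \<Longrightarrow> t0 \<le> t \<Longrightarrow>
      (\<integral>\<^sup>+x. ennreal (f t x powr 2 * inverse (f_inf x)) \<partial>lborel) \<le>
          ennreal ((2 / (pi * (2 + 1))) powr (2 * real CARD('d) / 2) *
            (8 * pi\<^sup>2 / (2 - 1)) powr (real CARD('d) / 2) *
            (LINT x|lborel. exp (\<epsilon> * (norm x)\<^sup>2) * f0 x) powr 2)"
    using hypercontractive_bound[OF assms(1,3,4) q \<epsilon>] by blast
  show "\<exists>t0>0. \<forall>f0 f.
        L1_plus f0 \<and> (LINT x|lborel. f0 x) = 1 \<and>
        (\<exists>\<epsilon>>0. integrable lborel (\<lambda>x. exp (\<epsilon> * (norm x)\<^sup>2) * f0 x)) \<and>
        fp_solution D C f0 f \<and>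
        rel_entropy p f0 f_inf < \<infinity> \<longrightarrow>
        (\<forall>t\<ge>t0.
          rel_entropy 2 (f t) f_inf \<le>
          ennreal (1 / 2 *
            ((8 * sqrt 2 / (3 * 2 powr (1 / p))) ^ CARD('d) *
             (p * (p - 1) * enn2real (rel_entropy p f0 f_inf) + 1) powr (2 / p) - 1)))"
  proof (intro exI[of _ t0] conjI allI impI t0)
    fix f0 f t
    assume h: "L1_plus f0 \<and> (LINT x|lborel. f0 x) = 1 \<and>
        (\<exists>\<epsilon>>0. integrable lborel (\<lambda>x. exp (\<epsilon> * (norm x)\<^sup>2) * f0 x)) \<and>
        fp_solution D C f0 f \<and> rel_entropy p f0 f_inf < \<infinity>" and t: "t0 \<le> t"
    define A where "A = p * (p - 1) * enn2real (rel_entropy p f0 f_inf) + 1"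
    have A: "0 \<le> A" using p by (simp add: A_def)
    define E where "E = (LINT x|lborel. exp (\<epsilon> * (norm x)\<^sup>2) * f0 x)"
    have mom: "integrable lborel (\<lambda>x. exp (\<epsilon> * (norm x)\<^sup>2) * f0 x)"
      and E: "E \<le> A powr (1 / p) * 2 powr (real CARD('d) / 2 * (1 - 1 / p))"
      using gaussian_moment_le_entropy[OF p, of f0] h unfolding \<epsilon>_def E_def A_def by blast+
    have E0: "0 \<le> E" unfolding E_def by (rule integral_nonneg_AE) (use h in \<open>auto simp: L1_plus_def\<close>)
    define c where "c = (2 / (pi * (2 + 1))) powr (2 * real CARD('d) / 2) * (8 * pi\<^sup>2 / (2 - 1)) powr (real CARD('d) / 2)"
    have "(\<integral>\<^sup>+x. ennreal (f t x powr 2 * inverse (f_inf x)) \<partial>lborel) \<le> ennreal (c * E powr 2)"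
      unfolding c_def E_def by (rule bound) (use h mom t in auto)
    also have "\<dots> \<le> ennreal (c * (A powr (1 / p) * 2 powr (real CARD('d) / 2 * (1 - 1 / p))) powr 2)"
      by (intro ennreal_leI mult_left_mono powr_mono2 E E0) (simp_all add: c_def)
    finally have le: "(\<integral>\<^sup>+x. ennreal (f t x powr 2 * inverse (f_inf x)) \<partial>lborel)
        \<le> ennreal ((8 * sqrt 2 / (3 * 2 powr (1 / p))) ^ CARD('d) * A powr (2 / p))"
      unfolding c_def constant_identity[OF less_trans[OF zero_less_one p] A] .
    have "0 < t" using t t0 by simp
    moreover obtain \<delta> ft fi fii where "fp_duality \<delta> C f ft fi fii f0"
      using fp_duality_intro[OF assms(4)] h by blast
    \<comment> \<open>Mass is conserved, so the linear part of psi_2 integrates to a constant at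
      time t.\<close>
    ultimately have "integrable lborel (f t)" "(LINT x|lborel. f t x) = 1"
      using fp_duality.int_f fp_duality.mass_conservation h by metis+
    from rel_entropy_2_le[OF this _ le]
    show "rel_entropy 2 (f t) f_inf \<le> ennreal (1 / 2 *
            ((8 * sqrt 2 / (3 * 2 powr (1 / p))) ^ CARD('d) *
             (p * (p - 1) * enn2real (rel_entropy p f0 f_inf) + 1) powr (2 / p) - 1))"
      unfolding A_def by simp
  qed
qed

end
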